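(* Let $\Theta$ be an inner function on the unit disc $\mathbb{D}$. Then $\Theta$ satisfies the Sharp Invertibility Property (SIP) if and only if it has Maximal Asymptotic Growth (MAG), that is, $$\lim_{t\to 1}\eta_\Theta(t)=\sup_{0<t<1}\eta_\Theta(t)=1 .$$
   Context: $\mathbb{D}$ is the open unit disc in $\mathbb{C}$; $H^\infty$ is the algebra of bounded analytic functions on $\mathbb{D}$ with norm $\|f\|_\infty=\sup_{\mathbb{D}}|f|$. $\Theta\in H^\infty$ is inner if it has radial limits of modulus $1$ at almost every point of $\partial\mathbb{D}$. The quotient algebra $H^\infty/\Theta H^\infty$ carries the norm $\|[f]\|=\inf\{\|f+g\Theta\|_\infty: g\in H^\infty\}$. $\mathcal{Z}(\Theta)=\{z\in\mathbb{D}:\Theta(z)=0\}$. Sharp Invertibility Property (SIP): for every $\varepsilon>0$ there exists $\delta>0$ such that for every $f\in H^\infty$, the conditions $\|[f]\|\le 1$ and $\inf_{\mathcal{Z}(\Theta)}|f|\ge 1-\delta$ imply that $[f]$ is invertible in $H^\infty/\Theta H^\infty$ and $\|[f]^{-1}\|\le 1+\varepsilon$. Pseudohyperbolic distance: $\rho(z,w)=\left|\frac{z-w}{1-\bar w z}\right|$ for $z,w\in\mathbb{D}$, and $\rho(z,A)=\inf_{a\in A}\rho(z,a)$. For $0<t<1$, $\eta_\Theta(t)=\inf\{|\Theta(z)|: z\in\mathbb{D},\ \rho(z,\mathcal{Z}(\Theta))\ge t\}$. Infima over the empty set are $+\infty$ (so if $\Theta$ has no zeros, the conditions $\inf_{\mathcal{Z}(\Theta)}|f|\ge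 1-\delta$ and $\rho(z,\mathcal{Z}(\Theta))\ge t$ hold vacuously). *)

theory Defs
  imports "HOL-Complex_Analysis.Complex_Analysis" "HOL-Algebra.QuotRing"
begin

abbreviation unit_disc :: "complex set" where
  "unit_disc \<equiv> ball 0 1"

(* Elements are represented extensionally (value undefined off the disc), so that equality in the
   carrier is equality of functions on the disc. *)
definition Hinf :: "(complex \<Rightarrow> complex) ring" where
  "Hinf = \<lparr>carrier = {f \<in> extensional unit_disc. f holomorphic_on unit_disc \<and> bounded (f ` unit_disc)},
           mult = (\<lambda>f g. \<lambda>z\<in>unit_disc. f z * g z),
           one = (\<lambda>z\<in>unit_disc. 1),
           zero = (\<lambda>z\<in>unit_disc. 0),
           add = (\<lambda>f g. \<lambda>z\<in>unit_disc. f z + g z)\<rparr>"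

definition sup_norm :: "(complex \<Rightarrow> complex) \<Rightarrow> real" where
  "sup_norm f = (SUP z\<in>unit_disc. cmod (f z))"

definition inner_function :: "(complex \<Rightarrow> complex) \<Rightarrow> bool" where
  "inner_function \<Theta> \<longleftrightarrow> \<Theta> \<in> carrier Hinf \<and>
     (AE t in lebesgue_on {0..2 * pi}.
        \<exists>l. ((\<lambda>r. \<Theta> (complex_of_real r * cis t)) \<longlongrightarrow> l) (at_left 1) \<and> cmod l = 1)"

definition Hinf_quot :: "(complex \<Rightarrow> complex) \<Rightarrow> (complex \<Rightarrow> complex) set ring" where
  "Hinf_quot \<Theta> = Hinf Quot (PIdl\<^bsub>Hinf\<^esub> \<Theta>)"

definition quot_class :: "(complex \<Rightarrow> complex) \<Rightarrow> (complex \<Rightarrow> complex) \<Rightarrow> (complex \<Rightarrow> complex) set" where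
  "quot_class \<Theta> f = (PIdl\<^bsub>Hinf\<^esub> \<Theta>) +>\<^bsub>Hinf\<^esub> f"

(* The quotient norm is taken on cosets, so that it applies to inverses in the quotient ring;
   quot_norm_quot_class below gives the form in terms of a representative. *)
definition quot_norm :: "(complex \<Rightarrow> complex) set \<Rightarrow> real" where
  "quot_norm C = (INF h\<in>C. sup_norm h)"

definition zeros :: "(complex \<Rightarrow> complex) \<Rightarrow> complex set" where
  "zeros \<Theta> = {z \<in> unit_disc. \<Theta> z = 0}"

(* The infima in SIP, rho_set and eta are taken in ereal, where the infimum of the empty set
   is \<infinity>. *)
definition SIP :: "(complex \<Rightarrow> complex) \<Rightarrow> bool" where
  "SIP \<Theta> \<longleftrightarrow> (\<forall>\<epsilon>>0. \<exists>\<delta>>0. \<forall>f\<in>carrier Hinf.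
      quot_norm (quot_class \<Theta> f) \<le> 1 \<and> (INF z\<in>zeros \<Theta>. ereal (cmod (f z))) \<ge> ereal (1 - \<delta>) \<longrightarrow>
      quot_class \<Theta> f \<in> Units (Hinf_quot \<Theta>) \<and>
      quot_norm (m_inv (Hinf_quot \<Theta>) (quot_class \<Theta> f)) \<le> 1 + \<epsilon>)"

definition rho :: "complex \<Rightarrow> complex \<Rightarrow> real" where
  "rho z w = cmod ((z - w) / (1 - cnj w * z))"

definition rho_set :: "complex \<Rightarrow> complex set \<Rightarrow> ereal" where
  "rho_set z A = (INF a\<in>A. ereal (rho z a))"

definition eta :: "(complex \<Rightarrow> complex) \<Rightarrow> real \<Rightarrow> ereal" where
  "eta \<Theta> t = (INF z\<in>{z \<in> unit_disc. rho_set z (zeros \<Theta>) \<ge> ereal t}. ereal (cmod (\<Theta> z)))"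

definition MAG :: "(complex \<Rightarrow> complex) \<Rightarrow> bool" where
  "MAG \<Theta> \<longleftrightarrow> (eta \<Theta> \<longlongrightarrow> 1) (at_left 1) \<and> (SUP t\<in>{0<..<1}. eta \<Theta> t) = 1"

lemma bounded_image_mult:
  fixes f g :: "complex \<Rightarrow> complex"
  assumes "bounded (f ` S)" "bounded (g ` S)"
  shows "bounded ((\<lambda>z. f z * g z) ` S)"
proof -
  obtain a b where "\<And>z. z \<in> S \<Longrightarrow> cmod (f z) \<le> a" "\<And>z. z \<in> S \<Longrightarrow> cmod (g z) \<le> b"
    using assms by (auto simp: bounded_iff)
  then have "cmod (f z * g z) \<le> \<bar>a\<bar> * \<bar>b\<bar>" if "z \<in> S" for z
    unfolding norm_mult using that by (intro mult_mono) force+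
  then show ?thesis by (auto simp: bounded_iff)
qed

lemma restrict_in_Hinf:
  assumes "f holomorphic_on unit_disc" "bounded (f ` unit_disc)"
  shows "restrict f unit_disc \<in> carrier Hinf"
proof -
  have "restrict f unit_disc holomorphic_on unit_disc"
    using assms(1) by (rule holomorphic_transform) simp
  moreover have "restrict f unit_disc ` unit_disc = f ` unit_disc" by simp
  ultimately show ?thesis using assms(2) by (simp add: Hinf_def)
qed

lemma Hinf_mult_closed:
  "f \<in> carrier Hinf \<Longrightarrow> g \<in> carrier Hinf \<Longrightarrow> f \<otimes>\<^bsub>Hinf\<^esub> g \<in> carrier Hinf"
  using restrict_in_Hinf[of "\<lambda>z. f z * g z"]
  by (auto simp: Hinf_def intro: holomorphic_intros bounded_image_mult)

lemma Hinf_add_closed: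
  "f \<in> carrier Hinf \<Longrightarrow> g \<in> carrier Hinf \<Longrightarrow> f \<oplus>\<^bsub>Hinf\<^esub> g \<in> carrier Hinf"
  using restrict_in_Hinf[of "\<lambda>z. f z + g z"]
  by (auto simp: Hinf_def intro: holomorphic_intros bounded_plus_comp)

lemma Hinf_const: "(\<lambda>z\<in>unit_disc. c) \<in> carrier Hinf"
  by (rule restrict_in_Hinf) (auto simp: bounded_iff)

lemma Hinf_one_closed: "\<one>\<^bsub>Hinf\<^esub> \<in> carrier Hinf"
  using Hinf_const[of 1] by (simp add: Hinf_def)

lemma Hinf_zero_closed: "\<zero>\<^bsub>Hinf\<^esub> \<in> carrier Hinf"
  using Hinf_const[of 0] by (simp add: Hinf_def)

lemma Hinf_ext:
  assumes "f \<in> carrier Hinf" "g \<in> carrier Hinf" "\<And>z. z \<in> unit_disc \<Longrightarrow> f z = g z"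
  shows "f = g"
  using assms by (intro extensionalityI[of _ unit_disc]) (auto simp: Hinf_def)

lemma Hinf_apply:
  assumes "z \<in> unit_disc"
  shows "(f \<otimes>\<^bsub>Hinf\<^esub> g) z = f z * g z" "(f \<oplus>\<^bsub>Hinf\<^esub> g) z = f z + g z"
    "\<one>\<^bsub>Hinf\<^esub> z = 1" "\<zero>\<^bsub>Hinf\<^esub> z = 0"
  using assms by (simp_all add: Hinf_def)

lemma cring_Hinf: "cring Hinf"
proof (rule cringI)
  note [simp] = Hinf_mult_closed Hinf_add_closed Hinf_one_closed Hinf_zero_closed Hinf_apply
  show "abelian_group Hinf"
  proof (rule abelian_groupI)
    fix f assume f: "f \<in> carrier Hinf"
    have "(\<lambda>z\<in>unit_disc. -1) \<otimes>\<^bsub>Hinf\<^esub> f \<oplus>\<^bsub>Hinf\<^esub> f = \<zero>\<^bsub>Hinf\<^esub>"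
      by (rule Hinf_ext) (use f Hinf_const in auto)
    then show "\<exists>g\<in>carrier Hinf. g \<oplus>\<^bsub>Hinf\<^esub> f = \<zero>\<^bsub>Hinf\<^esub>"
      using f Hinf_const Hinf_mult_closed by blast
  qed (auto intro!: Hinf_ext)
  show "Group.comm_monoid Hinf"
    by (rule comm_monoidI) (auto intro!: Hinf_ext)
  show "(f \<oplus>\<^bsub>Hinf\<^esub> g) \<otimes>\<^bsub>Hinf\<^esub> h = f \<otimes>\<^bsub>Hinf\<^esub> h \<oplus>\<^bsub>Hinf\<^esub> g \<otimes>\<^bsub>Hinf\<^esub> h"
    if "f \<in> carrier Hinf" "g \<in> carrier Hinf" "h \<in> carrier Hinf" for f g h
    using that by (intro Hinf_ext) (auto simp: algebra_simps)
qed

lemma quot_norm_quot_class: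
  assumes "f \<in> carrier Hinf" "\<Theta> \<in> carrier Hinf"
  shows "quot_norm (quot_class \<Theta> f) = (INF g\<in>carrier Hinf. sup_norm (\<lambda>z. f z + g z * \<Theta> z))"
proof -
  have "quot_class \<Theta> f = (\<lambda>g. g \<otimes>\<^bsub>Hinf\<^esub> \<Theta> \<oplus>\<^bsub>Hinf\<^esub> f) ` carrier Hinf"
    by (auto simp: quot_class_def a_r_coset_def' cgenideal_def)
  moreover have "sup_norm (g \<otimes>\<^bsub>Hinf\<^esub> \<Theta> \<oplus>\<^bsub>Hinf\<^esub> f) = sup_norm (\<lambda>z. f z + g z * \<Theta> z)" for g
    unfolding sup_norm_def by (intro SUP_cong) (auto simp: Hinf_apply add.commute)
  ultimately show ?thesis
    by (simp add: quot_norm_def image_image)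
qed

end

theory Submission
  imports Defs "HOL-Real_Asymp.Real_Asymp"
begin

text \<open>
SIP implies MAG: if $\rho(z,\mathcal{Z}(\Theta))$ is close to 1, apply SIP to the disc automorphism $f$ vanishing at $z$.
An inverse $g$ with $|fg| \le 1+2\varepsilon$ makes $1-fg+4\varepsilon$ a function with positive real part,
hence it dominates $h = (1-fg)/\Theta$ at $z$ (an inner factor may be divided out of an inequality between bounded functions),
so $1/|\Theta(z)| = |h(z)| \le 1+4\varepsilon$.

MAG implies SIP: by Schwarz--Pick, at every point of the disc $|f|$ or $|\Theta|$ is close to 1, and one needs
$fG+\Theta H=1$ with $\|G\|$ close to 1. By Schur's algorithm this reduces to the positivity of the kernel
$(f(z)\overline{f(w)} + C\,\Theta(z)\overline{\Theta(w)} - (1-\varepsilon))/(1-z\overline w)$, that is, to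
$(1-\varepsilon)\|x\|^2 \le \|T_f^*x\|^2 + C\|T_\Theta^*x\|^2$ on $H^2$. Put $y = x - fT_f^*x$ and $u = x - \Theta T_\Theta^*x$.
Green's formula with the weight $4-\log(1-|f|^2)$ gives
$\int |y'|^2\log\frac1{1-|f|^2}\,\log\frac1{|z|}\,dA \le K\|x\|^2$, and likewise for $u$ and $\Theta$. As one of the two weights is
large at every point, the Littlewood--Paley formula shows that $\langle y,u\rangle$ is small, which is the required inequality up to
the harmless term $\langle y, \Theta T_\Theta^*x\rangle$.
\<close>

section \<open>Means over the circle and the disc\<close>

text \<open>No Hardy space has to be built. The adjoint T_f^* multiplies the Szego kernel at w by
  the conjugate of f(w), so for a finite kernel sum x both T_f^* x and T_\<Theta>^* x are again
  kernel sums, and y, u and their pairings are explicit. With f replaced by r f(rz) they are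
  holomorphic beyond the closed disc; the constants depend neither on r nor on the number of
  kernels, and r tends to 1 only in the final inequality between finite sums.

  The sharp bound comes from the order of the choices. \<open>energy_const\<close> is absolute:
  about f and \<Theta> it uses only that they are bounded by 1. The tolerance k in 1 - |f|^2 \<le> k
  is chosen afterwards, and the pairing of y and u costs only (\<open>energy_const\<close> + 1) /
  sqrt (- ln (2k)) times the squared norm of x. The unweighted Littlewood--Paley formula would give
  no gain; the logarithm, which grows without bound as |f| tends to 1, supplies it. A large C is
  harmless: it only enlarges the cofactor of \<Theta>, whose norm SIP does not measure.\<close>

locale averaging =
  fixes a b :: "'a::euclidean_space" and \<Phi> :: "'a \<Rightarrow> complex" and c :: real
  assumes cont: "continuous_on (cbox a b) \<Phi>"
    and ran: "\<Phi> ` cbox a b \<subseteq> cball 0 1"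
    and c_pos: "c > 0"
begin

text \<open>In both uses the divisor \<open>c\<close> makes the mean of the constant function 1
  equal to 1. The integrands are continuous on the closed disc, so integrability and limits reduce
  to continuity and uniform convergence there.\<close>

definition avg :: "(complex \<Rightarrow> complex) \<Rightarrow> complex" where
  "avg F = integral (cbox a b) (\<lambda>p. F (\<Phi> p)) /\<^sub>R c"

lemma integrable [intro]:
  fixes F :: "complex \<Rightarrow> 'c::banach"
  assumes "continuous_on (cball 0 1) F"
  shows "(\<lambda>p. F (\<Phi> p)) integrable_on cbox a b"
  by (rule integrable_continuous) (rule continuous_on_compose2[OF assms cont ran])

lemma avg_add:
  assumes "continuous_on (cball 0 1) F" "continuous_on (cball 0 1) G"
  shows "avg (\<lambda>z. F z + G z) = avg F + avg G"
  using assms by (simp add: avg_def integral_add integrable scaleR_add_right)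

lemma avg_diff:
  assumes "continuous_on (cball 0 1) F" "continuous_on (cball 0 1) G"
  shows "avg (\<lambda>z. F z - G z) = avg F - avg G"
  using assms by (simp add: avg_def integral_diff integrable scaleR_diff_right)

lemma avg_cmult: "avg (\<lambda>z. k * F z) = k * avg F"
  by (simp add: avg_def)

lemma avg_cnj: "avg (\<lambda>z. cnj (F z)) = cnj (avg F)"
  by (simp add: avg_def integral_cnj)

lemma avg_sum:
  assumes "finite I" "\<And>i. i \<in> I \<Longrightarrow> continuous_on (cball 0 1) (F i)"
  shows "avg (\<lambda>z. \<Sum>i\<in>I. F i z) = (\<Sum>i\<in>I. avg (F i))"
  using assms by (simp add: avg_def integral_sum integrable scaleR_sum_right)

lemma Re_avg:
  assumes "continuous_on (cball 0 1) F"
  shows "Re (avg F) = integral (cbox a b) (\<lambda>p. Re (F (\<Phi> p))) / c"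
  using integral_linear[OF integrable[OF assms] bounded_linear_Re]
  by (simp add: avg_def o_def divide_inverse)

lemma Re_avg_mono:
  assumes "continuous_on (cball 0 1) F" "continuous_on (cball 0 1) G"
    and "\<And>p. p \<in> cbox a b \<Longrightarrow> Re (F (\<Phi> p)) \<le> Re (G (\<Phi> p))"
  shows "Re (avg F) \<le> Re (avg G)"
proof -
  have "integral (cbox a b) (\<lambda>p. Re (F (\<Phi> p))) \<le> integral (cbox a b) (\<lambda>p. Re (G (\<Phi> p)))"
    using assms by (intro integral_le) (auto intro!: integrable[of "\<lambda>z. Re (_ z)"] continuous_intros)
  then show ?thesis
    using assms c_pos by (simp add: Re_avg divide_right_mono)
qed

lemma norm_avg_le:
  assumes "continuous_on (cball 0 1) F" "continuous_on (cball 0 1) G"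
    and "\<And>p. p \<in> cbox a b \<Longrightarrow> cmod (F (\<Phi> p)) \<le> Re (G (\<Phi> p))"
  shows "cmod (avg F) \<le> Re (avg G)"
proof -
  have "norm (integral (cbox a b) (\<lambda>p. F (\<Phi> p))) \<le> integral (cbox a b) (\<lambda>p. Re (G (\<Phi> p)))"
    using assms by (intro integral_norm_bound_integral)
      (auto intro!: integrable integrable[of "\<lambda>z. Re (_ z)"] continuous_intros)
  then show ?thesis
    using c_pos unfolding Re_avg[OF assms(2)]
    by (simp add: avg_def field_simps)
qed

lemma avg_uniform_limit:
  assumes "uniform_limit (cball 0 1) F G sequentially" "\<And>n::nat. continuous_on (cball 0 1) (F n)"
  shows "(\<lambda>n. avg (F n)) \<longlonglongrightarrow> avg G"
proof -
  have 1: "uniform_limit (cbox a b) (\<lambda>n p. F n (\<Phi> p)) (\<lambda>p. G (\<Phi> p)) sequentially"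
    using ran by (intro uniform_limit_compose'[OF assms(1)]) auto
  have 2: "continuous_on (cbox a b) (\<lambda>p. F n (\<Phi> p))" for n
    by (rule continuous_on_compose2[OF assms(2) cont ran])
  obtain I J where
    I: "\<And>n. ((\<lambda>p. F n (\<Phi> p)) has_integral I n) (cbox a b)"
    and J: "((\<lambda>p. G (\<Phi> p)) has_integral J) (cbox a b)" and IJ: "I \<longlonglongrightarrow> J"
    by (rule uniform_limit_integral_cbox[OF 1 2]) auto
  have "I = (\<lambda>n. integral (cbox a b) (\<lambda>p. F n (\<Phi> p)))" "J = integral (cbox a b) (\<lambda>p. G (\<Phi> p))"
    using integral_unique[OF I] integral_unique[OF J] by auto
  with IJ show ?thesis unfolding avg_def by (auto intro!: tendsto_intros)
qed

lemma avg_suminf: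
  assumes "\<And>n z. z \<in> cball 0 1 \<Longrightarrow> cmod (F n z) \<le> A n" "summable A"
    and "\<And>n::nat. continuous_on (cball 0 1) (F n)"
  shows "(\<lambda>n. avg (F n)) sums avg (\<lambda>z. \<Sum>n. F n z)"
proof -
  have "(\<lambda>N. avg (\<lambda>z. \<Sum>n<N. F n z)) \<longlonglongrightarrow> avg (\<lambda>z. \<Sum>n. F n z)"
    by (intro avg_uniform_limit Weierstrass_m_test[OF assms(1,2)] continuous_on_sum assms(3)) auto
  then show ?thesis using assms(3) by (simp add: avg_sum sums_def)
qed

end

lemma continuous_on_suminf:
  fixes F :: "nat \<Rightarrow> complex \<Rightarrow> complex"
  assumes "\<And>n z. z \<in> S \<Longrightarrow> cmod (F n z) \<le> A n" "summable A"
    and "\<And>n. continuous_on S (F n)"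
  shows "continuous_on S (\<lambda>z. \<Sum>n. F n z)"
  by (rule uniform_limit_theorem[OF _ Weierstrass_m_test[OF assms(1,2)]])
    (auto intro!: continuous_on_sum assms(3) always_eventually)

section \<open>The circle mean, the disc mean and their monomial moments\<close>

global_interpretation circ: averaging 0 "2 * pi" cis "2 * pi"
  defines circ_mean = circ.avg
  by unfold_locales (auto intro!: continuous_intros)

text \<open>
Since $\int_0^1\int_0^1 (st)^n\,ds\,dt = 1/(n+1)^2$, pushing Lebesgue measure forward along
$(s,t,\theta) \mapsto \sqrt{st}\,e^{i\theta}$ gives a multiple of the measure $\log\frac1{|z|}\,dA$ of the Littlewood--Paley formula.
This description avoids polar coordinates and the singular weight.
\<close>
lemma continuous_on_disc_parametrization: "continuous_on UNIV (\<lambda>p::real \<times> real \<times> real. of_real (sqrt (fst p * fst (snd p))) * cis (snd (snd p)))"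
  by (intro continuous_intros)

global_interpretation disc: averaging "(0, 0, 0)" "(1, 1, 2 * pi)"
  "\<lambda>p::real \<times> real \<times> real. of_real (sqrt (fst p * fst (snd p))) * cis (snd (snd p))" "2 * pi"
  defines disc_mean = disc.avg
proof
  show "(\<lambda>p::real \<times> real \<times> real. of_real (sqrt (fst p * fst (snd p))) * cis (snd (snd p))) `
    cbox (0, 0, 0) (1, 1, 2 * pi) \<subseteq> cball 0 1"
    by (auto simp: cbox_Pair_eq norm_mult mult_le_one)
qed (use continuous_on_subset[OF continuous_on_disc_parametrization] in auto)

text \<open>On the circle the conjugate of z is 1/z, so the conjugated Szego kernel is z / (z - w);
  with dz = i z dt the mean is Cauchy's integral formula at \<open>w\<close>.\<close>

lemma circ_reproducing:
  assumes "u holomorphic_on ball 0 R" "1 < R" "cmod w < 1"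
  shows "circ_mean (\<lambda>z. u z * cnj (1 / (1 - cnj w * z))) = u w"
proof -
  have "u holomorphic_on cball 0 1"
    using assms by (auto intro: holomorphic_on_subset)
  then have "((\<lambda>z. u z / (z - w)) has_contour_integral 2 * of_real pi * \<i> * u w) (circlepath 0 1)"
    using assms by (intro Cauchy_integral_circlepath_simple) auto
  then have *: "((\<lambda>t. u (cis t) / (cis t - w) * \<i> * cis t) has_integral 2 * of_real pi * \<i> * u w) {0..2 * pi}"
    unfolding circlepath_def by (subst (asm) has_contour_integral_part_circlepath_iff) auto
  have "((\<lambda>t. (u (cis t) / (cis t - w) * \<i> * cis t) * (- \<i>)) has_integral 2 * of_real pi * \<i> * u w * (- \<i>)) {0..2 * pi}"
    by (rule has_integral_mult_left[OF *])
  moreover have "(u (cis t) / (cis t - w) * \<i> * cis t) * (- \<i>) = u (cis t) * cnj (1 / (1 - cnj w * cis t))" for t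
  proof -
    have "cis t \<noteq> w" "cis t \<noteq> 0" using assms(3) by auto
    then have "1 - w * cnj (cis t) = (cis t - w) / cis t"
      by (simp add: field_simps cis_cnj cis_inverse[symmetric])
    then have "cnj (1 / (1 - cnj w * cis t)) = cis t / (cis t - w)" by simp
    moreover have "x * \<i> * y * (- \<i>) = x * y" for x y :: complex by (simp add: algebra_simps)
    ultimately show ?thesis by (simp only: times_divide_eq_right times_divide_eq_left)
  qed
  ultimately have "((\<lambda>t. u (cis t) * cnj (1 / (1 - cnj w * cis t))) has_integral 2 * of_real pi * u w) {0..2 * pi}"
    by (simp add: algebra_simps)
  then show ?thesis
    by (simp add: circ.avg_def cbox_interval integral_unique scaleR_conv_of_real)
qed

text \<open>For m \<le> n the integrand is z^(n - m) on the circle, whose mean is its value at 0 by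
  the reproducing formula with w = 0; conjugation gives the other case.\<close>

lemma circ_mean_monomial: "circ_mean (\<lambda>z. z ^ n * cnj z ^ m) = of_bool (n = m)"
proof -
  have *: "circ_mean (\<lambda>z. z ^ n * cnj z ^ m) = of_bool (n = m)" if "m \<le> n" for n m
  proof -
    have "circ_mean (\<lambda>z. z ^ n * cnj z ^ m) = circ_mean (\<lambda>z. z ^ (n - m) * cnj (1 / (1 - cnj 0 * z)))"
    proof -
      have "cis t ^ n * cnj (cis t) ^ m = cis t ^ (n - m)" for t
      proof -
        have "cis t ^ n = cis t ^ (n - m) * cis t ^ m" using that by (simp flip: power_add)
        then have "cis t ^ n * cnj (cis t) ^ m = cis t ^ (n - m) * (cis t * cnj (cis t)) ^ m"
          by (simp add: power_mult_distrib)
        then show ?thesis by (simp add: complex_norm_square[symmetric])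
      qed
      then show ?thesis by (simp add: circ.avg_def)
    qed
    also have "\<dots> = 0 ^ (n - m)"
      by (rule circ_reproducing[of _ 2]) (auto intro!: holomorphic_intros)
    finally show ?thesis using that by (auto simp: power_0_left)
  qed
  show ?thesis
  proof (cases "m \<le> n")
    case False
    then have "circ_mean (\<lambda>z. z ^ m * cnj z ^ n) = of_bool (m = n)" using * by simp
    then have "cnj (circ_mean (\<lambda>z. z ^ m * cnj z ^ n)) = of_bool (m = n)" by simp
    then show ?thesis unfolding circ.avg_cnj[symmetric] by (simp add: mult.commute eq_commute)
  qed (use * in auto)
qed

lemma disc_mean_monomial: "disc_mean (\<lambda>z. z ^ n * cnj z ^ m) = of_bool (n = m) / (of_nat n + 1)\<^sup>2"
proof -
  let ?F = "\<lambda>z::complex. z ^ n * cnj z ^ m"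
  let ?I = "integral (cbox 0 (2 * pi)) (\<lambda>\<theta>. ?F (cis \<theta>))"
  have I: "?I = of_real (2 * pi) * of_bool (n = m)"
  proof -
    have "?I /\<^sub>R (2 * pi) = of_bool (n = m)"
      using circ_mean_monomial[of n m] unfolding circ.avg_def .
    moreover have "?I = (2 * pi) *\<^sub>R (?I /\<^sub>R (2 * pi))" by simp
    ultimately show ?thesis by (simp only: scaleR_conv_of_real)
  qed
  let ?G = "\<lambda>p::real \<times> real \<times> real. of_real (sqrt (fst p * fst (snd p)) ^ (n + m)) * ?F (cis (snd (snd p)))"
  have contG: "continuous_on X ?G" for X by (intro continuous_intros)
  have eq: "?F (of_real r * cis t) = of_real (r ^ (n + m)) * ?F (cis t)" for r t
    by (simp add: power_mult_distrib power_add)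
  have "integral (cbox (0,0,0) (1,1,2*pi)) ?G
     = integral (cbox 0 1) (\<lambda>s. integral (cbox (0,0) (1,2*pi)) (\<lambda>q. ?G (s, q)))"
    by (rule integral_prod_continuous[OF contG])
  also have "\<dots> = integral (cbox 0 1) (\<lambda>s. integral (cbox 0 1) (\<lambda>t. integral (cbox 0 (2*pi)) (\<lambda>\<theta>. ?G (s, t, \<theta>))))"
    by (intro integral_cong integral_prod_continuous continuous_on_compose2[OF contG[of UNIV]] continuous_intros) auto
  also have "\<dots> = integral (cbox 0 1) (\<lambda>s. integral (cbox 0 1) (\<lambda>t. of_real (sqrt (s * t) ^ (n + m)) * ?I))"
    by (simp del: of_real_power)
  also have "\<dots> = of_real (2 * pi) * of_bool (n = m) / (of_nat n + 1)\<^sup>2"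
  proof (cases "n = m")
    case True
    have "((\<lambda>t. t ^ n) has_integral (1 ^ Suc n / Suc n - 0 ^ Suc n / Suc n)) {0..1::real}"
      by (intro fundamental_theorem_of_calculus)
        (auto intro!: derivative_eq_intros simp: has_real_derivative_iff_has_vector_derivative[symmetric] simp del: power_Suc of_nat_Suc)
    then have r: "((\<lambda>t. t ^ n) has_integral (1 / (real n + 1))) {0..1::real}"
      by (simp add: add.commute)
    have "((\<lambda>t. complex_of_real (t ^ n)) has_integral of_real (1 / (real n + 1))) {0..1}"
      by (rule has_integral_of_real[OF r])
    then have c: "((\<lambda>t. complex_of_real t ^ n) has_integral (1 / (of_nat n + 1))) {0..1::real}"
      by (simp add: of_real_divide)
    have "integral (cbox 0 1) (\<lambda>s. integral (cbox 0 1) (\<lambda>t. of_real (sqrt (s * t) ^ (n + m)) * ?I)) =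
      integral (cbox 0 1) (\<lambda>s::real. integral (cbox 0 1) (\<lambda>t::real. (of_real s ^ n * of_real t ^ n) * ?I))"
    proof (intro integral_cong)
      fix s t :: real assume "s \<in> cbox 0 1" "t \<in> cbox 0 1"
      then have "sqrt (s * t) ^ (n + m) = (s * t) ^ n"
        using True by (simp add: mult_2[symmetric] power_mult)
      then show "of_real (sqrt (s * t) ^ (n + m)) * ?I = (of_real s ^ n * of_real t ^ n) * ?I"
        by (simp add: power_mult_distrib)
    qed
    also have "\<dots> = (1 / (of_nat n + 1)) * (1 / (of_nat n + 1)) * ?I"
      using integral_unique[OF c] by simp
    finally show ?thesis using I True by (simp add: power2_eq_square)
  qed (use I in simp)
  finally show ?thesis
    unfolding disc.avg_def eq by (simp add: scaleR_conv_of_real)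
qed

section \<open>Green pairs\<close>

text \<open>
$V$ plays the role of $\partial\overline\partial W$. Only sums of products of holomorphic and antiholomorphic functions
are needed, so the identity itself serves as the definition and no second derivatives occur.
\<close>
definition green_pair :: "(complex \<Rightarrow> complex) \<Rightarrow> (complex \<Rightarrow> complex) \<Rightarrow> bool" where
  "green_pair W V \<longleftrightarrow> continuous_on (cball 0 1) W \<and> continuous_on (cball 0 1) V \<and> circ_mean W = W 0 + disc_mean V"

lemma green_pair_add:
  "green_pair W V \<Longrightarrow> green_pair W' V' \<Longrightarrow> green_pair (\<lambda>z. W z + W' z) (\<lambda>z. V z + V' z)"
  by (auto simp: green_pair_def circ.avg_add disc.avg_add intro!: continuous_intros)

lemma green_pair_cmult: "green_pair W V \<Longrightarrow> green_pair (\<lambda>z. k * W z) (\<lambda>z. k * V z)"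
  by (auto simp: green_pair_def circ.avg_cmult disc.avg_cmult algebra_simps intro!: continuous_intros)

lemma green_pair_diff:
  assumes "green_pair W V" "green_pair W' V'"
  shows "green_pair (\<lambda>z. W z - W' z) (\<lambda>z. V z - V' z)"
  using green_pair_add[OF assms(1) green_pair_cmult[OF assms(2), of "-1"]] by simp

lemma green_pair_suminf:
  assumes W: "\<And>n z. z \<in> cball 0 1 \<Longrightarrow> cmod (W n z) \<le> A n"
    and V: "\<And>n z. z \<in> cball 0 1 \<Longrightarrow> cmod (V n z) \<le> B n"
    and A: "summable A" and B: "summable B" and gp: "\<And>n. green_pair (W n) (V n)"
  shows "green_pair (\<lambda>z. \<Sum>n. W n z) (\<lambda>z. \<Sum>n. V n z)"
proof -
  have cW: "\<And>n. continuous_on (cball 0 1) (W n)" and cV: "\<And>n. continuous_on (cball 0 1) (V n)"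
    and eq: "\<And>n. circ_mean (W n) = W n 0 + disc_mean (V n)"
    using gp by (auto simp: green_pair_def)
  have "summable (\<lambda>n. W n 0)"
    by (rule summable_comparison_test'[OF A, of 0]) (use W[of 0] in auto)
  then have "(\<lambda>n. W n 0 + disc_mean (V n)) sums ((\<Sum>n. W n 0) + disc_mean (\<lambda>z. \<Sum>n. V n z))"
    using disc.avg_suminf[OF V B cV] by (intro sums_add summable_sums) auto
  moreover have "(\<lambda>n. circ_mean (W n)) sums circ_mean (\<lambda>z. \<Sum>n. W n z)"
    by (rule circ.avg_suminf[OF W A cW])
  ultimately have "circ_mean (\<lambda>z. \<Sum>n. W n z) = (\<Sum>n. W n 0) + disc_mean (\<lambda>z. \<Sum>n. V n z)"
    by (simp add: eq sums_unique2)
  then show ?thesis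
    unfolding green_pair_def using continuous_on_suminf[OF W A cW] continuous_on_suminf[OF V B cV] by simp
qed

lemma green_pair_cong:
  assumes "green_pair W V" "\<And>z. z \<in> cball 0 1 \<Longrightarrow> W z = W' z" "\<And>z. z \<in> cball 0 1 \<Longrightarrow> V z = V' z"
  shows "green_pair W' V'"
proof -
  have "circ_mean W = circ_mean W'" "disc_mean V = disc_mean V'"
    using circ.ran disc.ran assms(2,3)
    by (auto simp: circ.avg_def disc.avg_def image_subset_iff intro!: integral_cong)
  with assms show ?thesis
    unfolding green_pair_def using continuous_on_eq[of "cball 0 1" W W'] continuous_on_eq[of "cball 0 1" V V'] by simp
qed

text \<open>Only n = m > 0 contributes to the disc mean, where the factor n * n cancels the moment 1
  / n^2 of z^(n - 1); for n = m = 0 the value at 0 already is the circle mean.\<close>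

lemma green_pair_monomial:
  "green_pair (\<lambda>z. z ^ n * cnj z ^ m) (\<lambda>z. (of_nat n * z ^ (n - 1)) * cnj (of_nat m * z ^ (m - 1)))"
proof -
  have "disc_mean (\<lambda>z. (of_nat n * z ^ (n - 1)) * cnj (of_nat m * z ^ (m - 1))) =
    disc_mean (\<lambda>z. (of_nat n * of_nat m) * (z ^ (n - 1) * cnj z ^ (m - 1)))"
    by (simp add: mult_ac)
  also have "\<dots> = of_nat n * of_nat m * (of_bool (n - 1 = m - 1) / (of_nat (n - 1) + 1)\<^sup>2)"
    by (simp only: disc.avg_cmult disc_mean_monomial)
  \<comment> \<open>Truncated subtraction makes \<open>n - 1 = m - 1\<close> true for the exponents
    0 and 1 as well; there a factor \<open>of_nat 0\<close> vanishes.\<close>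
  also have "\<dots> = of_bool (n = m \<and> n > 0)"
  proof (cases "n = m \<and> n > 0")
    case True
    then have "of_nat (n - 1) + 1 = (of_nat n :: complex)" by (simp add: of_nat_diff)
    then show ?thesis using True by (simp add: power2_eq_square)
  next
    case False
    then show ?thesis by (cases n; cases m) auto
  qed
  finally show ?thesis
    unfolding green_pair_def circ_mean_monomial by (auto intro!: continuous_intros simp: power_0_left)
qed

lemma holomorphic_series_cball:
  assumes "u holomorphic_on ball 0 R" "1 < R"
  obtains a :: "nat \<Rightarrow> complex" where
    "\<And>z. z \<in> cball 0 1 \<Longrightarrow> (\<lambda>n. a n * z ^ n) sums u z"
    "\<And>z. z \<in> cball 0 1 \<Longrightarrow> (\<lambda>n. a n * (of_nat n * z ^ (n - 1))) sums deriv u z"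
    "summable (\<lambda>n. cmod (a n))" "summable (\<lambda>n. cmod (a n) * real n)"
proof -
  define a where "a n = (deriv ^^ n) u 0 / fact n" for n
  have s: "(\<lambda>n. a n * z ^ n) sums u z" if "z \<in> ball 0 R" for z
    using holomorphic_power_series[OF assms(1) that] by (simp add: a_def)
  have "deriv u holomorphic_on ball 0 R" by (rule holomorphic_deriv[OF assms(1)]) simp
  then have "(\<lambda>n. (deriv ^^ n) (deriv u) 0 / fact n * z ^ n) sums deriv u z" if "z \<in> ball 0 R" for z
    using holomorphic_power_series[of "deriv u" 0 R z] that by simp
  moreover have "(deriv ^^ n) (deriv u) 0 / fact n = a (Suc n) * of_nat (Suc n)" for n
    by (simp add: a_def funpow_Suc_right[of n deriv, unfolded o_def, THEN fun_cong, symmetric] del: funpow.simps of_nat_Suc)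
  ultimately have s': "(\<lambda>n. (a (Suc n) * of_nat (Suc n)) * z ^ n) sums deriv u z" if "z \<in> ball 0 R" for z
    using that by simp
  \<comment> \<open>A point of modulus strictly between 1 and \<open>R\<close>: convergence there
    forces absolute convergence at 1, which is what the summability claims need.\<close>
  define x :: complex where "x = of_real ((1 + R) / 2)"
  have x: "x \<in> ball 0 R" "cmod 1 < cmod x" using assms(2) by (auto simp: x_def simp flip: of_real_add)
  show thesis
  proof
    show "(\<lambda>n. a n * z ^ n) sums u z" if "z \<in> cball 0 1" for z
      using that assms(2) by (intro s) auto
    show "(\<lambda>n. a n * (of_nat n * z ^ (n - 1))) sums deriv u z" if "z \<in> cball 0 1" for z
      using sums_Suc[of "\<lambda>n. a n * (of_nat n * z ^ (n - 1))" "deriv u z"] s'[of z] that assms(2)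
      by (simp add: mult_ac del: of_nat_Suc)
    show "summable (\<lambda>n. cmod (a n))"
      using powser_insidea[OF sums_summable[OF s[OF x(1)]] x(2)] by simp
    have "summable (\<lambda>n. cmod (a (Suc n)) * real (Suc n))"
      using powser_insidea[OF sums_summable[OF s'[OF x(1)]] x(2)] by (simp add: norm_mult del: of_nat_Suc)
    then show "summable (\<lambda>n. cmod (a n) * real n)" by (subst (asm) summable_Suc_iff)
  qed
qed

lemma holomorphic_continuous_on_cball:
  assumes "u holomorphic_on ball 0 R" "1 < R"
  shows "continuous_on (cball 0 1) u" "continuous_on (cball 0 1) (deriv u)"
proof -
  have "deriv u holomorphic_on ball 0 R" by (rule holomorphic_deriv[OF assms(1)]) simp
  then show "continuous_on (cball 0 1) u" "continuous_on (cball 0 1) (deriv u)"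
    using assms by (auto intro!: holomorphic_on_imp_continuous_on elim!: holomorphic_on_subset)
qed

lemma continuous_on_cball_bounded:
  fixes u :: "complex \<Rightarrow> complex"
  assumes "continuous_on (cball 0 1) u"
  obtains B where "B > 0" "\<And>z. z \<in> cball 0 1 \<Longrightarrow> cmod (u z) \<le> B"
proof -
  have "bounded (u ` cball 0 1)"
    using assms by (intro compact_imp_bounded compact_continuous_image) auto
  then show ?thesis using that by (auto simp: bounded_pos)
qed

text \<open>Both factors are expanded in power series, but one after the other: first
  \<open>u\<close> against a fixed power of the conjugate variable, then \<open>v\<close>. This
  takes two dominated single series instead of a double one.\<close>

lemma green_pair_holomorphic:
  assumes "u holomorphic_on ball 0 R" "v holomorphic_on ball 0 R" "1 < R"
  shows "green_pair (\<lambda>z. u z * cnj (v z)) (\<lambda>z. deriv u z * cnj (deriv v z))"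
proof -
  obtain a where a: "\<And>z. z \<in> cball 0 1 \<Longrightarrow> (\<lambda>n. a n * z ^ n) sums u z"
    "\<And>z. z \<in> cball 0 1 \<Longrightarrow> (\<lambda>n. a n * (of_nat n * z ^ (n - 1))) sums deriv u z"
    "summable (\<lambda>n. cmod (a n))" "summable (\<lambda>n. cmod (a n) * real n)"
    using holomorphic_series_cball[OF assms(1,3)] by blast
  obtain b where b: "\<And>z. z \<in> cball 0 1 \<Longrightarrow> (\<lambda>n. b n * z ^ n) sums v z"
    "\<And>z. z \<in> cball 0 1 \<Longrightarrow> (\<lambda>n. b n * (of_nat n * z ^ (n - 1))) sums deriv v z"
    "summable (\<lambda>n. cmod (b n))" "summable (\<lambda>n. cmod (b n) * real n)"
    using holomorphic_series_cball[OF assms(2,3)] by blast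
  have 1: "green_pair (\<lambda>z. u z * cnj z ^ m) (\<lambda>z. deriv u z * cnj (of_nat m * z ^ (m - 1)))" for m
  proof (rule green_pair_cong)
    show "green_pair (\<lambda>z. \<Sum>n. a n * (z ^ n * cnj z ^ m))
      (\<lambda>z. \<Sum>n. a n * ((of_nat n * z ^ (n - 1)) * cnj (of_nat m * z ^ (m - 1))))"
    proof (rule green_pair_suminf)
      show "cmod (a n * (z ^ n * cnj z ^ m)) \<le> cmod (a n)" if "z \<in> cball 0 1" for n z
        using that by (auto simp: norm_mult norm_power intro!: mult_left_le mult_le_one power_le_one)
      show "cmod (a n * ((of_nat n * z ^ (n - 1)) * cnj (of_nat m * z ^ (m - 1)))) \<le> (cmod (a n) * real n) * real m"
        if "z \<in> cball 0 1" for n z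
      proof -
        have "cmod z ^ (n - 1) * cmod z ^ (m - 1) \<le> 1"
          using that by (intro mult_le_one power_le_one) auto
        from mult_left_mono[OF this, of "cmod (a n) * real n * real m"] show ?thesis
          by (simp add: norm_mult norm_power mult_ac)
      qed
    qed (intro a(3,4) summable_mult2 green_pair_cmult green_pair_monomial)+
    fix z :: complex assume z: "z \<in> cball 0 1"
    show "(\<Sum>n. a n * (z ^ n * cnj z ^ m)) = u z * cnj z ^ m"
      using sums_mult2[OF a(1)[OF z], of "cnj z ^ m"] by (simp add: mult.assoc sums_iff)
    show "(\<Sum>n. a n * ((of_nat n * z ^ (n - 1)) * cnj (of_nat m * z ^ (m - 1)))) = deriv u z * cnj (of_nat m * z ^ (m - 1))"
      using sums_mult2[OF a(2)[OF z], of "cnj (of_nat m * z ^ (m - 1))"] by (simp add: mult.assoc sums_iff)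
  qed
  obtain K where K: "K > 0" "\<And>z. z \<in> cball 0 1 \<Longrightarrow> cmod (u z) \<le> K"
    using continuous_on_cball_bounded[OF holomorphic_continuous_on_cball(1)[OF assms(1,3)]] by blast
  obtain K' where K': "K' > 0" "\<And>z. z \<in> cball 0 1 \<Longrightarrow> cmod (deriv u z) \<le> K'"
    using continuous_on_cball_bounded[OF holomorphic_continuous_on_cball(2)[OF assms(1,3)]] by blast
  show ?thesis
  proof (rule green_pair_cong)
    show "green_pair (\<lambda>z. \<Sum>m. cnj (b m) * (u z * cnj z ^ m))
      (\<lambda>z. \<Sum>m. cnj (b m) * (deriv u z * cnj (of_nat m * z ^ (m - 1))))"
    proof (rule green_pair_suminf)
      show "cmod (cnj (b m) * (u z * cnj z ^ m)) \<le> cmod (b m) * K" if "z \<in> cball 0 1" for m z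
      proof -
        have "cmod (u z) * cmod z ^ m \<le> K * 1"
          using that K(2)[OF that] K(1) by (intro mult_mono power_le_one) auto
        from mult_left_mono[OF this, of "cmod (b m)"] show ?thesis
          by (simp add: norm_mult norm_power)
      qed
      show "cmod (cnj (b m) * (deriv u z * cnj (of_nat m * z ^ (m - 1)))) \<le> (cmod (b m) * real m) * K'"
        if "z \<in> cball 0 1" for m z
      proof -
        have "cmod (deriv u z) * cmod z ^ (m - 1) \<le> K' * 1"
          using that K'(2)[OF that] K'(1) by (intro mult_mono) (auto intro!: power_le_one)
        from mult_left_mono[OF this, of "cmod (b m) * real m"] show ?thesis
          by (simp add: norm_mult norm_power mult_ac)
      qed
    qed (intro b(3,4) summable_mult2 green_pair_cmult 1)+
    fix z :: complex assume z: "z \<in> cball 0 1"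
    have "(\<lambda>m. cnj (b m * z ^ m)) sums cnj (v z)" "(\<lambda>m. cnj (b m * (of_nat m * z ^ (m - 1)))) sums cnj (deriv v z)"
      using b(1,2)[OF z] by (simp_all only: sums_cnj)
    from sums_mult[OF this(1), of "u z"] sums_mult[OF this(2), of "deriv u z"]
    show "(\<Sum>m. cnj (b m) * (u z * cnj z ^ m)) = u z * cnj (v z)"
      "(\<Sum>m. cnj (b m) * (deriv u z * cnj (of_nat m * z ^ (m - 1)))) = deriv u z * cnj (deriv v z)"
      by (simp_all add: sums_iff mult_ac)
  qed
qed

lemma cmod_less_1_cball:
  fixes f :: "complex \<Rightarrow> complex"
  assumes "continuous_on (cball 0 1) f" "\<And>z. z \<in> cball 0 1 \<Longrightarrow> cmod (f z) < 1"
  obtains b where "0 < b" "b < 1" "\<And>z. z \<in> cball 0 1 \<Longrightarrow> cmod (f z) \<le> b"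
proof -
  have "\<exists>w\<in>cball 0 1. \<forall>z\<in>cball 0 1. cmod (f z) \<le> cmod (f w)"
    using assms(1) by (intro continuous_attains_sup continuous_on_norm) auto
  then obtain w where w: "w \<in> cball 0 1" "\<And>z. z \<in> cball 0 1 \<Longrightarrow> cmod (f z) \<le> cmod (f w)"
    by blast
  show thesis
  \<comment> \<open>The maximum with 1/2 keeps the bound positive when \<open>f\<close> vanishes on
    the closed disc.\<close>
  proof (rule that[of "max (cmod (f w)) (1 / 2)"])
    show "cmod (f z) \<le> max (cmod (f w)) (1 / 2)" if "z \<in> cball 0 1" for z
      using w(2)[OF that] by simp
  qed (use assms(2)[OF w(1)] in auto)
qed

text \<open>The n-th term of the series in \<open>green_pair_log_weight\<close>: \<open>c\<close> is
  n, \<open>p\<close> and \<open>p'\<close> are f^(n-1) and its conjugate, \<open>q\<close> and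
  \<open>q'\<close> are f and its conjugate. The coefficients 1/c, c/c and c lead to the series of -
  ln (1 - s), 1 / (1 - s) and 1 / (1 - s)^2. The quotient \<open>c / c\<close> is kept because in
  the series it has to be 0 at n = 0.\<close>

lemma log_weight_expand:
  fixes p q p' q' F U U' F' V V' c :: complex
  assumes "c \<noteq> 0"
  shows "(1 / c) * ((c * p * F * U + q * p * U') * (c * p' * F' * V + q' * p' * V'))
    = (q * q') * (p * p') / c * (U' * V') + c / c * (p * p') * (F * U * (q' * V') + q * U' * (F' * V))
      + c * (p * p') * (F * U * (F' * V))"
proof -
  have "c * ((1 / c) * ((c * p * F * U + q * p * U') * (c * p' * F' * V + q' * p' * V')))
    = c * ((q * q') * (p * p') / c * (U' * V') + c / c * (p * p') * (F * U * (q' * V') + q * U' * (F' * V))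
      + c * (p * p') * (F * U * (F' * V)))"
    using assms by (simp add: distrib_left) (simp add: algebra_simps)
  then show ?thesis using assms by (metis mult_cancel_left)
qed

text \<open>Since - ln (1 - |f|^2) is the sum of |f|^(2n) / n, the weighted product is a series of
  products of f^n u with the conjugate of f^n v, each of which has a Green pair. The three summands
  of the second function collect the terms where no, exactly one, or both derivatives fall on the
  weight.\<close>

lemma green_pair_log_weight:
  assumes f: "f holomorphic_on ball 0 R" and u: "u holomorphic_on ball 0 R"
    and v: "v holomorphic_on ball 0 R" and R: "1 < R"
    and f1: "\<And>z. z \<in> cball 0 1 \<Longrightarrow> cmod (f z) < 1"
  defines "s \<equiv> \<lambda>z. (cmod (f z))\<^sup>2"
  defines "f' \<equiv> deriv f" and "u' \<equiv> deriv u" and "v' \<equiv> deriv v"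
  shows "green_pair (\<lambda>z. of_real (4 - ln (1 - s z)) * (u z * cnj (v z)))
    (\<lambda>z. of_real (4 - ln (1 - s z)) * (u' z * cnj (v' z))
      + of_real (1 / (1 - s z)) * (f' z * u z * cnj (f z * v' z) + f z * u' z * cnj (f' z * v z))
      + of_real (1 / (1 - s z)\<^sup>2) * (f' z * u z * cnj (f' z * v z)))"
proof -
  note hol = f u v
  have c: "continuous_on (cball 0 1) f" "continuous_on (cball 0 1) f'" "continuous_on (cball 0 1) u"
    "continuous_on (cball 0 1) u'" "continuous_on (cball 0 1) v" "continuous_on (cball 0 1) v'"
    unfolding f'_def u'_def v'_def using hol R by (auto intro: holomorphic_continuous_on_cball)
  obtain b where b: "0 < b" "b < 1" "\<And>z. z \<in> cball 0 1 \<Longrightarrow> cmod (f z) \<le> b"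
    using cmod_less_1_cball[OF c(1) f1] by blast
  obtain K1 where K1: "K1 > 0" "\<And>z. z \<in> cball 0 1 \<Longrightarrow> cmod (f' z) \<le> K1" using continuous_on_cball_bounded[OF c(2)] by blast
  obtain K2 where K2: "K2 > 0" "\<And>z. z \<in> cball 0 1 \<Longrightarrow> cmod (u z) \<le> K2" using continuous_on_cball_bounded[OF c(3)] by blast
  obtain K3 where K3: "K3 > 0" "\<And>z. z \<in> cball 0 1 \<Longrightarrow> cmod (u' z) \<le> K3" using continuous_on_cball_bounded[OF c(4)] by blast
  obtain K4 where K4: "K4 > 0" "\<And>z. z \<in> cball 0 1 \<Longrightarrow> cmod (v z) \<le> K4" using continuous_on_cball_bounded[OF c(5)] by blast
  obtain K5 where K5: "K5 > 0" "\<And>z. z \<in> cball 0 1 \<Longrightarrow> cmod (v' z) \<le> K5" using continuous_on_cball_bounded[OF c(6)] by blast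
  define D where "D n g g' z = of_nat n * f z ^ (n - 1) * f' z * g z + f z ^ n * g' z"
    for n and g g' :: "complex \<Rightarrow> complex" and z
  have D: "deriv (\<lambda>z. f z ^ n * g z) z = D n g (deriv g) z"
    if "g holomorphic_on ball 0 R" "z \<in> cball 0 1" for n g z
  proof -
    have z: "z \<in> ball 0 R" using that R by auto
    have df: "(f has_field_derivative f' z) (at z)" "(g has_field_derivative deriv g z) (at z)"
      unfolding f'_def using that(1) z f by (auto intro: holomorphic_derivI)
    have "((\<lambda>z. f z ^ n * g z) has_field_derivative D n g (deriv g) z) (at z)"
      using DERIV_mult[OF DERIV_power[OF df(1), of n] df(2)] by (simp add: D_def mult_ac add_ac)
    then show ?thesis by (rule DERIV_imp_deriv)
  qed
  have Dbound: "cmod (D n g g' z) \<le> (real n + 1) * b ^ (n - 1) * (K1 * A + B)"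
    if "z \<in> cball 0 1" "cmod (g z) \<le> A" "cmod (g' z) \<le> B" "A > 0" "B > 0" for n g g' z A B
  proof -
    have p: "cmod (f z) ^ k \<le> b ^ k" for k using b(3)[OF that(1)] by (intro power_mono) auto
    have "cmod (D n g g' z) \<le> real n * cmod (f z) ^ (n - 1) * cmod (f' z) * cmod (g z) + cmod (f z) ^ n * cmod (g' z)"
      unfolding D_def by (rule order.trans[OF norm_triangle_ineq]) (simp add: norm_mult norm_power)
    also have "\<dots> \<le> real n * b ^ (n - 1) * K1 * A + b ^ n * B"
      using that K1 p b(1) by (intro add_mono mult_mono) (auto intro!: mult_nonneg_nonneg)
    also have "\<dots> \<le> (real n + 1) * b ^ (n - 1) * (K1 * A) + (real n + 1) * b ^ (n - 1) * B"
    proof (intro add_mono)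
      show "real n * b ^ (n - 1) * K1 * A \<le> (real n + 1) * b ^ (n - 1) * (K1 * A)"
        using b(1) K1(1) that(4) by (simp add: algebra_simps)
      have "b ^ n \<le> b ^ (n - 1)" using b(1,2) by (intro power_decreasing) auto
      also have "\<dots> \<le> (real n + 1) * b ^ (n - 1)" using b(1) by (simp add: algebra_simps)
      finally show "b ^ n * B \<le> (real n + 1) * b ^ (n - 1) * B" using that(5) by (intro mult_right_mono) auto
    qed
    finally show ?thesis by (simp add: algebra_simps)
  qed
  have gp: "green_pair (\<lambda>z. f z ^ n * u z * cnj (f z ^ n * v z)) (\<lambda>z. D n u u' z * cnj (D n v v' z))" for n
  proof (rule green_pair_cong[OF green_pair_holomorphic[of "\<lambda>z. f z ^ n * u z" R "\<lambda>z. f z ^ n * v z"]])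
    show "deriv (\<lambda>z. f z ^ n * u z) z * cnj (deriv (\<lambda>z. f z ^ n * v z) z) = D n u u' z * cnj (D n v v' z)"
      if "z \<in> cball 0 1" for z using that D[OF u that] D[OF v that] by (simp add: u'_def v'_def)
  qed (auto intro!: holomorphic_intros f u v R)
  define A where "A = (K1 * K2 + K3) * (K1 * K4 + K5)"
  have A: "A > 0" using K1 K2 K3 K4 K5 by (auto simp: A_def intro!: mult_pos_pos add_pos_pos)
  have sumb: "summable (\<lambda>n. (real n + 1) * b ^ (n - 1) * (2 * A))"
  proof -
    have "summable (\<lambda>n. real (Suc n) * b ^ n)"
      using geometric_deriv_sums[of b] b(1,2) by (auto simp: sums_iff)
    then have "summable (\<lambda>n. real (Suc n) * b ^ n + b ^ n)"
      using b(1,2) by (intro summable_add summable_geometric) auto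
    then have "summable (\<lambda>n. (real (Suc n) + 1) * b ^ (Suc n - 1))" by (simp add: algebra_simps)
    then have "summable (\<lambda>n. (real n + 1) * b ^ (n - 1))" by (subst (asm) summable_Suc_iff)
    then show ?thesis by (rule summable_mult2)
  qed
  \<comment> \<open>The term n = 0 drops out because 1 / 0 is 0, so both series effectively start at
    n = 1.\<close>
  let ?W = "\<lambda>z. (\<Sum>n. (1 / of_nat n) * (f z ^ n * u z * cnj (f z ^ n * v z)))"
  let ?V = "\<lambda>z. (\<Sum>n. (1 / of_nat n) * (D n u u' z * cnj (D n v v' z)))"
  have series: "green_pair ?W ?V"
  proof (rule green_pair_suminf)
    fix n and z :: complex assume z: "z \<in> cball 0 1"
    have p: "cmod (f z) ^ n \<le> b ^ n" "b ^ n \<le> 1" using b z by (auto intro!: power_mono power_le_one)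
    have "cmod ((1 / of_nat n) * (f z ^ n * u z * cnj (f z ^ n * v z)))
      = (1 / real n) * (cmod (f z) ^ n * cmod (u z) * (cmod (f z) ^ n * cmod (v z)))"
      by (simp add: norm_mult norm_power norm_divide)
    also have "\<dots> \<le> 1 * (b ^ n * K2 * (1 * K4))"
      using p K2(1) K4(1) K2(2)[OF z] K4(2)[OF z] b(1)
      by (intro mult_mono) (auto simp: divide_simps intro!: mult_nonneg_nonneg)
    finally show "cmod ((1 / of_nat n) * (f z ^ n * u z * cnj (f z ^ n * v z))) \<le> b ^ n * (K2 * K4)"
      by (simp add: mult_ac)
    have b1: "b ^ (n - 1) \<le> 1" using b by (intro power_le_one) auto
    have "cmod ((1 / of_nat n) * (D n u u' z * cnj (D n v v' z))) = (1 / real n) * (cmod (D n u u' z) * cmod (D n v v' z))"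
      by (simp add: norm_mult norm_divide)
    also have "\<dots> \<le> (1 / real n) * (((real n + 1) * b ^ (n - 1) * (K1 * K2 + K3)) * ((real n + 1) * b ^ (n - 1) * (K1 * K4 + K5)))"
      using z K1(1) K2 K3 K4 K5 b(1) by (intro mult_left_mono mult_mono Dbound) (auto intro!: mult_nonneg_nonneg add_nonneg_nonneg)
    also have "\<dots> = ((real n + 1) / real n) * b ^ (n - 1) * ((real n + 1) * b ^ (n - 1) * A)"
      by (simp add: A_def mult_ac)
    \<comment> \<open>The weight 1/n cancels one of the two factors n + 1 up to 2, and one of the
      two powers of \<open>b\<close> is discarded; what remains is summable.\<close>
    also have "\<dots> \<le> 2 * 1 * ((real n + 1) * b ^ (n - 1) * A)"
    proof (cases "n = 0")
      case False
      then have "(real n + 1) / real n \<le> 2" by (simp add: divide_simps)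
      then show ?thesis using b1 b(1) A by (intro mult_right_mono mult_mono) auto
    qed (use A b in auto)
    finally show "cmod ((1 / of_nat n) * (D n u u' z * cnj (D n v v' z))) \<le> (real n + 1) * b ^ (n - 1) * (2 * A)"
      by (simp add: mult_ac)
  next
    show "summable (\<lambda>n. b ^ n * (K2 * K4))" using b by (intro summable_mult2 summable_geometric) auto
  qed (intro sumb green_pair_cmult gp)+
  have "green_pair (\<lambda>z. 4 * (u z * cnj (v z)) + ?W z) (\<lambda>z. 4 * (u' z * cnj (v' z)) + ?V z)"
    unfolding u'_def v'_def
    by (rule green_pair_add[OF green_pair_cmult[OF green_pair_holomorphic[OF u v R]] series[unfolded u'_def v'_def]])
  then show ?thesis
  proof (rule green_pair_cong)
    fix z :: complex assume z: "z \<in> cball 0 1"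
    let ?s = "of_real (s z) :: complex"
    have ss: "f z * cnj (f z) = ?s" using complex_norm_square[of "f z"] by (simp add: s_def)
    have s1: "0 \<le> s z" "s z < 1" using f1[OF z] by (auto simp: s_def abs_square_less_1)
    have "(\<lambda>n. - ((- (- s z)) ^ n) / of_nat n) sums ln (1 + (- s z))"
      by (rule ln_series') (use s1 in auto)
    then have "(\<lambda>n. complex_of_real (- (- (s z ^ n) / real n))) sums of_real (- ln (1 - s z))"
      by (intro sums_of_real sums_minus) simp
    then have L0: "(\<lambda>n. ?s ^ n / of_nat n) sums of_real (- ln (1 - s z))" by simp
    have "(\<lambda>n. of_real (s z ^ n)) sums complex_of_real (1 / (1 - s z))"
      by (intro sums_of_real geometric_sums) (use s1 in auto)
    then have "(\<lambda>n. ?s ^ n) sums of_real (1 / (1 - s z))" by simp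
    \<comment> \<open>The factor \<open>of_nat n / of_nat n\<close> is 0 for n = 0 and 1 otherwise;
      it removes the spurious first term that the truncated exponent \<open>n - 1\<close> would
      produce.\<close>
    then have L1: "(\<lambda>n. of_nat n / of_nat n * ?s ^ (n - 1)) sums of_real (1 / (1 - s z))"
      using sums_Suc[of "\<lambda>n. of_nat n / of_nat n * ?s ^ (n - 1)"] by (simp del: of_nat_Suc)
    have "(\<lambda>n. of_real (of_nat (Suc n) * s z ^ n)) sums complex_of_real (1 / (1 - s z)\<^sup>2)"
      by (intro sums_of_real geometric_deriv_sums) (use s1 in auto)
    then have "(\<lambda>n. of_nat (Suc n) * ?s ^ n) sums of_real (1 / (1 - s z)\<^sup>2)" by (simp del: of_nat_Suc)
    then have L2: "(\<lambda>n. of_nat n * ?s ^ (n - 1)) sums of_real (1 / (1 - s z)\<^sup>2)"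
      using sums_Suc[of "\<lambda>n. of_nat n * ?s ^ (n - 1)"] by (simp del: of_nat_Suc)
    have "(1 / of_nat n) * (f z ^ n * u z * cnj (f z ^ n * v z)) = ?s ^ n / of_nat n * (u z * cnj (v z))" for n
      by (simp add: ss[symmetric] power_mult_distrib)
    then have W: "?W z = of_real (- ln (1 - s z)) * (u z * cnj (v z))"
      using sums_unique[OF sums_mult2[OF L0, of "u z * cnj (v z)"]] by (simp only:)
    have comb: "4 * x + of_real (- l) * x = of_real (4 - l) * x" for x :: complex and l
      by (simp add: algebra_simps)
    show "4 * (u z * cnj (v z)) + ?W z = of_real (4 - ln (1 - s z)) * (u z * cnj (v z))"
      unfolding W by (rule comb)
    have expand: "(1 / of_nat n) * (D n u u' z * cnj (D n v v' z)) =
      ?s ^ n / of_nat n * (u' z * cnj (v' z))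
      + of_nat n / of_nat n * ?s ^ (n - 1) * (f' z * u z * cnj (f z * v' z) + f z * u' z * cnj (f' z * v z))
      + of_nat n * ?s ^ (n - 1) * (f' z * u z * cnj (f' z * v z))" for n
    proof (cases n)
      case (Suc k)
      have "(of_nat (Suc k) :: complex) \<noteq> 0" by (simp del: of_nat_Suc)
      from log_weight_expand[OF this, of "f z ^ k" "f' z" "u z" "f z" "u' z" "cnj (f z) ^ k" "cnj (f' z)" "cnj (v z)" "cnj (f z)" "cnj (v' z)"]
      show ?thesis unfolding Suc D_def by (simp add: ss[symmetric] power_mult_distrib del: of_nat_Suc)
    qed (simp add: D_def)
    have "(\<lambda>n. (1 / of_nat n) * (D n u u' z * cnj (D n v v' z))) sums
      (of_real (- ln (1 - s z)) * (u' z * cnj (v' z))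
      + of_real (1 / (1 - s z)) * (f' z * u z * cnj (f z * v' z) + f z * u' z * cnj (f' z * v z))
      + of_real (1 / (1 - s z)\<^sup>2) * (f' z * u z * cnj (f' z * v z)))"
      unfolding expand by (intro sums_add sums_mult2 L0 L1 L2)
    note V = sums_unique[OF this, symmetric]
    show "4 * (u' z * cnj (v' z)) + ?V z = of_real (4 - ln (1 - s z)) * (u' z * cnj (v' z))
      + of_real (1 / (1 - s z)) * (f' z * u z * cnj (f z * v' z) + f z * u' z * cnj (f' z * v z))
      + of_real (1 / (1 - s z)\<^sup>2) * (f' z * u z * cnj (f' z * v z))"
      unfolding V add.assoc[symmetric] comb ..
  qed
qed

section \<open>Energy estimates\<close>

definition hardy_norm2 :: "(complex \<Rightarrow> complex) \<Rightarrow> real" where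
  "hardy_norm2 u = Re (circ_mean (\<lambda>z. u z * cnj (u z)))"

lemma Re_circ_mean_mono:
  assumes "continuous_on (cball 0 1) F" "continuous_on (cball 0 1) G"
    and "\<And>z. cmod z = 1 \<Longrightarrow> Re (F z) \<le> Re (G z)"
  shows "Re (circ_mean F) \<le> Re (circ_mean G)"
  using assms by (intro circ.Re_avg_mono) auto

lemma Re_disc_mean_mono:
  assumes "continuous_on (cball 0 1) F" "continuous_on (cball 0 1) G"
    and "\<And>z. z \<in> cball 0 1 \<Longrightarrow> Re (F z) \<le> Re (G z)"
  shows "Re (disc_mean F) \<le> Re (disc_mean G)"
  using assms disc.ran by (intro disc.Re_avg_mono) (auto simp: image_subset_iff)

lemma norm_disc_mean_le:
  assumes "continuous_on (cball 0 1) F" "continuous_on (cball 0 1) G"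
    and "\<And>z. z \<in> cball 0 1 \<Longrightarrow> cmod (F z) \<le> Re (G z)"
  shows "cmod (disc_mean F) \<le> Re (disc_mean G)"
  using assms disc.ran by (intro disc.norm_avg_le) (auto simp: image_subset_iff)

lemma Re_disc_mean_nonneg:
  assumes "continuous_on (cball 0 1) F" "\<And>z. z \<in> cball 0 1 \<Longrightarrow> 0 \<le> Re (F z)"
  shows "0 \<le> Re (disc_mean F)"
  using Re_disc_mean_mono[of "\<lambda>_. 0" F] assms by (simp add: disc.avg_def)

lemma circ_mean_cong:
  assumes "\<And>z. cmod z = 1 \<Longrightarrow> F z = G z"
  shows "circ_mean F = circ_mean G"
  using assms by (simp add: circ.avg_def)

lemma mult_cnj_self: "z * cnj z = of_real ((cmod z)\<^sup>2)"
  by (simp add: complex_norm_square[symmetric])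

text \<open>The Littlewood--Paley formula. It carries no constant because \<open>disc_mean\<close>
  is normalized so that the derivative of z^n has mean square 1 for n > 0.\<close>

lemma hardy_norm2_green:
  assumes "u holomorphic_on ball 0 R" "1 < R"
  shows "hardy_norm2 u = (cmod (u 0))\<^sup>2 + Re (disc_mean (\<lambda>z. of_real ((cmod (deriv u z))\<^sup>2)))"
  using green_pair_holomorphic[OF assms(1,1,2)]
  by (simp add: hardy_norm2_def green_pair_def mult_cnj_self)

lemma hardy_norm2_nonneg:
  assumes "u holomorphic_on ball 0 R" "1 < R"
  shows "0 \<le> hardy_norm2 u"
  unfolding hardy_norm2_green[OF assms]
  by (intro add_nonneg_nonneg Re_disc_mean_nonneg)
    (auto intro!: continuous_intros holomorphic_continuous_on_cball[OF assms])

text \<open>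
The derivative of $f^{n+1}y$ controls $(n+1)f^nf'y$; summing these bounds over $n$ with weights $1/(n+1)^2$
yields a Carleson embedding with the unbounded density $|f'|^2/(1-|f|^2)$.
\<close>
lemma energy_power_le:
  assumes f: "f holomorphic_on ball 0 R" and y: "y holomorphic_on ball 0 R" and R: "1 < R"
    and f1: "\<And>z. z \<in> cball 0 1 \<Longrightarrow> cmod (f z) < 1"
  shows "(real n + 1)\<^sup>2 * Re (disc_mean (\<lambda>z. of_real (((cmod (f z))\<^sup>2) ^ n * (cmod (deriv f z) * cmod (y z))\<^sup>2)))
    \<le> 4 * hardy_norm2 y"
proof -
  note c = holomorphic_continuous_on_cball[OF f R] holomorphic_continuous_on_cball[OF y R]
  define g where "g z = f z ^ Suc n * y z" for z
  have g: "g holomorphic_on ball 0 R" unfolding g_def by (intro holomorphic_intros f y)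
  have dg: "deriv g z = of_nat (Suc n) * f z ^ n * deriv f z * y z + f z ^ Suc n * deriv y z" if "z \<in> cball 0 1" for z
  proof (rule DERIV_imp_deriv)
    have z: "z \<in> ball 0 R" using that R by auto
    have df: "(f has_field_derivative deriv f z) (at z)" "(y has_field_derivative deriv y z) (at z)"
      using z f y by (auto intro: holomorphic_derivI)
    show "(g has_field_derivative of_nat (Suc n) * f z ^ n * deriv f z * y z + f z ^ Suc n * deriv y z) (at z)"
      using DERIV_mult[OF DERIV_power[OF df(1), of "Suc n"] df(2)]
      unfolding g_def by (simp add: mult_ac add_ac del: of_nat_Suc)
  qed
  have pw: "cmod (f z) ^ k \<le> 1" if "z \<in> cball 0 1" for z k
    using f1[OF that] by (intro power_le_one) auto
  have "(real n + 1)\<^sup>2 * Re (disc_mean (\<lambda>z. of_real (((cmod (f z))\<^sup>2) ^ n * (cmod (deriv f z) * cmod (y z))\<^sup>2)))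
    = Re (disc_mean (\<lambda>z. of_real ((real n + 1)\<^sup>2) * of_real (((cmod (f z))\<^sup>2) ^ n * (cmod (deriv f z) * cmod (y z))\<^sup>2)))"
    unfolding disc.avg_cmult by (simp del: of_real_power)
  also have "\<dots> \<le> Re (disc_mean (\<lambda>z. 2 * of_real ((cmod (deriv g z))\<^sup>2) + 2 * of_real ((cmod (deriv y z))\<^sup>2)))"
  proof (rule Re_disc_mean_mono)
    fix z :: complex assume z: "z \<in> cball 0 1"
    let ?a = "of_nat (Suc n) * f z ^ n * deriv f z * y z"
    have "cmod (f z ^ Suc n * deriv y z) \<le> 1 * cmod (deriv y z)"
      unfolding norm_mult norm_power using pw[OF z, of "Suc n"] by (intro mult_right_mono) auto
    moreover have "cmod ?a \<le> cmod (deriv g z) + cmod (f z ^ Suc n * deriv y z)"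
      unfolding dg[OF z] using norm_triangle_ineq4[of "?a + f z ^ Suc n * deriv y z" "f z ^ Suc n * deriv y z"]
      by (simp only: add_diff_cancel_right')
    ultimately have "cmod ?a \<le> cmod (deriv g z) + cmod (deriv y z)" by linarith
    then have sq: "(cmod ?a)\<^sup>2 \<le> (cmod (deriv g z) + cmod (deriv y z))\<^sup>2" by (intro power_mono) auto
    have norm_a: "cmod ?a = (real n + 1) * cmod (f z) ^ n * (cmod (deriv f z) * cmod (y z))"
      by (simp add: norm_mult norm_power mult.assoc of_nat_Suc[where 'a = real] del: of_nat_Suc)
    have square_eq: "((real n + 1) * cmod (f z) ^ n * (cmod (deriv f z) * cmod (y z)))\<^sup>2
      = (real n + 1)\<^sup>2 * (((cmod (f z))\<^sup>2) ^ n * (cmod (deriv f z) * cmod (y z))\<^sup>2)"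
      by (simp only: power_mult_distrib power_mult[symmetric] mult.commute[of 2] mult.assoc)
    have "(real n + 1)\<^sup>2 * (((cmod (f z))\<^sup>2) ^ n * (cmod (deriv f z) * cmod (y z))\<^sup>2)
      \<le> (cmod (deriv g z) + cmod (deriv y z))\<^sup>2" using sq unfolding norm_a square_eq .
    also have "\<dots> \<le> 2 * (cmod (deriv g z))\<^sup>2 + 2 * (cmod (deriv y z))\<^sup>2"
      using sum_squares_bound[of "cmod (deriv g z)" "cmod (deriv y z)"] by (simp add: power2_sum)
    finally show "Re (of_real ((real n + 1)\<^sup>2) * of_real (((cmod (f z))\<^sup>2) ^ n * (cmod (deriv f z) * cmod (y z))\<^sup>2))
      \<le> Re (2 * of_real ((cmod (deriv g z))\<^sup>2) + 2 * of_real ((cmod (deriv y z))\<^sup>2))"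
      by (simp del: of_real_power)
  qed (auto intro!: continuous_intros c holomorphic_continuous_on_cball[OF g R])
  also have "\<dots> = 2 * Re (disc_mean (\<lambda>z. of_real ((cmod (deriv g z))\<^sup>2))) + 2 * Re (disc_mean (\<lambda>z. of_real ((cmod (deriv y z))\<^sup>2)))"
    by (subst disc.avg_add) (auto intro!: continuous_intros c holomorphic_continuous_on_cball[OF g R] simp: disc.avg_cmult)
  \<comment> \<open>Littlewood--Paley with the values at 0 dropped. As |g| \<le> |y| on the circle,
    the two coefficients 2 add up to the constant 4.\<close>
  also have "\<dots> \<le> 2 * hardy_norm2 g + 2 * hardy_norm2 y"
    unfolding hardy_norm2_green[OF g R] hardy_norm2_green[OF y R] by simp
  also have "hardy_norm2 g \<le> hardy_norm2 y"
    unfolding hardy_norm2_def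
  proof (rule Re_circ_mean_mono)
    fix z :: complex assume "cmod z = 1"
    then have "cmod (f z ^ Suc n) \<le> 1" unfolding norm_power using pw[of z "Suc n"] by simp
    then have "(cmod (g z))\<^sup>2 \<le> (cmod (y z))\<^sup>2"
      unfolding g_def norm_mult by (intro power_mono mult_left_le_one_le) auto
    then show "Re (g z * cnj (g z)) \<le> Re (y z * cnj (y z))" by (simp add: mult_cnj_self)
  qed (auto intro!: continuous_intros c holomorphic_continuous_on_cball[OF g R])
  finally show ?thesis by simp
qed

text \<open>The sum over n of the bounds of \<open>energy_power_le\<close>, divided by (n + 1)^2;
  its value is 2 pi^2 / 3.\<close>

definition carleson_const :: real where "carleson_const = (\<Sum>n. 4 / (real n + 1)\<^sup>2)"

lemma carleson_const_sums: "(\<lambda>n. 4 / (real n + 1)\<^sup>2) sums carleson_const"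
  using sums_mult[OF inverse_squares_sums, of 4] unfolding carleson_const_def
  by (simp add: sums_iff add.commute)

lemma carleson_const_nonneg: "0 \<le> carleson_const"
  unfolding carleson_const_def using sums_summable[OF carleson_const_sums]
  by (intro suminf_nonneg) auto

lemma carleson_embedding:
  assumes f: "f holomorphic_on ball 0 R" and y: "y holomorphic_on ball 0 R" and R: "1 < R"
    and f1: "\<And>z. z \<in> cball 0 1 \<Longrightarrow> cmod (f z) < 1"
  shows "Re (disc_mean (\<lambda>z. of_real ((cmod (deriv f z) * cmod (y z))\<^sup>2 / (1 - (cmod (f z))\<^sup>2))))
    \<le> carleson_const * hardy_norm2 y"
proof -
  note c = holomorphic_continuous_on_cball[OF f R] holomorphic_continuous_on_cball[OF y R]
  \<comment> \<open>The bound \<open>b\<close> < 1 only justifies the interchange of the geometric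
    series with the mean; it does not enter the constant, which therefore survives the later
    limit.\<close>
  obtain b where b: "0 < b" "b < 1" "\<And>z. z \<in> cball 0 1 \<Longrightarrow> cmod (f z) \<le> b"
    using cmod_less_1_cball[OF c(1) f1] by blast
  define h where "h z = complex_of_real ((cmod (deriv f z) * cmod (y z))\<^sup>2)" for z
  have hc: "continuous_on (cball 0 1) h" unfolding h_def by (intro continuous_intros c)
  obtain K where K: "K > 0" "\<And>z. z \<in> cball 0 1 \<Longrightarrow> cmod (h z) \<le> K"
    using continuous_on_cball_bounded[OF hc] by blast
  define F where "F n z = complex_of_real (((cmod (f z))\<^sup>2) ^ n * (cmod (deriv f z) * cmod (y z))\<^sup>2)" for n z
  have sF: "(\<lambda>n. disc_mean (F n)) sums disc_mean (\<lambda>z. \<Sum>n. F n z)"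
  proof (rule disc.avg_suminf)
    fix n and z :: complex assume z: "z \<in> cball 0 1"
    have "((cmod (f z))\<^sup>2) ^ n \<le> (b\<^sup>2) ^ n" using b(3)[OF z] by (intro power_mono) auto
    then have "((cmod (f z))\<^sup>2) ^ n * cmod (h z) \<le> (b\<^sup>2) ^ n * K"
      using K(2)[OF z] by (intro mult_mono) auto
    then show "cmod (F n z) \<le> (b\<^sup>2) ^ n * K" by (simp add: F_def h_def norm_mult norm_power)
  next
    show "summable (\<lambda>n. (b\<^sup>2) ^ n * K)"
      using b by (intro summable_mult2 summable_geometric) (simp add: abs_square_less_1)
    show "continuous_on (cball 0 1) (F n)" for n unfolding F_def by (intro continuous_intros c)
  qed
  have eq: "disc_mean (\<lambda>z. \<Sum>n. F n z) =
    disc_mean (\<lambda>z. of_real ((cmod (deriv f z) * cmod (y z))\<^sup>2 / (1 - (cmod (f z))\<^sup>2)))"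
    unfolding disc.avg_def
  proof (intro arg_cong2[where f = "scaleR"] refl integral_cong)
    fix p :: "real \<times> real \<times> real" assume "p \<in> cbox (0, 0, 0) (1, 1, 2 * pi)"
    then have z: "of_real (sqrt (fst p * fst (snd p))) * cis (snd (snd p)) \<in> cball 0 1"
      using disc.ran by auto
    define z where "z = of_real (sqrt (fst p * fst (snd p))) * cis (snd (snd p))"
    have "(cmod (f z))\<^sup>2 < 1" using f1 z by (simp add: z_def abs_square_less_1)
    then have "(\<lambda>n. ((cmod (f z))\<^sup>2) ^ n) sums (1 / (1 - (cmod (f z))\<^sup>2))"
      by (intro geometric_sums) auto
    from sums_of_real[OF sums_mult2[OF this]]
    have "(\<lambda>n. F n z) sums of_real (1 / (1 - (cmod (f z))\<^sup>2) * (cmod (deriv f z) * cmod (y z))\<^sup>2)"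
      unfolding F_def .
    then show "(\<Sum>n. F n (of_real (sqrt (fst p * fst (snd p))) * cis (snd (snd p)))) =
      of_real ((cmod (deriv f (of_real (sqrt (fst p * fst (snd p))) * cis (snd (snd p)))) *
        cmod (y (of_real (sqrt (fst p * fst (snd p))) * cis (snd (snd p)))))\<^sup>2 /
        (1 - (cmod (f (of_real (sqrt (fst p * fst (snd p))) * cis (snd (snd p)))))\<^sup>2))"
      unfolding z_def[symmetric] by (simp add: sums_iff)
  qed
  have "Re (disc_mean (F n)) \<le> 4 / (real n + 1)\<^sup>2 * hardy_norm2 y" for n
    using energy_power_le[OF f y R f1, of n] by (simp add: F_def[abs_def] field_simps)
  from sums_le[OF this sums_Re[OF sF] sums_mult2[OF carleson_const_sums]]
  show ?thesis unfolding eq .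
qed

text \<open>The linear budget of the next lemma. Of \<open>p1\<close> and \<open>p2\<close> one
  quarter is spent on \<open>r\<close> and one half on \<open>q\<close>, which leaves a quarter;
  \<open>\<sigma>\<close> is spent entirely on \<open>q\<close>; and 17 = 16 + 1 collects the error
  terms \<open>e1\<close>, \<open>e2\<close>.\<close>

lemma pointwise_lower_bound_arith:
  fixes r q \<sigma> p1 p2 e1 e2 a b :: real
  assumes "r \<le> p1 / 4 + p2 / 4 + 16 * e2 + 16 * e1"
    "- q \<le> (2 * a + \<sigma> / 2) + (2 * b + \<sigma> / 2) + (e1 + e2)"
    "2 * a \<le> p1 / 2" "2 * b \<le> p2 / 2"
  shows "p1 / 4 + p2 / 4 - 17 * (e1 + e2) \<le> p1 + p2 - r + q + \<sigma>"
  using assms by argo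

text \<open>
The left-hand side is $\partial\overline\partial(\kappa S)$ for $S = |y|^2+|Y|^2-2\,\mathrm{Re}(\overline f yY)$ and
$\kappa = 4-\log(1-|f|^2)$, where $F, y_1, Y_1$ stand for $f', y', Y'$. The cross terms are absorbed because $\kappa\kappa'' \ge 4\kappa'^2$
as functions of $|f|^2$; this is the reason for the constant 4 in the weight.
\<close>
lemma pointwise_lower_bound:
  fixes f F y Y y1 Y1 :: complex and \<kappa> t :: real
  defines "t \<equiv> 1 - (cmod f)\<^sup>2"
  assumes t: "0 < t" and \<kappa>: "4 \<le> \<kappa>" "\<kappa> \<le> 4 / t"
  defines "V \<equiv> \<lambda>u u' v v'. of_real \<kappa> * (u' * cnj v') + of_real (1 / t) * (F * u * cnj (f * v') + f * u' * cnj (F * v))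
      + of_real (1 / t\<^sup>2) * (F * u * cnj (F * v))"
  shows "Re (V y y1 y y1 + V Y Y1 Y Y1 - V (y * Y) (y1 * Y + y * Y1) f F - V f F (y * Y) (y1 * Y + y * Y1))
    \<ge> \<kappa> / 4 * ((cmod y1)\<^sup>2 + (cmod Y1)\<^sup>2) - 17 * ((cmod F * cmod y)\<^sup>2 / t + (cmod F * cmod Y)\<^sup>2 / t)"
proof -
  define D1 where "D1 = cnj y - cnj f * Y"
  define D2 where "D2 = cnj Y - cnj f * y"
  define S where "S = (cmod y)\<^sup>2 + (cmod Y)\<^sup>2 - 2 * Re (cnj f * y * Y)"
  \<comment> \<open>\<open>D1\<close> and \<open>D2\<close> are the derivatives of \<open>S\<close>
    in y and Y, so the bracket is the holomorphic derivative of S and \<open>Q\<close> is the cross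
    term in which the other derivative falls on |f|^2. \<open>P\<close> comes from the mixed
    derivative of the product f, y, Y inside S.\<close>
  define Q where "Q = f * cnj F * (y1 * D1 + Y1 * D2 - F * cnj y * cnj Y)"
  define P where "P = cnj F * (y1 * Y + y * Y1)"
  have Sc: "of_real S = y * cnj y + Y * cnj Y - cnj f * y * Y - f * cnj y * cnj Y"
  proof -
    have "of_real (2 * Re (cnj f * y * Y)) = cnj f * y * Y + cnj (cnj f * y * Y)"
      by (simp only: complex_add_cnj)
    then show ?thesis by (simp add: S_def mult_cnj_self)
  qed
  have "V y y1 y y1 + V Y Y1 Y Y1 - V (y * Y) (y1 * Y + y * Y1) f F - V f F (y * Y) (y1 * Y + y * Y1)
    = of_real \<kappa> * (y1 * cnj y1 + Y1 * cnj Y1 - (P + cnj P)) + of_real (1 / t) * (Q + cnj Q)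
      + of_real (1 / t\<^sup>2) * (F * cnj F * of_real S)"
    unfolding V_def P_def Q_def D1_def D2_def Sc by (simp add: algebra_simps)
  also have "\<dots> = of_real (\<kappa> * ((cmod y1)\<^sup>2 + (cmod Y1)\<^sup>2 - 2 * Re P) + 1 / t * (2 * Re Q) + 1 / t\<^sup>2 * ((cmod F)\<^sup>2 * S))"
    by (simp only: complex_add_cnj mult_cnj_self of_real_add of_real_mult of_real_diff)
  finally have eq: "Re (V y y1 y y1 + V Y Y1 Y Y1 - V (y * Y) (y1 * Y + y * Y1) f F - V f F (y * Y) (y1 * Y + y * Y1))
    = \<kappa> * ((cmod y1)\<^sup>2 + (cmod Y1)\<^sup>2 - 2 * Re P) + 1 / t * (2 * Re Q) + 1 / t\<^sup>2 * ((cmod F)\<^sup>2 * S)"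
    by simp
  \<comment> \<open>Completing the square in either variable. Hence S dominates both |D1|^2 and
    |D2|^2, and the term with the second derivative of the weight can absorb
    \<open>Q\<close>.\<close>
  have S1: "S = (cmod D1)\<^sup>2 + t * (cmod Y)\<^sup>2" and S2: "S = (cmod D2)\<^sup>2 + t * (cmod y)\<^sup>2"
  proof -
    have "complex_of_real S = of_real ((cmod D1)\<^sup>2 + t * (cmod Y)\<^sup>2)" "complex_of_real S = of_real ((cmod D2)\<^sup>2 + t * (cmod y)\<^sup>2)"
      unfolding Sc of_real_add of_real_mult t_def of_real_diff mult_cnj_self[symmetric] D1_def D2_def
      by (simp_all add: algebra_simps)
    then show "S = (cmod D1)\<^sup>2 + t * (cmod Y)\<^sup>2" "S = (cmod D2)\<^sup>2 + t * (cmod y)\<^sup>2"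
      by (simp_all only: of_real_eq_iff)
  qed
  have D: "(cmod D1)\<^sup>2 \<le> S" "(cmod D2)\<^sup>2 \<le> S"
    using S1 S2 t by (metis add_increasing2 order_refl mult_nonneg_nonneg less_imp_le zero_le_power2)+
  have f1: "cmod f \<le> 1" using t unfolding t_def using abs_square_less_1[of "cmod f"] by simp
  have ReP: "Re P \<le> cmod F * cmod y1 * cmod Y + cmod F * cmod Y1 * cmod y"
  proof -
    have "Re P \<le> cmod P" by (rule complex_Re_le_cmod)
    also have "\<dots> \<le> cmod F * (cmod (y1 * Y) + cmod (y * Y1))"
      unfolding P_def norm_mult[of "cnj F"] by (simp add: mult_left_mono norm_triangle_ineq)
    finally show ?thesis by (simp add: norm_mult algebra_simps)
  qed
  have ReQ: "- Re Q \<le> cmod F * cmod y1 * cmod D1 + cmod F * cmod Y1 * cmod D2 + (cmod F)\<^sup>2 * (cmod y * cmod Y)"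
  proof -
    have "- Re Q \<le> cmod Q" using abs_Re_le_cmod[of Q] by linarith
    also have "\<dots> = cmod f * (cmod F * cmod (y1 * D1 + Y1 * D2 - F * cnj y * cnj Y))"
      by (simp add: Q_def norm_mult)
    also have "\<dots> \<le> 1 * (cmod F * (cmod (y1 * D1) + cmod (Y1 * D2) + cmod (F * cnj y * cnj Y)))"
      using f1 by (intro mult_mono order.trans[OF norm_triangle_ineq4] add_right_mono norm_triangle_ineq) auto
    finally show ?thesis by (simp add: norm_mult algebra_simps power2_eq_square)
  qed
  \<comment> \<open>The second weighting is the one that needs 4 \<le> \<kappa>: it spends 2 |y1|^2,
    at most half of \<kappa> |y1|^2, and half of the term with S; the same again for Y1.\<close>
  have amgm: "2 * (a * b) \<le> a\<^sup>2 / 4 + 4 * b\<^sup>2" "2 * (a * b) \<le> 2 * a\<^sup>2 + b\<^sup>2 / 2" "2 * (a * b) \<le> a\<^sup>2 + b\<^sup>2" for a b :: real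
    using sum_squares_bound[of "a / 2" "2 * b"] sum_squares_bound[of "2 * a" b] sum_squares_bound[of a b]
    by (simp_all add: power2_eq_square algebra_simps)
  have B1: "2 * Re P \<le> (cmod y1)\<^sup>2 / 4 + 4 * (cmod F * cmod Y)\<^sup>2 + (cmod Y1)\<^sup>2 / 4 + 4 * (cmod F * cmod y)\<^sup>2"
    using ReP amgm(1)[of "cmod y1" "cmod F * cmod Y"] amgm(1)[of "cmod Y1" "cmod F * cmod y"]
    by (simp add: mult_ac)
  have B2: "- (1 / t * (2 * Re Q)) \<le> (2 * (cmod y1)\<^sup>2 + 1 / t\<^sup>2 * ((cmod F)\<^sup>2 * S) / 2) + (2 * (cmod Y1)\<^sup>2 + 1 / t\<^sup>2 * ((cmod F)\<^sup>2 * S) / 2)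
      + ((cmod F * cmod y)\<^sup>2 / t + (cmod F * cmod Y)\<^sup>2 / t)"
  proof -
    have "- (1 / t * (2 * Re Q)) = 1 / t * (2 * (- Re Q))" by simp
    also have "\<dots> \<le> 1 / t * (2 * (cmod F * cmod y1 * cmod D1 + cmod F * cmod Y1 * cmod D2 + (cmod F)\<^sup>2 * (cmod y * cmod Y)))"
      using ReQ t by (intro mult_left_mono) auto
    also have "\<dots> = 2 * (cmod y1 * (cmod F * cmod D1 / t)) + 2 * (cmod Y1 * (cmod F * cmod D2 / t)) + (cmod F)\<^sup>2 * (2 * (cmod y * cmod Y)) / t"
      by (simp add: algebra_simps add_divide_distrib)
    also have "\<dots> \<le> (2 * (cmod y1)\<^sup>2 + (cmod F * cmod D1 / t)\<^sup>2 / 2) + (2 * (cmod Y1)\<^sup>2 + (cmod F * cmod D2 / t)\<^sup>2 / 2)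
       + (cmod F)\<^sup>2 * ((cmod y)\<^sup>2 + (cmod Y)\<^sup>2) / t"
      using t by (intro add_mono amgm divide_right_mono mult_left_mono) auto
    also have "\<dots> \<le> (2 * (cmod y1)\<^sup>2 + 1 / t\<^sup>2 * ((cmod F)\<^sup>2 * S) / 2) + (2 * (cmod Y1)\<^sup>2 + 1 / t\<^sup>2 * ((cmod F)\<^sup>2 * S) / 2)
       + ((cmod F * cmod y)\<^sup>2 / t + (cmod F * cmod Y)\<^sup>2 / t)"
    proof (intro add_mono order.refl)
      have "(cmod F * cmod D / t)\<^sup>2 / 2 \<le> 1 / t\<^sup>2 * ((cmod F)\<^sup>2 * S) / 2" if "(cmod D)\<^sup>2 \<le> S" for D
      proof -
        have "(cmod F)\<^sup>2 * (cmod D)\<^sup>2 / t\<^sup>2 \<le> (cmod F)\<^sup>2 * S / t\<^sup>2"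
          using that by (intro divide_right_mono mult_left_mono) auto
        then have "(cmod F * cmod D / t)\<^sup>2 \<le> 1 / t\<^sup>2 * ((cmod F)\<^sup>2 * S)"
          by (simp add: power_mult_distrib power_divide)
        then show ?thesis by (rule divide_right_mono) simp
      qed
      then show "(cmod F * cmod D1 / t)\<^sup>2 / 2 \<le> 1 / t\<^sup>2 * ((cmod F)\<^sup>2 * S) / 2"
        "(cmod F * cmod D2 / t)\<^sup>2 / 2 \<le> 1 / t\<^sup>2 * ((cmod F)\<^sup>2 * S) / 2" using D by auto
      show "(cmod F)\<^sup>2 * ((cmod y)\<^sup>2 + (cmod Y)\<^sup>2) / t \<le> (cmod F * cmod y)\<^sup>2 / t + (cmod F * cmod Y)\<^sup>2 / t"
        by (simp add: power_mult_distrib add_divide_distrib distrib_left)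
    qed
    finally show ?thesis .
  qed
  \<comment> \<open>Here the upper bound on \<kappa> enters: it turns the errors from
    \<open>P\<close> into multiples of the density in \<open>carleson_embedding\<close>.\<close>
  have B3: "\<kappa> * (4 * (cmod F * w)\<^sup>2) \<le> 16 * ((cmod F * w)\<^sup>2 / t)" for w
    using mult_right_mono[OF \<kappa>(2), of "4 * (cmod F * w)\<^sup>2"] by simp
  have B4: "2 * w\<^sup>2 \<le> \<kappa> / 2 * w\<^sup>2" for w :: real
    using \<kappa>(1) by (intro mult_right_mono) auto
  have "\<kappa> * (2 * Re P) \<le> \<kappa> * ((cmod y1)\<^sup>2 / 4 + 4 * (cmod F * cmod Y)\<^sup>2 + (cmod Y1)\<^sup>2 / 4 + 4 * (cmod F * cmod y)\<^sup>2)"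
    using B1 \<kappa> by (intro mult_left_mono) auto
  then have B1': "\<kappa> * (2 * Re P) \<le> \<kappa> / 4 * (cmod y1)\<^sup>2 + \<kappa> / 4 * (cmod Y1)\<^sup>2
      + 16 * ((cmod F * cmod Y)\<^sup>2 / t) + 16 * ((cmod F * cmod y)\<^sup>2 / t)"
    using B3[of "cmod y"] B3[of "cmod Y"] by (simp add: distrib_left)
  define p1 p2 r q \<sigma> e1 e2 where defs: "p1 = \<kappa> * (cmod y1)\<^sup>2" "p2 = \<kappa> * (cmod Y1)\<^sup>2"
    "r = \<kappa> * (2 * Re P)" "q = 1 / t * (2 * Re Q)" "\<sigma> = 1 / t\<^sup>2 * ((cmod F)\<^sup>2 * S)"
    "e1 = (cmod F * cmod y)\<^sup>2 / t" "e2 = (cmod F * cmod Y)\<^sup>2 / t"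
  have e: "\<kappa> * ((cmod y1)\<^sup>2 + (cmod Y1)\<^sup>2 - 2 * Re P) = p1 + p2 - r"
    "\<kappa> / 4 * ((cmod y1)\<^sup>2 + (cmod Y1)\<^sup>2) = p1 / 4 + p2 / 4"
    "\<kappa> / 4 * (cmod y1)\<^sup>2 = p1 / 4" "\<kappa> / 4 * (cmod Y1)\<^sup>2 = p2 / 4"
    "\<kappa> / 2 * (cmod y1)\<^sup>2 = p1 / 2" "\<kappa> / 2 * (cmod Y1)\<^sup>2 = p2 / 2"
    unfolding defs by (simp_all only: right_diff_distrib distrib_left times_divide_eq_left)
  have "r \<le> p1 / 4 + p2 / 4 + 16 * e2 + 16 * e1"
    using B1' unfolding e defs(3,6,7) .
  moreover have "- q \<le> (2 * (cmod y1)\<^sup>2 + \<sigma> / 2) + (2 * (cmod Y1)\<^sup>2 + \<sigma> / 2) + (e1 + e2)"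
    using B2 unfolding defs(4-7) .
  moreover have "2 * (cmod y1)\<^sup>2 \<le> p1 / 2" "2 * (cmod Y1)\<^sup>2 \<le> p2 / 2"
    using B4[of "cmod y1"] B4[of "cmod Y1"] unfolding e .
  ultimately have "p1 / 4 + p2 / 4 - 17 * (e1 + e2) \<le> p1 + p2 - r + q + \<sigma>"
    by (rule pointwise_lower_bound_arith)
  then show ?thesis unfolding eq e unfolding defs(4-7) .
qed

section \<open>The logarithmic weight and the weighted energy inequality\<close>

definition log_weight :: "(complex \<Rightarrow> complex) \<Rightarrow> complex \<Rightarrow> real" where
  "log_weight f z = 4 - ln (1 - (cmod (f z))\<^sup>2)"

text \<open>Four times 8 + 34 \<open>carleson_const\<close>, as only a quarter of the weighted
  integral survives the pointwise bound: 8 bounds the mean over the circle, and 34 = 2 * 17 is the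
  error of the pointwise bound for y and Y together.\<close>

definition energy_const :: real where "energy_const = 32 + 136 * carleson_const"

lemma log_weight_bounds:
  assumes "cmod (f z) < 1"
  shows "4 \<le> log_weight f z" "log_weight f z \<le> 4 / (1 - (cmod (f z))\<^sup>2)"
proof -
  define t where "t = 1 - (cmod (f z))\<^sup>2"
  have t: "0 < t" "t \<le> 1" using assms abs_square_less_1[of "cmod (f z)"] by (auto simp: t_def)
  then show "4 \<le> log_weight f z" by (simp add: log_weight_def t_def)
  have "ln (1 / t) \<le> 1 / t - 1" using t by (intro ln_le_minus_one) auto
  then have "4 - ln t \<le> 4 + (1 / t - 1)" using t by (simp add: ln_div)
  also have "\<dots> \<le> 4 / t" using t by (simp add: field_simps)
  finally show "log_weight f z \<le> 4 / (1 - (cmod (f z))\<^sup>2)" by (simp add: log_weight_def t_def)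
qed

lemma continuous_on_log_weight:
  assumes "continuous_on S f" "\<And>z. z \<in> S \<Longrightarrow> cmod (f z) < 1"
  shows "continuous_on S (log_weight f)"
proof -
  have "1 - (cmod (f z))\<^sup>2 \<noteq> 0" if "z \<in> S" for z
    using assms(2)[OF that] abs_square_less_1[of "cmod (f z)"] by simp
  then show ?thesis unfolding log_weight_def by (intro continuous_intros assms(1)) auto
qed

text \<open>On the circle $S$ is $O(1-|f|^2)$, which compensates the logarithm in the boundary term of Green's formula.\<close>
lemma weighted_energy_le:
  assumes f: "f holomorphic_on ball 0 R" and x: "x holomorphic_on ball 0 R"
    and a: "a holomorphic_on ball 0 R" and Y: "Y holomorphic_on ball 0 R" and R: "1 < R"
    and f1: "\<And>z. z \<in> cball 0 1 \<Longrightarrow> cmod (f z) < 1"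
    and Y0: "Y 0 = 0"
    and YT: "\<And>z. cmod z = 1 \<Longrightarrow> Y z = f z * cnj (x z) - cnj (a z)"
    and y_def: "y = (\<lambda>z. x z - f z * a z)"
    and n: "hardy_norm2 x \<le> n" "hardy_norm2 y \<le> n" "hardy_norm2 Y \<le> n"
  shows "log_weight f 0 * (cmod (y 0))\<^sup>2 + Re (disc_mean (\<lambda>z. of_real (log_weight f z * (cmod (deriv y z))\<^sup>2)))
    \<le> energy_const * n"
proof -
  have y: "y holomorphic_on ball 0 R" unfolding y_def by (intro holomorphic_intros x f a)
  have yY: "(\<lambda>z. y z * Y z) holomorphic_on ball 0 R" by (intro holomorphic_intros y Y)
  note c = holomorphic_continuous_on_cball[OF f R] holomorphic_continuous_on_cball[OF x R] holomorphic_continuous_on_cball[OF a R] holomorphic_continuous_on_cball[OF y R] holomorphic_continuous_on_cball[OF Y R]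
  have lw: "continuous_on (cball 0 1) (log_weight f)"
    by (rule continuous_on_log_weight[OF c(1) f1])
  have t0: "0 < 1 - (cmod (f z))\<^sup>2" if "z \<in> cball 0 1" for z
    using f1[OF that] abs_square_less_1[of "cmod (f z)"] by simp
  have dyY: "deriv (\<lambda>z. y z * Y z) z = deriv y z * Y z + y z * deriv Y z" if "z \<in> cball 0 1" for z
    using that R deriv_mult[OF holomorphic_on_imp_differentiable_at[OF y, of z] holomorphic_on_imp_differentiable_at[OF Y, of z]]
    by (simp add: add.commute)
  let ?V = "\<lambda>u v z. of_real (log_weight f z) * (deriv u z * cnj (deriv v z))
      + of_real (1 / (1 - (cmod (f z))\<^sup>2)) * (deriv f z * u z * cnj (f z * deriv v z) + f z * deriv u z * cnj (deriv f z * v z))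
      + of_real (1 / (1 - (cmod (f z))\<^sup>2)\<^sup>2) * (deriv f z * u z * cnj (deriv f z * v z))"
  let ?W = "\<lambda>u v z. of_real (log_weight f z) * (u z * cnj (v z))"
  have gp: "green_pair (?W u v) (?V u v)" if "u holomorphic_on ball 0 R" "v holomorphic_on ball 0 R" for u v
    using green_pair_log_weight[OF f that R f1] unfolding log_weight_def .
  \<comment> \<open>The weighted S as a combination of four products of a holomorphic and an
    antiholomorphic function: in the cross terms the product y Y counts as one holomorphic function,
    paired with f.\<close>
  define W where "W z = ?W y y z + ?W Y Y z - ?W (\<lambda>z. y z * Y z) f z - ?W f (\<lambda>z. y z * Y z) z" for z
  define V where "V z = ?V y y z + ?V Y Y z - ?V (\<lambda>z. y z * Y z) f z - ?V f (\<lambda>z. y z * Y z) z" for z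
  have WV: "green_pair W V"
    unfolding W_def[abs_def] V_def[abs_def]
    by (intro green_pair_diff green_pair_add gp y Y yY f)
  define E where "E u z = complex_of_real ((cmod (deriv f z) * cmod (u z))\<^sup>2 / (1 - (cmod (f z))\<^sup>2))"
    for u :: "complex \<Rightarrow> complex" and z
  define H where "H u z = complex_of_real (log_weight f z * (cmod (deriv u z))\<^sup>2)"
    for u :: "complex \<Rightarrow> complex" and z
  have cE: "continuous_on (cball 0 1) (E y)" "continuous_on (cball 0 1) (E Y)"
    unfolding E_def using t0 by (intro continuous_on_of_real continuous_on_divide continuous_intros c; force)+
  have cH: "continuous_on (cball 0 1) (H y)" "continuous_on (cball 0 1) (H Y)"
    unfolding H_def by (intro continuous_intros c lw)+
  have "Re (disc_mean (\<lambda>z. 1 / 4 * H y z - 17 * (E y z + E Y z))) \<le> Re (disc_mean V)"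
  proof (rule Re_disc_mean_mono)
    fix z :: complex assume z: "z \<in> cball 0 1"
    have "Re (1 / 4 * H y z - 17 * (E y z + E Y z)) = log_weight f z / 4 * (cmod (deriv y z))\<^sup>2
      - 17 * ((cmod (deriv f z) * cmod (y z))\<^sup>2 / (1 - (cmod (f z))\<^sup>2) + (cmod (deriv f z) * cmod (Y z))\<^sup>2 / (1 - (cmod (f z))\<^sup>2))"
      by (simp add: H_def E_def)
    also have "\<dots> \<le> log_weight f z / 4 * ((cmod (deriv y z))\<^sup>2 + (cmod (deriv Y z))\<^sup>2)
      - 17 * ((cmod (deriv f z) * cmod (y z))\<^sup>2 / (1 - (cmod (f z))\<^sup>2) + (cmod (deriv f z) * cmod (Y z))\<^sup>2 / (1 - (cmod (f z))\<^sup>2))"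
      using log_weight_bounds(1)[of f, OF f1[OF z]] by (intro diff_mono mult_left_mono) auto
    also have "\<dots> \<le> Re (V z)"
      unfolding V_def dyY[OF z]
      by (rule pointwise_lower_bound[OF t0[OF z] log_weight_bounds[of f, OF f1[OF z]]])
    finally show "Re (1 / 4 * H y z - 17 * (E y z + E Y z)) \<le> Re (V z)" .
  qed (use WV cE cH in \<open>auto simp: green_pair_def intro!: continuous_intros\<close>)
  moreover have "disc_mean (\<lambda>z. 1 / 4 * H y z - 17 * (E y z + E Y z)) =
    1 / 4 * disc_mean (H y) - 17 * (disc_mean (E y) + disc_mean (E Y))"
  proof -
    have "disc_mean (\<lambda>z. 1 / 4 * H y z - 17 * (E y z + E Y z)) =
      disc_mean (\<lambda>z. 1 / 4 * H y z) - disc_mean (\<lambda>z. 17 * (E y z + E Y z))"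
      using cE cH by (intro disc.avg_diff continuous_intros)
    then show ?thesis unfolding disc.avg_cmult disc.avg_add[OF cE] .
  qed
  ultimately have LV: "1 / 4 * Re (disc_mean (H y)) - 17 * (Re (disc_mean (E y)) + Re (disc_mean (E Y))) \<le> Re (disc_mean V)"
    by simp
  have LE: "Re (disc_mean (E y)) \<le> carleson_const * n" "Re (disc_mean (E Y)) \<le> carleson_const * n"
    using carleson_embedding[OF f y R f1] carleson_embedding[OF f Y R f1] n(2,3) carleson_const_nonneg
    unfolding E_def by (meson mult_left_mono order.trans)+
  have "Re (circ_mean W) \<le> Re (circ_mean (\<lambda>z. 4 * (x z * cnj (x z)) + 4 * (Y z * cnj (Y z))))"
  proof (rule Re_circ_mean_mono)
    fix z :: complex assume z: "cmod z = 1"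
    define t where "t = 1 - (cmod (f z))\<^sup>2"
    have z': "z \<in> cball 0 1" using z by simp
    have t: "0 < t" "t \<le> 1" using t0[OF z'] by (auto simp: t_def)
    have tc: "complex_of_real t = 1 - f z * cnj (f z)" by (simp add: t_def mult_cnj_self)
    have yz: "y z = of_real t * x z + f z * cnj (Y z)"
      unfolding YT[OF z] y_def tc by (simp add: algebra_simps)
    \<comment> \<open>On the circle S is exactly t (t |x|^2 + |Y|^2) with t = 1 - |f|^2; the leading
      factor t is what meets the bound 4 / t of the weight.\<close>
    have ring: "(T * u + g * w') * (T * u' + g' * w) + w * w' - (T * u + g * w') * w * g' - g * ((T * u' + g' * w) * w')
      = T * T * (u * u') + T * (w * w')" if "T = 1 - g * g'" for T u u' g g' w w' :: complex
      unfolding that by (simp add: algebra_simps)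
    have "y z * cnj (y z) + Y z * cnj (Y z) - y z * Y z * cnj (f z) - f z * cnj (y z * Y z)
      = of_real t * of_real t * (x z * cnj (x z)) + of_real t * (Y z * cnj (Y z))"
      unfolding yz using ring[OF tc, of "x z" "cnj (Y z)" "cnj (x z)" "Y z"] by simp
    moreover have "W z = of_real (log_weight f z) * (y z * cnj (y z) + Y z * cnj (Y z) - y z * Y z * cnj (f z) - f z * cnj (y z * Y z))"
      unfolding W_def by (simp only: right_diff_distrib distrib_left)
    ultimately have "W z = of_real (log_weight f z * t) * (of_real t * (x z * cnj (x z)) + Y z * cnj (Y z))"
      by (simp add: distrib_left mult.assoc)
    then have "W z = of_real ((log_weight f z * t) * (t * (cmod (x z))\<^sup>2 + (cmod (Y z))\<^sup>2))"
      by (simp add: mult_cnj_self)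
    then have "Re (W z) = (log_weight f z * t) * (t * (cmod (x z))\<^sup>2 + (cmod (Y z))\<^sup>2)" by simp
    also have "\<dots> \<le> 4 * (1 * (cmod (x z))\<^sup>2 + (cmod (Y z))\<^sup>2)"
    proof (rule mult_mono)
      show "log_weight f z * t \<le> 4"
        using log_weight_bounds(2)[of f, OF f1[OF z']] t(1) unfolding t_def[symmetric] by (simp add: field_simps)
      show "t * (cmod (x z))\<^sup>2 + (cmod (Y z))\<^sup>2 \<le> 1 * (cmod (x z))\<^sup>2 + (cmod (Y z))\<^sup>2"
        using t(2) by (intro add_right_mono mult_right_mono) auto
    qed (use t in auto)
    finally show "Re (W z) \<le> Re (4 * (x z * cnj (x z)) + 4 * (Y z * cnj (Y z)))"
      by (simp add: mult_cnj_self)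
  qed (use WV in \<open>auto simp: green_pair_def intro!: continuous_intros c\<close>)
  also have "\<dots> = 4 * hardy_norm2 x + 4 * hardy_norm2 Y"
    by (subst circ.avg_add) (auto intro!: continuous_intros c simp: circ.avg_cmult hardy_norm2_def)
  finally have MW: "Re (circ_mean W) \<le> 8 * n" using n by simp
  have W0: "Re (W 0) = log_weight f 0 * (cmod (y 0))\<^sup>2"
    by (simp add: W_def Y0 mult_cnj_self)
  have 4: "4 \<le> log_weight f 0" using log_weight_bounds(1)[of f 0] f1[of 0] by simp
  have "Re (circ_mean W) = Re (W 0) + Re (disc_mean V)" using WV by (simp add: green_pair_def)
  then have "log_weight f 0 * (cmod (y 0))\<^sup>2 + 1 / 4 * Re (disc_mean (H y)) \<le> 8 * n + 34 * (carleson_const * n)"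
    using MW LV LE W0 by simp
  moreover have "0 \<le> log_weight f 0 * (cmod (y 0))\<^sup>2" using 4 by simp
  ultimately show ?thesis unfolding H_def[symmetric] energy_const_def by (simp add: algebra_simps)
qed

section \<open>Defect vectors of kernel sums\<close>

definition kernel_sum :: "'i set \<Rightarrow> ('i \<Rightarrow> complex) \<Rightarrow> ('i \<Rightarrow> complex) \<Rightarrow> complex \<Rightarrow> complex" where
  "kernel_sum I z c w = (\<Sum>i\<in>I. c i / (1 - cnj (z i) * w))"

text \<open>The Gram form of Szego kernels, that is, the squared norm of
  \<open>kernel_sum I z c\<close>; see \<open>hardy_norm2_kernel_sum\<close>.\<close>

definition pick_form :: "'i set \<Rightarrow> ('i \<Rightarrow> complex) \<Rightarrow> ('i \<Rightarrow> complex) \<Rightarrow> complex" where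
  "pick_form I z c = (\<Sum>j\<in>I. \<Sum>i\<in>I. cnj (c j) * c i / (1 - cnj (z i) * z j))"

lemma kernel_sum_holomorphic:
  assumes "1 < R" "\<And>i. i \<in> I \<Longrightarrow> cmod (z i) * R < 1"
  shows "kernel_sum I z c holomorphic_on ball 0 R"
  unfolding kernel_sum_def[abs_def]
proof (intro holomorphic_intros)
  fix i and w :: complex assume i: "i \<in> I" and w: "w \<in> ball 0 R"
  have "cmod (cnj (z i) * w) \<le> cmod (z i) * R" using w by (auto simp: norm_mult intro!: mult_left_mono)
  also have "\<dots> < 1" by (rule assms(2)[OF i])
  finally show "1 - cnj (z i) * w \<noteq> 0" by auto
qed

lemma circ_mean_kernel_sum:
  assumes u: "u holomorphic_on ball 0 R" and R: "1 < R" and I: "finite I" and z: "\<And>i. i \<in> I \<Longrightarrow> cmod (z i) * R < 1"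
  shows "circ_mean (\<lambda>w. u w * cnj (kernel_sum I z c w)) = (\<Sum>i\<in>I. cnj (c i) * u (z i))"
proof -
  have "continuous_on (cball 0 1) (\<lambda>w. cnj (c i) * (u w * cnj (1 / (1 - cnj (z i) * w))))" if "i \<in> I" for i
  proof -
    have "kernel_sum {i} z (\<lambda>_. 1) holomorphic_on ball 0 R"
      using that z R by (intro kernel_sum_holomorphic) auto
    then have "continuous_on (cball 0 1) (\<lambda>w. 1 / (1 - cnj (z i) * w))"
      using holomorphic_continuous_on_cball(1)[of _ R] R by (simp add: kernel_sum_def[abs_def])
    then show ?thesis using holomorphic_continuous_on_cball(1)[OF u R]
      by (intro continuous_on_mult continuous_on_const continuous_on_cnj)
  qed
  moreover have "(\<lambda>w. u w * cnj (kernel_sum I z c w)) =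
    (\<lambda>w. \<Sum>i\<in>I. cnj (c i) * (u w * cnj (1 / (1 - cnj (z i) * w))))"
    by (simp add: kernel_sum_def sum_distrib_left mult_ac fun_eq_iff)
  moreover have "cmod (z i) < 1" if "i \<in> I" for i
  proof -
    have "cmod (z i) * 1 \<le> cmod (z i) * R" using R by (intro mult_left_mono) auto
    then show ?thesis using z[OF that] by simp
  qed
  ultimately show ?thesis
    using I circ_reproducing[OF u R] by (simp only: circ.avg_sum circ.avg_cmult) simp
qed

lemma hardy_norm2_kernel_sum:
  assumes R: "1 < R" and I: "finite I" and z: "\<And>i. i \<in> I \<Longrightarrow> cmod (z i) * R < 1"
  shows "circ_mean (\<lambda>w. kernel_sum I z c w * cnj (kernel_sum I z c w)) = pick_form I z c"
    "hardy_norm2 (kernel_sum I z c) = Re (pick_form I z c)"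
proof -
  show "circ_mean (\<lambda>w. kernel_sum I z c w * cnj (kernel_sum I z c w)) = pick_form I z c"
    using circ_mean_kernel_sum[OF kernel_sum_holomorphic[OF R z] R I z]
    by (simp add: pick_form_def kernel_sum_def sum_distrib_left)
  then show "hardy_norm2 (kernel_sum I z c) = Re (pick_form I z c)"
    by (simp add: hardy_norm2_def)
qed

lemma holomorphic_difference_quotient:
  assumes "f holomorphic_on S" "open S" "a \<in> S"
  obtains q where "q holomorphic_on S" "\<And>w. f w - f a = (w - a) * q w"
proof
  have "(\<lambda>w. if w = a then deriv f a else (f w - f a) / (w - a)) holomorphic_on S"
    by (rule pole_lemma_open[OF assms(1,2)])
  then show "(\<lambda>w. if w = a then deriv f a else (f w - f a) / (w - a)) holomorphic_on S" .
qed auto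

text \<open>Here \<open>a\<close> is T_f^* x, computed kernel by kernel, and \<open>y\<close> is the
  defect vector x - f T_f^* x. The pairing of f a with x equals the squared norm of a, which gives
  the pairing of y with x; the norm bound for y then follows from |f| \<le> 1 on the circle.\<close>

lemma hardy_defect:
  fixes f :: "complex \<Rightarrow> complex" and c z :: "'i \<Rightarrow> complex"
  assumes f: "f holomorphic_on ball 0 R" and R: "1 < R"
    and f1: "\<And>w. w \<in> cball 0 1 \<Longrightarrow> cmod (f w) < 1"
    and I: "finite I" and z: "\<And>i. i \<in> I \<Longrightarrow> cmod (z i) * R < 1"
  defines "x \<equiv> kernel_sum I z c"
  defines "a \<equiv> kernel_sum I z (\<lambda>i. c i * cnj (f (z i)))"
  defines "y \<equiv> \<lambda>w. x w - f w * a w"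
  shows "y holomorphic_on ball 0 R"
    and "hardy_norm2 y \<le> hardy_norm2 x"
    and "Re (circ_mean (\<lambda>w. y w * cnj (x w))) = hardy_norm2 x - hardy_norm2 a"
    and "log_weight f 0 * (cmod (y 0))\<^sup>2 + Re (disc_mean (\<lambda>w. of_real (log_weight f w * (cmod (deriv y w))\<^sup>2)))
      \<le> energy_const * hardy_norm2 x"
proof -
  have x: "x holomorphic_on ball 0 R" and a: "a holomorphic_on ball 0 R"
    unfolding x_def a_def by (intro kernel_sum_holomorphic R z; assumption)+
  then show y: "y holomorphic_on ball 0 R" unfolding y_def by (intro holomorphic_intros f)
  have zR: "z i \<in> ball 0 R" "cmod (z i) < 1" if "i \<in> I" for i
  proof -
    have "cmod (z i) * 1 \<le> cmod (z i) * R" using R by (intro mult_left_mono) auto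
    then show "cmod (z i) < 1" using z[OF that] by simp
    then show "z i \<in> ball 0 R" using R by simp
  qed
  have "\<exists>q. q holomorphic_on ball 0 R \<and> (\<forall>w. f w - f (z i) = (w - z i) * q w)" if "i \<in> I" for i
    by (rule holomorphic_difference_quotient[OF f open_ball zR(1)[OF that]]) blast
  then obtain q where q: "\<And>i. i \<in> I \<Longrightarrow> q i holomorphic_on ball 0 R"
    "\<And>i w. i \<in> I \<Longrightarrow> f w - f (z i) = (w - z i) * q i w"
    by metis
  \<comment> \<open>On the circle the conjugate of \<open>Y\<close> is cnj f * x - a, the part of
    cnj f * x that the projection onto H^2 removes. For a kernel sum it is given explicitly by
    difference quotients of f, and the factor w yields \<open>Y 0 = 0\<close>.\<close>
  define Y where "Y w = (\<Sum>i\<in>I. cnj (c i) * (w * q i w))" for w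
  have Y: "Y holomorphic_on ball 0 R" unfolding Y_def[abs_def] by (intro holomorphic_intros q)
  have YT: "Y w = f w * cnj (x w) - cnj (a w)" if w: "cmod w = 1" for w
  proof -
    have "cnj (c i) * (w * q i w) = f w * cnj (c i / (1 - cnj (z i) * w)) - cnj (c i * cnj (f (z i)) / (1 - cnj (z i) * w))"
      if i: "i \<in> I" for i
    proof -
      have ne: "w - z i \<noteq> 0" "w \<noteq> 0" using zR(2)[OF i] w by auto
      have "w * cnj w = 1" using w by (simp add: mult_cnj_self)
      then have "w * (1 - z i * cnj w) = w - z i" by (simp add: algebra_simps)
      then have "1 / (1 - z i * cnj w) = w / (w - z i)" using ne
        by (metis divide_divide_eq_right mult.commute mult_1 nonzero_mult_div_cancel_left times_divide_eq_right)
      then have "f w * cnj (c i / (1 - cnj (z i) * w)) - cnj (c i * cnj (f (z i)) / (1 - cnj (z i) * w))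
        = cnj (c i) * (w / (w - z i)) * (f w - f (z i))"
        by (simp add: divide_inverse algebra_simps)
      also have "\<dots> = cnj (c i) * (w * q i w)" unfolding q(2)[OF i] using ne by simp
      finally show ?thesis by simp
    qed
    then show ?thesis
      unfolding Y_def x_def a_def kernel_sum_def cnj_sum sum_distrib_left by (simp add: sum_subtractf)
  qed
  have fa: "(\<lambda>w. f w * a w) holomorphic_on ball 0 R" by (intro holomorphic_intros f a)
  note ct = holomorphic_continuous_on_cball[OF f R] holomorphic_continuous_on_cball[OF x R] holomorphic_continuous_on_cball[OF a R] holomorphic_continuous_on_cball[OF y R] holomorphic_continuous_on_cball[OF Y R]
  \<comment> \<open>The adjoint relation: pairing f a with x is the same as pairing a with T_f^* x =
    a. Both sides are evaluated by the reproducing property.\<close>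
  have fax: "circ_mean (\<lambda>w. f w * a w * cnj (x w)) = circ_mean (\<lambda>w. a w * cnj (a w))"
  proof -
    have "circ_mean (\<lambda>w. f w * a w * cnj (x w)) = (\<Sum>i\<in>I. cnj (c i) * (f (z i) * a (z i)))"
      unfolding x_def by (rule circ_mean_kernel_sum[OF fa R I z])
    moreover have "circ_mean (\<lambda>w. a w * cnj (a w)) = (\<Sum>i\<in>I. cnj (c i * cnj (f (z i))) * a (z i))"
      unfolding a_def by (rule circ_mean_kernel_sum[OF a[unfolded a_def] R I z])
    ultimately show ?thesis by (simp add: mult_ac)
  qed
  have mono: "Re (circ_mean (\<lambda>w. (f w * u w) * cnj (f w * u w))) \<le> hardy_norm2 u"
    if "u holomorphic_on ball 0 R" for u
    unfolding hardy_norm2_def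
  proof (rule Re_circ_mean_mono)
    fix w :: complex assume "cmod w = 1"
    then have "cmod (f w) \<le> 1" using f1[of w] by simp
    then have "(cmod (f w * u w))\<^sup>2 \<le> (cmod (u w))\<^sup>2"
      unfolding norm_mult by (intro power_mono mult_left_le_one_le) auto
    then show "Re (f w * u w * cnj (f w * u w)) \<le> Re (u w * cnj (u w))" by (simp only: mult_cnj_self Re_complex_of_real)
  qed (intro continuous_intros ct holomorphic_continuous_on_cball(1)[OF that R])+
  have n0: "0 \<le> hardy_norm2 a" by (rule hardy_norm2_nonneg[OF a R])
  have expand: "circ_mean (\<lambda>w. A w - B w - C w + D w) = circ_mean A - circ_mean B - circ_mean C + circ_mean D"
    if "continuous_on (cball 0 1) A" "continuous_on (cball 0 1) B" "continuous_on (cball 0 1) C" "continuous_on (cball 0 1) D"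
    for A B C D
    using that by (simp add: circ.avg_add circ.avg_diff continuous_on_diff)
  let ?P = "\<lambda>w. f w * a w * cnj (x w)"
  have Pc: "continuous_on (cball 0 1) ?P" "continuous_on (cball 0 1) (\<lambda>w. cnj (?P w))" by (intro continuous_intros ct)+
  have RP: "Re (circ_mean ?P) = hardy_norm2 a" "Re (circ_mean (\<lambda>w. cnj (?P w))) = hardy_norm2 a"
    unfolding circ.avg_cnj fax hardy_norm2_def by simp_all
  have "(\<lambda>w. y w * cnj (y w)) = (\<lambda>w. x w * cnj (x w) - ?P w - cnj (?P w) + (f w * a w) * cnj (f w * a w))"
    by (simp add: y_def fun_eq_iff algebra_simps)
  then have "hardy_norm2 y = hardy_norm2 x - hardy_norm2 a - hardy_norm2 a + Re (circ_mean (\<lambda>w. (f w * a w) * cnj (f w * a w)))"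
    unfolding hardy_norm2_def[of y] using RP
    by (simp only: expand continuous_intros ct Pc) (simp add: hardy_norm2_def)
  then show ny: "hardy_norm2 y \<le> hardy_norm2 x" using mono[OF a] n0 by simp
  have "circ_mean (\<lambda>w. Y w * cnj (Y w)) =
    circ_mean (\<lambda>w. (f w * x w) * cnj (f w * x w) - ?P w - cnj (?P w) + a w * cnj (a w))"
  proof (rule circ_mean_cong)
    fix w :: complex assume "cmod w = 1"
    show "Y w * cnj (Y w) = (f w * x w) * cnj (f w * x w) - ?P w - cnj (?P w) + a w * cnj (a w)"
      unfolding YT[OF \<open>cmod w = 1\<close>] by (simp add: algebra_simps)
  qed
  then have "hardy_norm2 Y = Re (circ_mean (\<lambda>w. (f w * x w) * cnj (f w * x w))) - hardy_norm2 a - hardy_norm2 a + hardy_norm2 a"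
    unfolding hardy_norm2_def[of Y] using RP
    by (simp only: expand continuous_intros ct Pc) (simp add: hardy_norm2_def)
  then have nY: "hardy_norm2 Y \<le> hardy_norm2 x" using mono[OF x] n0 by simp
  have "(\<lambda>w. y w * cnj (x w)) = (\<lambda>w. x w * cnj (x w) - ?P w)"
    by (simp add: y_def fun_eq_iff algebra_simps)
  then show "Re (circ_mean (\<lambda>w. y w * cnj (x w))) = hardy_norm2 x - hardy_norm2 a"
    using RP by (simp add: circ.avg_diff Pc continuous_intros ct hardy_norm2_def)
  show "log_weight f 0 * (cmod (y 0))\<^sup>2 + Re (disc_mean (\<lambda>w. of_real (log_weight f w * (cmod (deriv y w))\<^sup>2)))
      \<le> energy_const * hardy_norm2 x"
    by (rule weighted_energy_le[OF f x a Y R f1 _ YT y_def[THEN meta_eq_to_obj_eq] order.refl ny nY]) (simp_all add: Y_def)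
qed

text \<open>The inequality 2 (sqrt \<Lambda> p) q \<le> \<Lambda> p^2 + q^2 serves when the weight
  of p is large, its mirror image when the weight of q is. Adding both right-hand sides gives one
  integrand valid at every point, whichever weight is large there.\<close>

lemma mult_le_half_sum_weighted:
  fixes p q \<alpha> \<beta> \<Lambda> :: real
  assumes "0 \<le> p" "0 \<le> q" "0 < \<Lambda>" "\<Lambda> \<le> \<alpha> \<or> \<Lambda> \<le> \<beta>" "0 \<le> \<alpha>" "0 \<le> \<beta>"
  shows "p * q \<le> (\<alpha> * p\<^sup>2 + q\<^sup>2 + (\<beta> * q\<^sup>2 + p\<^sup>2)) / (2 * sqrt \<Lambda>)"
proof -
  have *: "p * q \<le> (\<alpha> * p\<^sup>2 + q\<^sup>2) / (2 * sqrt \<Lambda>)" if "0 \<le> p" "0 \<le> q" "\<Lambda> \<le> \<alpha>" for p q \<alpha> :: real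
  proof -
    have "2 * (sqrt \<Lambda> * p) * q \<le> (sqrt \<Lambda> * p)\<^sup>2 + q\<^sup>2" by (rule sum_squares_bound)
    also have "(sqrt \<Lambda> * p)\<^sup>2 = \<Lambda> * p\<^sup>2" using assms(3) by (simp add: power_mult_distrib)
    also have "\<Lambda> * p\<^sup>2 \<le> \<alpha> * p\<^sup>2" using that by (intro mult_right_mono) auto
    finally show ?thesis using assms(3) by (simp add: field_simps)
  qed
  from assms(4) show ?thesis
  proof
    assume "\<Lambda> \<le> \<alpha>"
    from *[OF assms(1,2) this] have "p * q \<le> (\<alpha> * p\<^sup>2 + q\<^sup>2) / (2 * sqrt \<Lambda>)" .
    also have "\<dots> \<le> (\<alpha> * p\<^sup>2 + q\<^sup>2 + (\<beta> * q\<^sup>2 + p\<^sup>2)) / (2 * sqrt \<Lambda>)"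
      using assms by (intro divide_right_mono) auto
    finally show ?thesis .
  next
    assume "\<Lambda> \<le> \<beta>"
    from *[OF assms(2,1) this] have "p * q \<le> (\<beta> * q\<^sup>2 + p\<^sup>2) / (2 * sqrt \<Lambda>)" by (simp add: mult.commute)
    also have "\<dots> \<le> (\<alpha> * p\<^sup>2 + q\<^sup>2 + (\<beta> * q\<^sup>2 + p\<^sup>2)) / (2 * sqrt \<Lambda>)"
      using assms by (intro divide_right_mono) auto
    finally show ?thesis .
  qed
qed

text \<open>The pairing of y with x equals |x|^2 - |a|^2 in norms, and x = u + g b splits it. The
  pairing with u is small by Green's formula and the two weighted energies; the pairing with g b is
  split by Cauchy's inequality with a free parameter \<tau>, whose reciprocal only multiplies
  |b|^2.\<close>

lemma pick_form_lower_bound_smooth: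
  fixes f g :: "complex \<Rightarrow> complex" and c z :: "'i \<Rightarrow> complex"
  assumes f: "f holomorphic_on ball 0 R" and g: "g holomorphic_on ball 0 R" and R: "1 < R"
    and f1: "\<And>w. w \<in> cball 0 1 \<Longrightarrow> cmod (f w) < 1" and g1: "\<And>w. w \<in> cball 0 1 \<Longrightarrow> cmod (g w) < 1"
    and I: "finite I" and z: "\<And>i. i \<in> I \<Longrightarrow> cmod (z i) * R < 1"
    and \<Lambda>: "0 < \<Lambda>" "\<And>w. w \<in> cball 0 1 \<Longrightarrow> \<Lambda> \<le> log_weight f w \<or> \<Lambda> \<le> log_weight g w"
    and \<tau>: "0 < \<tau>"
  shows "Re (pick_form I z c) \<le> Re (pick_form I z (\<lambda>i. c i * cnj (f (z i))))
    + ((energy_const + 1) / sqrt \<Lambda> + \<tau> / 2) * Re (pick_form I z c)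
    + 1 / (2 * \<tau>) * Re (pick_form I z (\<lambda>i. c i * cnj (g (z i))))"
proof -
  define x where "x = kernel_sum I z c"
  define a where "a = kernel_sum I z (\<lambda>i. c i * cnj (f (z i)))"
  define b where "b = kernel_sum I z (\<lambda>i. c i * cnj (g (z i)))"
  define y where "y = (\<lambda>w. x w - f w * a w)"
  define u where "u = (\<lambda>w. x w - g w * b w)"
  have D: "y holomorphic_on ball 0 R" "hardy_norm2 y \<le> hardy_norm2 x"
    "Re (circ_mean (\<lambda>w. y w * cnj (x w))) = hardy_norm2 x - hardy_norm2 a"
    "log_weight f 0 * (cmod (y 0))\<^sup>2 + Re (disc_mean (\<lambda>w. of_real (log_weight f w * (cmod (deriv y w))\<^sup>2)))
      \<le> energy_const * hardy_norm2 x"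
    unfolding y_def a_def x_def by (rule hardy_defect[OF f R f1 I z]; assumption)+
  have E: "u holomorphic_on ball 0 R" "hardy_norm2 u \<le> hardy_norm2 x"
    "log_weight g 0 * (cmod (u 0))\<^sup>2 + Re (disc_mean (\<lambda>w. of_real (log_weight g w * (cmod (deriv u w))\<^sup>2)))
      \<le> energy_const * hardy_norm2 x"
    unfolding u_def b_def x_def by (rule hardy_defect[OF g R g1 I z]; assumption)+
  have x: "x holomorphic_on ball 0 R" and b: "b holomorphic_on ball 0 R"
    unfolding x_def b_def by (intro kernel_sum_holomorphic R z; assumption)+
  note y = D(1) and u = E(1)
  have "continuous_on (cball 0 1) (log_weight f)" "continuous_on (cball 0 1) (log_weight g)"
    using continuous_on_log_weight[OF holomorphic_continuous_on_cball(1)[OF f R]] continuous_on_log_weight[OF holomorphic_continuous_on_cball(1)[OF g R]] f1 g1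
    by auto
  note ct = this holomorphic_continuous_on_cball[OF x R] holomorphic_continuous_on_cball[OF b R] holomorphic_continuous_on_cball[OF y R] holomorphic_continuous_on_cball[OF u R] holomorphic_continuous_on_cball[OF f R] holomorphic_continuous_on_cball[OF g R]
  define n where "n = hardy_norm2 x"
  have lw: "4 \<le> log_weight f w" "4 \<le> log_weight g w" if "w \<in> cball 0 1" for w
    using log_weight_bounds(1)[of f, OF f1[OF that]] log_weight_bounds(1)[of g, OF g1[OF that]] by auto
  have gp: "green_pair (\<lambda>w. y w * cnj (u w)) (\<lambda>w. deriv y w * cnj (deriv u w))"
    by (rule green_pair_holomorphic[OF y u R])
  define H where "H \<phi> v w = complex_of_real (log_weight \<phi> w * (cmod (deriv v w))\<^sup>2)" for \<phi> v w
  define N where "N v w = complex_of_real ((cmod (deriv v w))\<^sup>2)" for v w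
  define k where "k = complex_of_real (1 / (2 * sqrt \<Lambda>))"
  have Hc: "continuous_on (cball 0 1) (H f y)" "continuous_on (cball 0 1) (H g u)"
    "continuous_on (cball 0 1) (N y)" "continuous_on (cball 0 1) (N u)"
    unfolding H_def N_def
    by (intro continuous_on_of_real continuous_on_mult continuous_on_power continuous_on_norm ct)+
  have "cmod (disc_mean (\<lambda>w. deriv y w * cnj (deriv u w)))
    \<le> Re (disc_mean (\<lambda>w. k * (H f y w + N u w + (H g u w + N y w))))"
  proof (rule norm_disc_mean_le)
    fix w :: complex assume w: "w \<in> cball 0 1"
    show "cmod (deriv y w * cnj (deriv u w)) \<le> Re (k * (H f y w + N u w + (H g u w + N y w)))"
      using mult_le_half_sum_weighted[of "cmod (deriv y w)" "cmod (deriv u w)", OF _ _ \<Lambda>(1) \<Lambda>(2)[OF w]] lw[OF w]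
      by (simp add: norm_mult k_def H_def N_def mult.commute)
  qed (intro continuous_intros ct Hc)+
  also have "\<dots> = (Re (disc_mean (H f y)) + Re (disc_mean (N u)) + (Re (disc_mean (H g u)) + Re (disc_mean (N y)))) / (2 * sqrt \<Lambda>)"
    unfolding disc.avg_cmult k_def by (simp add: disc.avg_add Hc continuous_on_add)
  finally have L: "cmod (disc_mean (\<lambda>w. deriv y w * cnj (deriv u w)))
    \<le> (Re (disc_mean (H f y)) + Re (disc_mean (N u)) + (Re (disc_mean (H g u)) + Re (disc_mean (N y)))) / (2 * sqrt \<Lambda>)" .
  \<comment> \<open>The value at 0 in Green's formula is estimated like the integrand; for this
    reason the energy bound also controls the weighted values at 0.\<close>
  have Z: "cmod (y 0) * cmod (u 0) \<le> (log_weight f 0 * (cmod (y 0))\<^sup>2 + (cmod (u 0))\<^sup>2 + (log_weight g 0 * (cmod (u 0))\<^sup>2 + (cmod (y 0))\<^sup>2)) / (2 * sqrt \<Lambda>)"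
    using lw[of 0] by (intro mult_le_half_sum_weighted \<Lambda>) auto
  have "cmod (circ_mean (\<lambda>w. y w * cnj (u w))) \<le> cmod (y 0) * cmod (u 0) + cmod (disc_mean (\<lambda>w. deriv y w * cnj (deriv u w)))"
    using gp norm_triangle_ineq[of "y 0 * cnj (u 0)" "disc_mean (\<lambda>w. deriv y w * cnj (deriv u w))"]
    by (simp add: green_pair_def norm_mult)
  also have "\<dots> \<le> ((log_weight f 0 * (cmod (y 0))\<^sup>2 + Re (disc_mean (H f y))) + (log_weight g 0 * (cmod (u 0))\<^sup>2 + Re (disc_mean (H g u)))
      + hardy_norm2 y + hardy_norm2 u) / (2 * sqrt \<Lambda>)"
    using add_mono[OF Z L] unfolding hardy_norm2_green[OF y R] hardy_norm2_green[OF u R] N_def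
    by (simp add: add_divide_distrib algebra_simps)
  also have "\<dots> \<le> (energy_const * n + energy_const * n + n + n) / (2 * sqrt \<Lambda>)"
    using D(2,4) E(2,3) \<Lambda>(1) unfolding n_def H_def by (intro divide_right_mono add_mono) auto
  also have "\<dots> = (energy_const + 1) / sqrt \<Lambda> * n"
    using \<Lambda>(1) by (simp add: field_simps)
  finally have yu: "Re (circ_mean (\<lambda>w. y w * cnj (u w))) \<le> (energy_const + 1) / sqrt \<Lambda> * n"
    using complex_Re_le_cmod order.trans by blast
  have "Re (circ_mean (\<lambda>w. y w * cnj (g w * b w))) \<le> Re (circ_mean (\<lambda>w. of_real (\<tau> / 2) * (y w * cnj (y w)) + of_real (1 / (2 * \<tau>)) * (b w * cnj (b w))))"
  proof (rule Re_circ_mean_mono)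
    fix w :: complex assume w: "cmod w = 1"
    have "cmod (g w) \<le> 1" using g1[of w] w by simp
    then have gb: "cmod (g w) * cmod (b w) \<le> cmod (b w)" by (intro mult_left_le_one_le) auto
    have "Re (y w * cnj (g w * b w)) \<le> cmod (y w * cnj (g w * b w))" by (rule complex_Re_le_cmod)
    also have "\<dots> = cmod (y w) * (cmod (g w) * cmod (b w))" by (simp add: norm_mult)
    also have "\<dots> \<le> cmod (y w) * cmod (b w)" using gb by (rule mult_left_mono) simp
    also have "\<dots> \<le> \<tau> / 2 * (cmod (y w))\<^sup>2 + 1 / (2 * \<tau>) * (cmod (b w))\<^sup>2"
      using sum_squares_bound[of "\<tau> * cmod (y w)" "cmod (b w)"] \<tau> by (simp add: field_simps power2_eq_square)
    finally show "Re (y w * cnj (g w * b w)) \<le> Re (of_real (\<tau> / 2) * (y w * cnj (y w)) + of_real (1 / (2 * \<tau>)) * (b w * cnj (b w)))"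
      unfolding mult_cnj_self by (simp only: Re_complex_of_real of_real_mult[symmetric] of_real_add[symmetric])
  qed (intro continuous_intros ct)+
  also have "\<dots> = \<tau> / 2 * hardy_norm2 y + 1 / (2 * \<tau>) * hardy_norm2 b"
  proof -
    have "circ_mean (\<lambda>w. of_real (\<tau> / 2) * (y w * cnj (y w)) + of_real (1 / (2 * \<tau>)) * (b w * cnj (b w)))
      = of_real (\<tau> / 2) * circ_mean (\<lambda>w. y w * cnj (y w)) + of_real (1 / (2 * \<tau>)) * circ_mean (\<lambda>w. b w * cnj (b w))"
      by (subst circ.avg_add) (intro continuous_intros ct | simp only: circ.avg_cmult)+
    then show ?thesis by (simp add: hardy_norm2_def)
  qed
  also have "\<dots> \<le> \<tau> / 2 * n + 1 / (2 * \<tau>) * hardy_norm2 b"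
    using D(2) \<tau> unfolding n_def by (intro add_right_mono mult_left_mono) auto
  finally have yb: "Re (circ_mean (\<lambda>w. y w * cnj (g w * b w))) \<le> \<tau> / 2 * n + 1 / (2 * \<tau>) * hardy_norm2 b" .
  have "(\<lambda>w. y w * cnj (x w)) = (\<lambda>w. y w * cnj (u w) + y w * cnj (g w * b w))"
    by (simp add: u_def fun_eq_iff algebra_simps)
  then have "circ_mean (\<lambda>w. y w * cnj (x w)) = circ_mean (\<lambda>w. y w * cnj (u w)) + circ_mean (\<lambda>w. y w * cnj (g w * b w))"
    by (simp only:) (intro circ.avg_add continuous_intros ct)
  then have "n - hardy_norm2 a \<le> (energy_const + 1) / sqrt \<Lambda> * n + (\<tau> / 2 * n + 1 / (2 * \<tau>) * hardy_norm2 b)"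
    using D(3) yu yb unfolding n_def by simp
  then have "n \<le> hardy_norm2 a + ((energy_const + 1) / sqrt \<Lambda> + \<tau> / 2) * n + 1 / (2 * \<tau>) * hardy_norm2 b"
    by (simp add: distrib_right)
  moreover have "hardy_norm2 (kernel_sum I z d) = Re (pick_form I z d)" for d
    by (rule hardy_norm2_kernel_sum(2)[OF R I]) (rule z)
  ultimately show ?thesis
    unfolding n_def x_def a_def b_def by (simp only:)
qed

section \<open>Tangential Nevanlinna--Pick interpolation\<close>

text \<open>Testing the real part suffices because the matrices J in use are Hermitian. The
  coefficients are conjugated in comparison with \<open>pick_form\<close>, to fit the kernel J(i,j)
  / (1 - z_i cnj z_j).\<close>

definition pick_psd :: "'i set \<Rightarrow> ('i \<Rightarrow> complex) \<Rightarrow> ('i \<Rightarrow> 'i \<Rightarrow> complex) \<Rightarrow> bool" where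
  "pick_psd I z J \<longleftrightarrow> (\<forall>c. 0 \<le> Re (\<Sum>i\<in>I. \<Sum>j\<in>I. c i * cnj (c j) * (J i j / (1 - z i * cnj (z j)))))"

definition gram :: "('i \<Rightarrow> complex) \<Rightarrow> ('i \<Rightarrow> complex) \<Rightarrow> ('i \<Rightarrow> complex) \<Rightarrow> 'i \<Rightarrow> 'i \<Rightarrow> complex" where
  "gram p q m i j = p i * cnj (p j) + q i * cnj (q j) - m i * cnj (m j)"

lemma cnj_gram: "cnj (gram p q m i j) = gram p q m j i"
  by (simp add: gram_def mult.commute)

lemma one_minus_mult_cnj_nonzero:
  assumes "cmod a < 1" "cmod b < 1" shows "1 - a * cnj b \<noteq> 0"
proof
  assume "1 - a * cnj b = 0"
  then have "cmod (a * cnj b) = 1" by simp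
  moreover have "cmod a * cmod b < 1" by (rule norm_mult_less[of a 1 b 1, simplified norm_mult, simplified]) (use assms in auto)
  ultimately show False by (simp add: norm_mult)
qed

text \<open>Positivity on the enlarged index set as a quadratic function of the coefficient
  \<open>t\<close> of the new point. If \<open>K n n\<close> is 0 it forces the linear term to
  vanish; otherwise its minimum is the Schur complement.\<close>

lemma pick_psd_insert:
  assumes psd: "pick_psd (insert n I) z J" and I: "finite I" "n \<notin> I"
    and herm: "\<And>i j. cnj (J i j) = J j i" and nz: "cmod (z n) < 1"
  defines "K \<equiv> \<lambda>i j. J i j / (1 - z i * cnj (z j))"
  shows "0 \<le> Re (\<Sum>i\<in>I. \<Sum>j\<in>I. c i * cnj (c j) * K i j)
    + 2 * Re (t * (\<Sum>j\<in>I. cnj (c j) * K n j)) + (cmod t)\<^sup>2 * Re (K n n)"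
proof -
  have hK: "K i n = cnj (K n i)" for i by (simp add: K_def herm mult.commute)
  define d where "d i = (if i = n then t else c i)" for i
  have dI: "d i = c i" if "i \<in> I" for i using that I by (auto simp: d_def)
  have "0 \<le> Re (\<Sum>i\<in>insert n I. \<Sum>j\<in>insert n I. d i * cnj (d j) * K i j)"
    using psd by (simp only: pick_psd_def K_def)
  also have "(\<Sum>i\<in>insert n I. \<Sum>j\<in>insert n I. d i * cnj (d j) * K i j) =
    t * cnj t * K n n + (\<Sum>j\<in>I. t * cnj (c j) * K n j) + ((\<Sum>i\<in>I. c i * cnj t * K i n) + (\<Sum>i\<in>I. \<Sum>j\<in>I. c i * cnj (c j) * K i j))"
    using I dI by (simp add: sum.distrib d_def cong: sum.cong)
  also have "(\<Sum>j\<in>I. t * cnj (c j) * K n j) = t * (\<Sum>j\<in>I. cnj (c j) * K n j)"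
    by (simp add: sum_distrib_left mult.assoc)
  also have "(\<Sum>i\<in>I. c i * cnj t * K i n) = cnj (t * (\<Sum>j\<in>I. cnj (c j) * K n j))"
    unfolding hK by (simp add: sum_distrib_left mult_ac)
  also have "t * cnj t * K n n = of_real ((cmod t)\<^sup>2) * K n n"
    by (simp only: complex_norm_square[symmetric])
  finally have "0 \<le> Re (of_real ((cmod t)\<^sup>2) * K n n + t * (\<Sum>j\<in>I. cnj (c j) * K n j)
    + (cnj (t * (\<Sum>j\<in>I. cnj (c j) * K n j)) + (\<Sum>i\<in>I. \<Sum>j\<in>I. c i * cnj (c j) * K i j)))" .
  moreover have "Re (of_real x * k + a + (cnj a + s)) = Re s + 2 * Re a + x * Re k" for x k a s
    by simp
  ultimately show ?thesis by (simp only:)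
qed

text \<open>Let b be the disc automorphism vanishing at z_n. Adding \<open>r i\<close> times row n
  multiplies the J-projection of row i onto row n by b(z_i), so the Gram entry loses (1 - b(z_i) cnj
  b(z_j)) times J(i,n) J(n,j) / J(n,n). As 1 - b(z_i) cnj b(z_j) has the factor 1 - z_i cnj z_j,
  dividing by the latter turns the loss into K(i,n) K(n,j) / K(n,n).\<close>

lemma schur_complement_gram:
  fixes p q m z :: "'i \<Rightarrow> complex"
  assumes z: "cmod (z i) < 1" "cmod (z j) < 1" "cmod (z n) < 1"
    and nz: "gram p q m n n \<noteq> 0"
  defines "r \<equiv> \<lambda>i. ((z i - z n) / (1 - cnj (z n) * z i) - 1) * gram p q m i n / gram p q m n n"
  defines "K \<equiv> \<lambda>i j. gram p q m i j / (1 - z i * cnj (z j))"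
  shows "gram (\<lambda>i. p i + r i * p n) (\<lambda>i. q i + r i * q n) (\<lambda>i. m i + r i * m n) i j / (1 - z i * cnj (z j))
    = K i j - K i n * K n j / K n n"
proof -
  let ?J = "gram p q m"
  have "gram (\<lambda>i. p i + r i * p n) (\<lambda>i. q i + r i * q n) (\<lambda>i. m i + r i * m n) i j
    = ?J i j + r i * ?J n j + cnj (r j) * ?J i n + r i * cnj (r j) * ?J n n"
    by (simp add: gram_def algebra_simps)
  moreover have key: "(A + (b - 1) * X / N * Y + (c - 1) * Y / N * X + (b - 1) * X / N * ((c - 1) * Y / N) * N) = A - (1 - b * c) * (X * Y / N)"
    if "N \<noteq> 0" for A b c X Y N :: complex
    using that by (simp add: field_simps)
  have rj: "cnj (r j) = ((cnj (z j) - cnj (z n)) / (1 - z n * cnj (z j)) - 1) * ?J n j / ?J n n"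
    by (simp add: r_def cnj_gram)
  have "?J i j + r i * ?J n j + cnj (r j) * ?J i n + r i * cnj (r j) * ?J n n
    = ?J i j - (1 - (z i - z n) / (1 - cnj (z n) * z i) * ((cnj (z j) - cnj (z n)) / (1 - z n * cnj (z j)))) * (?J i n * ?J n j / ?J n n)"
    unfolding rj unfolding r_def by (rule key[OF nz])
  moreover have "1 - (z i - z n) / (1 - cnj (z n) * z i) * ((cnj (z j) - cnj (z n)) / (1 - z n * cnj (z j)))
    = (1 - z n * cnj (z n)) * (1 - z i * cnj (z j)) / ((1 - z i * cnj (z n)) * (1 - z n * cnj (z j)))"
  proof -
    have "1 - (a - b) / A * ((c - d) / B) = (A * B - (a - b) * (c - d)) / (A * B)" if "A \<noteq> 0" "B \<noteq> 0" for a b c d A B :: complex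
      using that by (simp add: field_simps)
    moreover have "(1 - cnj (z n) * z i) * (1 - z n * cnj (z j)) - (z i - z n) * (cnj (z j) - cnj (z n)) = (1 - z n * cnj (z n)) * (1 - z i * cnj (z j))"
      by (simp add: algebra_simps)
    ultimately show ?thesis
      using one_minus_mult_cnj_nonzero[OF z(1,3)] one_minus_mult_cnj_nonzero[OF z(3,2)] by (simp add: mult.commute)
  qed
  ultimately have eq: "gram (\<lambda>i. p i + r i * p n) (\<lambda>i. q i + r i * q n) (\<lambda>i. m i + r i * m n) i j
    = ?J i j - ((1 - z n * cnj (z n)) * (1 - z i * cnj (z j)) / ((1 - z i * cnj (z n)) * (1 - z n * cnj (z j)))) * (?J i n * ?J n j / ?J n n)"
    by simp
  have "(A - (N * D / (E * F)) * (X * Y / G)) / D = A / D - X / E * (Y / F) / (G / N)"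
    if "D \<noteq> 0" "N \<noteq> 0" "E \<noteq> 0" "F \<noteq> 0" "G \<noteq> 0" for A N D E F X Y G :: complex
    using that by (simp add: field_simps)
  from this[OF one_minus_mult_cnj_nonzero[OF z(1,2)] one_minus_mult_cnj_nonzero[OF z(3,3)]
      one_minus_mult_cnj_nonzero[OF z(1,3)] one_minus_mult_cnj_nonzero[OF z(3,2)] nz]
  show ?thesis unfolding eq K_def .
qed

text \<open>The elementary factor acting on solutions: (G, H, 1) is moved along the conjugate of the
  row (p, q, m). This lowers |G|^2 + |H|^2 - 1 by (1 - |b|^2) |e|^2 / N, where e is the residue in
  the equation of that row, so division by the third component gives a contractive pair
  again.\<close>

lemma indefinite_shift:
  fixes G H e b p q m :: complex and N :: real
  assumes N: "of_real N = p * cnj p + q * cnj q - m * cnj m" and "N > 0"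
    and e: "e = p * G + q * H - m" and GH: "(cmod G)\<^sup>2 + (cmod H)\<^sup>2 \<le> 1" and b: "cmod b \<le> 1"
  defines "l \<equiv> (b - 1) * e / of_real N"
  shows "1 + l * cnj m \<noteq> 0"
    and "(cmod ((G + l * cnj p) / (1 + l * cnj m)))\<^sup>2 + (cmod ((H + l * cnj q) / (1 + l * cnj m)))\<^sup>2 \<le> 1"
proof -
  define W1 W2 W3 where W: "W1 = G + l * cnj p" "W2 = H + l * cnj q" "W3 = 1 + l * cnj m"
  have lN: "l * of_real N = (b - 1) * e" using \<open>N > 0\<close> by (simp add: l_def)
  have sq: "of_real ((cmod x)\<^sup>2) = x * cnj x" for x :: complex by (rule complex_norm_square)
  have "W1 * cnj W1 + W2 * cnj W2 - W3 * cnj W3 = G * cnj G + H * cnj H - 1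
     + l * cnj e + cnj l * e + l * cnj l * of_real N"
    unfolding W N e by (simp add: algebra_simps)
  also have "l * cnj l * of_real N = cnj l * ((b - 1) * e)" using lN by (metis mult.assoc mult.commute)
  also have "G * cnj G + H * cnj H - 1 + l * cnj e + cnj l * e + cnj l * ((b - 1) * e) =
    G * cnj G + H * cnj H - 1 + (l * cnj e + cnj l * (b * e))"
    by (simp add: algebra_simps)
  also have "l * cnj e + cnj l * (b * e) = - ((1 - b * cnj b) * (e * cnj e) / of_real N)"
    using \<open>N > 0\<close> by (simp add: l_def field_simps)
  finally have "complex_of_real ((cmod W1)\<^sup>2 + (cmod W2)\<^sup>2 - (cmod W3)\<^sup>2) =
    of_real ((cmod G)\<^sup>2 + (cmod H)\<^sup>2 - 1 + - ((1 - (cmod b)\<^sup>2) * (cmod e)\<^sup>2 / N))"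
    by (simp add: sq del: of_real_power)
  then have "(cmod W1)\<^sup>2 + (cmod W2)\<^sup>2 - (cmod W3)\<^sup>2 = (cmod G)\<^sup>2 + (cmod H)\<^sup>2 - 1 - (1 - (cmod b)\<^sup>2) * (cmod e)\<^sup>2 / N"
    by (simp only: of_real_eq_iff)
  moreover have "0 \<le> (1 - (cmod b)\<^sup>2) * (cmod e)\<^sup>2 / N"
    using b \<open>N > 0\<close> by (intro divide_nonneg_pos mult_nonneg_nonneg) (auto simp: abs_square_le_1)
  ultimately have le: "(cmod W1)\<^sup>2 + (cmod W2)\<^sup>2 \<le> (cmod W3)\<^sup>2" using GH by linarith
  \<comment> \<open>If the third component vanished, all three would, and (G, H, 1) would be - l
    times the conjugated row. Its form would then be |l|^2 N and at most 0, forcing l = 0, which is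
    absurd.\<close>
  show nz: "1 + l * cnj m \<noteq> 0"
  proof
    assume 0: "1 + l * cnj m = 0"
    then have "W1 = 0" "W2 = 0" using le by (auto simp: W sum_power2_le_zero_iff)
    then have "G = - (l * cnj p)" "H = - (l * cnj q)" by (simp_all add: W eq_neg_iff_add_eq_0)
    then have "G * cnj G + H * cnj H - (l * cnj m) * cnj (l * cnj m) = l * cnj l * of_real N"
      unfolding N by (simp add: algebra_simps)
    moreover have m1: "l * cnj m = - 1" using 0 by (simp add: eq_neg_iff_add_eq_0 add.commute)
    ultimately have "complex_of_real ((cmod G)\<^sup>2 + (cmod H)\<^sup>2 - 1) = of_real ((cmod l)\<^sup>2 * N)"
      unfolding m1 by (simp add: sq del: of_real_power)
    then have "(cmod G)\<^sup>2 + (cmod H)\<^sup>2 - 1 = (cmod l)\<^sup>2 * N" by (simp only: of_real_eq_iff)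
    then have "(cmod l)\<^sup>2 * N \<le> 0" using GH by simp
    then have "l = 0" using \<open>N > 0\<close> by (simp add: mult_le_0_iff)
    then show False using m1 by simp
  qed
  then have "(cmod W3)\<^sup>2 > 0" by (simp add: W)
  then show "(cmod ((G + l * cnj p) / (1 + l * cnj m)))\<^sup>2 + (cmod ((H + l * cnj q) / (1 + l * cnj m)))\<^sup>2 \<le> 1"
    using le unfolding W(1,2,3)[symmetric]
    by (simp add: norm_divide power_divide add_divide_distrib[symmetric])
qed

text \<open>
Schur's algorithm: the rows $(p_i,q_i,m_i)$ are multiplied by a $J$-inner elementary factor that annihilates the row $n$,
where $J = \mathrm{diag}(1,1,-1)$; on the level of the kernel this is a Schur complement.
\<close>
theorem tangential_interpolation:
  fixes p q m z :: "'i \<Rightarrow> complex"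
  assumes "finite I" "\<And>i. i \<in> I \<Longrightarrow> cmod (z i) < 1" "pick_psd I z (gram p q m)"
  shows "\<exists>G H. G holomorphic_on ball 0 1 \<and> H holomorphic_on ball 0 1 \<and>
    (\<forall>w\<in>ball 0 1. (cmod (G w))\<^sup>2 + (cmod (H w))\<^sup>2 \<le> 1) \<and>
    (\<forall>i\<in>I. p i * G (z i) + q i * H (z i) = m i)"
  using assms
proof (induction I arbitrary: p q m rule: finite_induct)
  case empty
  then show ?case by (intro exI[of _ "\<lambda>_. 0"]) auto
next
  case (insert n I)
  note I = insert.hyps and psd = insert.prems(2)
  have z: "cmod (z i) < 1" if "i \<in> insert n I" for i using insert.prems(1)[OF that] .
  let ?J = "gram p q m"
  define K where "K i j = ?J i j / (1 - z i * cnj (z j))" for i j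
  have psd': "0 \<le> Re (\<Sum>i\<in>I. \<Sum>j\<in>I. c i * cnj (c j) * K i j)
    + 2 * Re (t * (\<Sum>j\<in>I. cnj (c j) * K n j)) + (cmod t)\<^sup>2 * Re (K n n)" for c t
    unfolding K_def by (rule pick_psd_insert[OF psd I cnj_gram z]) simp
  define N where "N = (cmod (p n))\<^sup>2 + (cmod (q n))\<^sup>2 - (cmod (m n))\<^sup>2"
  have NJ: "?J n n = of_real N"
    by (simp add: gram_def N_def complex_norm_square[symmetric])
  have d: "1 - (cmod (z n))\<^sup>2 > 0" using z[of n] abs_square_less_1[of "cmod (z n)"] by simp
  have Knn: "K n n = of_real (N / (1 - (cmod (z n))\<^sup>2))"
    by (simp add: K_def NJ complex_norm_square[symmetric])
  have "0 \<le> N / (1 - (cmod (z n))\<^sup>2)" using psd'[of "\<lambda>_. 0" 1] by (simp add: Knn)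
  then have N0: "0 \<le> N" using d by (simp add: zero_le_divide_iff)
  have restr: "pick_psd I z ?J"
    unfolding pick_psd_def K_def[symmetric]
  proof
    show "0 \<le> Re (\<Sum>i\<in>I. \<Sum>j\<in>I. c i * cnj (c j) * K i j)" for c
      using psd'[of c 0] by simp
  qed
  show ?case
  proof (cases "N = 0")
    case True
    \<comment> \<open>With \<open>K n n\<close> = 0 the form is affine in t and bounded below, so
      its linear coefficient has to vanish.\<close>
    have Kn: "K n i = 0" if i: "i \<in> I" for i
    proof -
      define c where "c j = (if j = i then 1 else 0 :: complex)" for j
      have s: "(\<Sum>j\<in>I. cnj (c j) * K n j) = K n i"
      proof -
        have "(\<Sum>j\<in>I. cnj (c j) * K n j) = (\<Sum>j\<in>I. if j = i then K n j else 0)"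
          by (intro sum.cong) (auto simp: c_def)
        then show ?thesis using I(1) i by simp
      qed
      define A where "A = Re (\<Sum>i\<in>I. \<Sum>j\<in>I. c i * cnj (c j) * K i j)"
      have le: "0 \<le> A + 2 * Re (t * K n i)" for t
        using psd'[of c t] True unfolding s A_def Knn by simp
      have 1: "Re (of_real x * cnj (K n i) * K n i) = x * (cmod (K n i))\<^sup>2" for x
        using complex_norm_square[of "K n i"]
        by (metis Re_complex_of_real mult.assoc mult.commute of_real_mult)
      show ?thesis
      proof (rule ccontr)
        assume ne: "K n i \<noteq> 0"
        define s where "s = - (A + 1) / (2 * (cmod (K n i))\<^sup>2)"
        have "0 \<le> A + 2 * (s * (cmod (K n i))\<^sup>2)" using le[of "of_real s * cnj (K n i)"] unfolding 1 .
        moreover have "2 * (s * (cmod (K n i))\<^sup>2) = - (A + 1)" using ne by (simp add: s_def)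
        ultimately show False by simp
      qed
    qed
    have Jn: "?J i n = 0" if "i \<in> insert n I" for i
    proof (cases "i = n")
      case False
      then have "?J n i = 0"
        using Kn[of i] that one_minus_mult_cnj_nonzero[OF z[of n] z[OF that]] by (simp add: K_def)
      then show ?thesis using cnj_gram[of p q m n i] by simp
    qed (simp add: NJ True)
    show ?thesis
    proof (cases "m n = 0")
      case mn: True
      have "(cmod (p n))\<^sup>2 + (cmod (q n))\<^sup>2 = 0" using True mn by (simp add: N_def)
      then have "p n = 0" "q n = 0" by (simp_all add: sum_power2_eq_zero_iff)
      then show ?thesis using insert.IH[OF z restr] mn by auto
    next
      case False
      \<comment> \<open>Row n is J-neutral and J-orthogonal to every row, so one constant pair
        solves all the equations at once.\<close>
      let ?G = "\<lambda>_::complex. cnj (p n) / cnj (m n)" and ?H = "\<lambda>_::complex. cnj (q n) / cnj (m n)"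
      have "(cmod (?G w))\<^sup>2 + (cmod (?H w))\<^sup>2 \<le> 1" for w :: complex
      proof -
        have "(cmod (?G w))\<^sup>2 + (cmod (?H w))\<^sup>2 = ((cmod (p n))\<^sup>2 + (cmod (q n))\<^sup>2) / (cmod (m n))\<^sup>2"
          by (simp add: norm_divide power_divide add_divide_distrib)
        also have "\<dots> = 1" using True False by (simp add: N_def)
        finally show ?thesis by simp
      qed
      moreover have "p i * ?G (z i) + q i * ?H (z i) = m i" if "i \<in> insert n I" for i
        using Jn[OF that] False by (simp add: gram_def field_simps)
      ultimately show ?thesis by (intro exI[of _ ?G] exI[of _ ?H]) auto
    qed
  next
    case False
    then have Np: "N > 0" using N0 by simp
    have Jnz: "?J n n \<noteq> 0" using Np by (simp add: NJ)
    define r where "r i = ((z i - z n) / (1 - cnj (z n) * z i) - 1) * ?J i n / ?J n n" for i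
    define p' where "p' i = p i + r i * p n" for i
    define q' where "q' i = q i + r i * q n" for i
    define m' where "m' i = m i + r i * m n" for i
    have "pick_psd I z (gram p' q' m')"
      unfolding pick_psd_def
    proof
      fix c :: "'i \<Rightarrow> complex"
      define s where "s = (\<Sum>j\<in>I. cnj (c j) * K n j)"
      have hK: "K i n = cnj (K n i)" for i by (simp add: K_def cnj_gram mult.commute)
      have kn: "Re (K n n) > 0" using Np d by (simp add: Knn)
      have "(\<Sum>i\<in>I. \<Sum>j\<in>I. c i * cnj (c j) * (gram p' q' m' i j / (1 - z i * cnj (z j)))) =
        (\<Sum>i\<in>I. \<Sum>j\<in>I. c i * cnj (c j) * K i j - (c i * K i n) * (cnj (c j) * K n j) / K n n)"
      proof (intro sum.cong refl)
        fix i j assume "i \<in> I" "j \<in> I"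
        then have g: "gram p' q' m' i j / (1 - z i * cnj (z j)) = K i j - K i n * K n j / K n n"
          unfolding p'_def[abs_def] q'_def[abs_def] m'_def[abs_def] r_def K_def
          by (intro schur_complement_gram z Jnz) auto
        show "c i * cnj (c j) * (gram p' q' m' i j / (1 - z i * cnj (z j))) =
          c i * cnj (c j) * K i j - (c i * K i n) * (cnj (c j) * K n j) / K n n"
          unfolding g by (simp add: right_diff_distrib mult_ac)
      qed
      also have "\<dots> = (\<Sum>i\<in>I. \<Sum>j\<in>I. c i * cnj (c j) * K i j) - (\<Sum>i\<in>I. c i * K i n) * s / K n n"
        by (simp add: sum_subtractf s_def sum_product sum_divide_distrib)
      also have "(\<Sum>i\<in>I. c i * K i n) = cnj s"
        by (simp add: s_def hK)
      also have "cnj s * s / K n n = of_real ((cmod s)\<^sup>2 / Re (K n n))"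
      proof -
        have "cnj s * s / of_real x = of_real ((cmod s)\<^sup>2 / x)" for x
          by (simp add: complex_norm_square mult.commute del: of_real_power)
        moreover have "of_real (Re (K n n)) = K n n" by (simp only: Knn Re_complex_of_real)
        ultimately show ?thesis by metis
      qed
      finally have eq: "Re (\<Sum>i\<in>I. \<Sum>j\<in>I. c i * cnj (c j) * (gram p' q' m' i j / (1 - z i * cnj (z j))))
        = Re (\<Sum>i\<in>I. \<Sum>j\<in>I. c i * cnj (c j) * K i j) - (cmod s)\<^sup>2 / Re (K n n)"
        by (simp only: minus_complex.sel Re_complex_of_real)
      \<comment> \<open>The value of t that minimizes the quadratic function of
        \<open>psd'\<close>.\<close>
      have "Re (- cnj s / of_real (Re (K n n)) * s) = - ((cmod s)\<^sup>2 / Re (K n n))"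
      proof -
        have "- cnj s / of_real (Re (K n n)) * s = of_real (- ((cmod s)\<^sup>2 / Re (K n n)))"
          by (simp add: complex_norm_square mult.commute del: of_real_power)
        then show ?thesis by (simp only: Re_complex_of_real)
      qed
      moreover have "(cmod (- cnj s / of_real (Re (K n n))))\<^sup>2 * Re (K n n) = (cmod s)\<^sup>2 / Re (K n n)"
        using kn by (simp add: norm_divide power_divide power2_eq_square)
      ultimately show "0 \<le> Re (\<Sum>i\<in>I. \<Sum>j\<in>I. c i * cnj (c j) * (gram p' q' m' i j / (1 - z i * cnj (z j))))"
        using psd'[of c "- cnj s / of_real (Re (K n n))"] unfolding eq s_def[symmetric] by linarith
    qed
    from insert.IH[OF z this] obtain G H where GH: "G holomorphic_on ball 0 1" "H holomorphic_on ball 0 1"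
      "\<And>w. w \<in> ball 0 1 \<Longrightarrow> (cmod (G w))\<^sup>2 + (cmod (H w))\<^sup>2 \<le> 1"
      "\<And>i. i \<in> I \<Longrightarrow> p' i * G (z i) + q' i * H (z i) = m' i" by auto
    define b where "b w = (w - z n) / (1 - cnj (z n) * w)" for w
    define e where "e w = p n * G w + q n * H w - m n" for w
    define l where "l w = (b w - 1) * e w / of_real N" for w
    have b1: "cmod (b w) \<le> 1" if "w \<in> ball 0 1" for w
      using Moebius_function_norm_lt_1[of "z n" w 0] z[of n] that
      by (simp add: b_def Moebius_function_simple less_imp_le)
    have NC: "of_real N = p n * cnj (p n) + q n * cnj (q n) - m n * cnj (m n)"
      using NJ by (simp add: gram_def)
    have sh: "1 + l w * cnj (m n) \<noteq> 0"
      "(cmod ((G w + l w * cnj (p n)) / (1 + l w * cnj (m n))))\<^sup>2 + (cmod ((H w + l w * cnj (q n)) / (1 + l w * cnj (m n))))\<^sup>2 \<le> 1"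
      if "w \<in> ball 0 1" for w
      unfolding l_def e_def by (rule indefinite_shift[OF NC Np refl GH(3)[OF that] b1[OF that]])+
    have bh: "b holomorphic_on ball 0 1"
      using Moebius_function_holomorphic[of "z n" 0] z[of n]
      by (simp add: b_def[abs_def] Moebius_function_simple[abs_def])
    have lh: "l holomorphic_on ball 0 1"
      unfolding l_def[abs_def] e_def[abs_def] using Np by (intro holomorphic_intros bh GH) auto
    let ?G = "\<lambda>w. (G w + l w * cnj (p n)) / (1 + l w * cnj (m n))"
    let ?H = "\<lambda>w. (H w + l w * cnj (q n)) / (1 + l w * cnj (m n))"
    have "p i * ?G (z i) + q i * ?H (z i) = m i" if i: "i \<in> insert n I" for i
    proof -
      have zi: "z i \<in> ball 0 1" using z[OF i] by simp
      have "p i * (G (z i) + l (z i) * cnj (p n)) + q i * (H (z i) + l (z i) * cnj (q n)) - m i * (1 + l (z i) * cnj (m n))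
        = p i * G (z i) + q i * H (z i) - m i + l (z i) * ?J i n"
        by (simp add: gram_def algebra_simps)
      also have "l (z i) * ?J i n = r i * e (z i)"
        unfolding l_def r_def b_def NJ by simp
      also have "p i * G (z i) + q i * H (z i) - m i + r i * e (z i) = 0"
      proof (cases "i = n")
        case True
        \<comment> \<open>The automorphism vanishes at z_n. The equation of row n therefore holds
          for every pair (G, H) that solves the reduced problem.\<close>
        have "r n = - 1" using Jnz by (simp add: r_def)
        then show ?thesis by (simp add: True e_def)
      next
        case False
        then have "p' i * G (z i) + q' i * H (z i) = m' i" using GH(4) i by auto
        then show ?thesis by (simp add: p'_def q'_def m'_def e_def algebra_simps)
      qed
      finally have "p i * (G (z i) + l (z i) * cnj (p n)) + q i * (H (z i) + l (z i) * cnj (q n)) = m i * (1 + l (z i) * cnj (m n))"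
        by simp
      then have "(p i * (G (z i) + l (z i) * cnj (p n)) + q i * (H (z i) + l (z i) * cnj (q n))) / (1 + l (z i) * cnj (m n)) = m i"
        using sh(1)[OF zi] by simp
      then show ?thesis unfolding times_divide_eq_right add_divide_distrib[symmetric] .
    qed
    moreover have "?G holomorphic_on ball 0 1" "?H holomorphic_on ball 0 1"
      using sh(1) by (auto intro!: holomorphic_intros lh GH)
    ultimately show ?thesis using sh(2) by (intro exI[of _ ?G] exI[of _ ?H]) auto
  qed
qed

section \<open>A sharp corona theorem\<close>

text \<open>The smooth inequality is applied to dilates with \<Lambda> = - ln (2k) and \<tau> =
  \<epsilon>, each responsible for \<epsilon>/2. Passing to the dilate may cost a second k, hence
  2k. Only the values of f and g at the given points occur, so r can tend to 1 in finite
  sums.\<close>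

lemma pick_form_lower_bound:
  fixes f g :: "complex \<Rightarrow> complex" and c z :: "'i \<Rightarrow> complex"
  assumes f: "f holomorphic_on ball 0 1" and g: "g holomorphic_on ball 0 1"
    and f1: "\<And>w. w \<in> ball 0 1 \<Longrightarrow> cmod (f w) \<le> 1" and g1: "\<And>w. w \<in> ball 0 1 \<Longrightarrow> cmod (g w) \<le> 1"
    and I: "finite I" and z: "\<And>i. i \<in> I \<Longrightarrow> cmod (z i) < 1"
    and k: "0 < k" "2 * k < 1"
    and fg: "\<And>w. w \<in> ball 0 1 \<Longrightarrow> 1 - (cmod (f w))\<^sup>2 \<le> k \<or> 1 - (cmod (g w))\<^sup>2 \<le> k"
    and \<epsilon>: "0 < \<epsilon>" "(energy_const + 1) / sqrt (- ln (2 * k)) \<le> \<epsilon> / 2"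
  shows "Re (pick_form I z c) \<le> Re (pick_form I z (\<lambda>i. c i * cnj (f (z i))))
    + \<epsilon> * Re (pick_form I z c) + 1 / (2 * \<epsilon>) * Re (pick_form I z (\<lambda>i. c i * cnj (g (z i))))"
proof -
  \<comment> \<open>Besides the dilation there is a factor r in front: modulus 1 is allowed for f
    and g, whereas the smooth version needs modulus less than 1 on the closed disc.\<close>
  define D where "D h r w = complex_of_real r * h (of_real r * w)" for h :: "complex \<Rightarrow> complex" and r w
  have nn: "0 \<le> Re (pick_form I z c)"
  proof -
    have "\<forall>\<^sub>F R in at_right 1. \<forall>i\<in>I. cmod (z i) * R < 1"
    proof (intro eventually_ball_finite I ballI)
      fix i assume "i \<in> I"
      have "((\<lambda>R. cmod (z i) * R) \<longlongrightarrow> cmod (z i) * 1) (at_right 1)" by (intro tendsto_intros)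
      then show "\<forall>\<^sub>F R in at_right 1. cmod (z i) * R < 1" by (rule order_tendstoD) (use z \<open>i \<in> I\<close> in auto)
    qed
    then have "\<forall>\<^sub>F R in at_right (1::real). (\<forall>i\<in>I. cmod (z i) * R < 1) \<and> 1 < R"
      by (intro eventually_conj eventually_at_right_less)
    then obtain R where R: "1 < R" "\<And>i. i \<in> I \<Longrightarrow> cmod (z i) * R < 1"
      using eventually_happens'[OF trivial_limit_at_right_real] by blast
    show ?thesis
      using R by (subst hardy_norm2_kernel_sum(2)[symmetric, OF R(1) I])
        (auto intro!: hardy_norm2_nonneg[of _ R] kernel_sum_holomorphic)
  qed
  have bound: "Re (pick_form I z c) \<le> Re (pick_form I z (\<lambda>i. c i * cnj (D f r (z i))))
    + \<epsilon> * Re (pick_form I z c) + 1 / (2 * \<epsilon>) * Re (pick_form I z (\<lambda>i. c i * cnj (D g r (z i))))"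
    if r: "0 < r" "r < 1" "1 - r\<^sup>2 < k" for r
  proof -
    have "\<forall>\<^sub>F R in at_right 1. \<forall>i\<in>I. cmod (z i) * R < 1"
    proof (intro eventually_ball_finite I ballI)
      fix i assume "i \<in> I"
      have "((\<lambda>R. cmod (z i) * R) \<longlongrightarrow> cmod (z i) * 1) (at_right 1)" by (intro tendsto_intros)
      then show "\<forall>\<^sub>F R in at_right 1. cmod (z i) * R < 1" by (rule order_tendstoD) (use z \<open>i \<in> I\<close> in auto)
    qed
    moreover have "\<forall>\<^sub>F R in at_right 1. r * R < 1"
    proof -
      have "((\<lambda>R. r * R) \<longlongrightarrow> r * 1) (at_right 1)" by (intro tendsto_intros)
      then show ?thesis by (rule order_tendstoD) (use r in auto)
    qed
    ultimately have "\<forall>\<^sub>F R in at_right (1::real). (\<forall>i\<in>I. cmod (z i) * R < 1) \<and> r * R < 1 \<and> 1 < R"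
      by (intro eventually_conj eventually_at_right_less)
    then obtain R where R: "1 < R" "\<And>i. i \<in> I \<Longrightarrow> cmod (z i) * R < 1" "r * R < 1"
      using eventually_happens'[OF trivial_limit_at_right_real] by blast
    have rw: "of_real r * w \<in> ball 0 1" if "w \<in> cball 0 1" for w :: complex
    proof -
      have "r * cmod w \<le> r * 1" using that r by (intro mult_left_mono) auto
      then have "r * cmod w < 1" using r by linarith
      then show ?thesis using r by (simp add: norm_mult)
    qed
    have Dh: "D h r holomorphic_on ball 0 R" if "h holomorphic_on ball 0 1" for h
    proof -
      have "(\<lambda>w::complex. of_real r * w) ` ball 0 R \<subseteq> ball 0 1"
      proof (rule image_subsetI)
        fix w :: complex assume "w \<in> ball 0 R"
        then have "r * cmod w \<le> r * R" using r by (intro mult_left_mono) auto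
        then have "r * cmod w < 1" using R by linarith
        then show "of_real r * w \<in> ball 0 1" using R r by (simp add: norm_mult)
      qed
      then have "(h \<circ> (\<lambda>w. of_real r * w)) holomorphic_on ball 0 R"
        by (intro holomorphic_on_compose_gen[OF _ that] holomorphic_intros)
      then show ?thesis unfolding D_def[abs_def] o_def by (intro holomorphic_intros)
    qed
    have D1: "cmod (D h r w) < 1" if "\<And>w. w \<in> ball 0 1 \<Longrightarrow> cmod (h w) \<le> 1" "w \<in> cball 0 1" for h w
    proof -
      have "cmod (D h r w) \<le> r * 1"
        unfolding D_def norm_mult using that(1)[OF rw[OF that(2)]] r by (intro mult_mono) auto
      then show ?thesis using r by simp
    qed
    have lw: "- ln (2 * k) \<le> log_weight (D h r) w"
      if "\<And>w. w \<in> ball 0 1 \<Longrightarrow> cmod (h w) \<le> 1" "1 - (cmod (h (of_real r * w)))\<^sup>2 \<le> k" "w \<in> cball 0 1" for h w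
    proof -
      have s: "(cmod (h (of_real r * w)))\<^sup>2 \<le> 1" using that(1)[OF rw[OF that(3)]] by (simp add: abs_square_le_1)
      have "(1 - r\<^sup>2) * (cmod (h (of_real r * w)))\<^sup>2 \<le> (1 - r\<^sup>2) * 1"
        using s r abs_square_less_1[of r] by (intro mult_left_mono) auto
      then have "(1 - r\<^sup>2) * (cmod (h (of_real r * w)))\<^sup>2 \<le> k" using r(3) by simp
      then have "(1 - (cmod (h (of_real r * w)))\<^sup>2) + (1 - r\<^sup>2) * (cmod (h (of_real r * w)))\<^sup>2 \<le> k + k"
        using that(2) by (intro add_mono)
      then have "1 - (cmod (D h r w))\<^sup>2 \<le> 2 * k"
        using r by (simp add: D_def norm_mult power_mult_distrib algebra_simps)
      moreover have "0 < 1 - (cmod (D h r w))\<^sup>2"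
        using D1[OF that(1,3)] abs_square_less_1[of "cmod (D h r w)"] by simp
      ultimately have "ln (1 - (cmod (D h r w))\<^sup>2) \<le> ln (2 * k)" by simp
      then show ?thesis by (simp add: log_weight_def)
    qed
    have "Re (pick_form I z c) \<le> Re (pick_form I z (\<lambda>i. c i * cnj (D f r (z i))))
      + ((energy_const + 1) / sqrt (- ln (2 * k)) + \<epsilon> / 2) * Re (pick_form I z c)
      + 1 / (2 * \<epsilon>) * Re (pick_form I z (\<lambda>i. c i * cnj (D g r (z i))))"
    proof (rule pick_form_lower_bound_smooth[OF Dh[OF f] Dh[OF g] R(1) _ _ I R(2) _ _ \<epsilon>(1)])
      show "0 < - ln (2 * k)" using k by simp
      show "- ln (2 * k) \<le> log_weight (D f r) w \<or> - ln (2 * k) \<le> log_weight (D g r) w" if "w \<in> cball 0 1" for w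
        using fg[OF rw[OF that]] lw[of f w] lw[of g w] f1 g1 that by blast
    qed (use D1 f1 g1 in auto)
    moreover have "((energy_const + 1) / sqrt (- ln (2 * k)) + \<epsilon> / 2) * Re (pick_form I z c) \<le> \<epsilon> * Re (pick_form I z c)"
      using nn add_right_mono[OF \<epsilon>(2), of "\<epsilon> / 2"] by (intro mult_right_mono) auto
    ultimately show ?thesis by linarith
  qed
  have lim: "((\<lambda>r. pick_form I z (\<lambda>i. c i * cnj (D h r (z i)))) \<longlongrightarrow> pick_form I z (\<lambda>i. c i * cnj (h (z i)))) (at_left 1)"
    if h: "h holomorphic_on ball 0 1" for h
  proof -
    have D: "((\<lambda>r. D h r (z i)) \<longlongrightarrow> h (z i)) (at_left 1)" if "i \<in> I" for i
    proof -
      have "isCont h (z i)"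
        using holomorphic_on_imp_continuous_on[OF h] z[OF that] by (auto simp: continuous_on_eq_continuous_at)
      moreover have "((\<lambda>r. of_real r * z i) \<longlongrightarrow> of_real 1 * z i) (at_left 1)" by (intro tendsto_intros)
      ultimately have "((\<lambda>r. h (of_real r * z i)) \<longlongrightarrow> h (z i)) (at_left 1)"
        using isCont_tendsto_compose[of "z i" h "\<lambda>r. of_real r * z i"] by simp
      then have "((\<lambda>r. of_real r * h (of_real r * z i)) \<longlongrightarrow> of_real 1 * h (z i)) (at_left 1)"
        by (intro tendsto_intros)
      then show ?thesis by (simp add: D_def)
    qed
    have nz: "1 - cnj (z i) * z j \<noteq> 0" if "i \<in> I" "j \<in> I" for i j
      using one_minus_mult_cnj_nonzero[OF z[OF that(2)] z[OF that(1)]] by (simp add: mult.commute)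
    show ?thesis unfolding pick_form_def
      by (intro tendsto_intros D nz)
  qed
  have "((\<lambda>r. Re (pick_form I z (\<lambda>i. c i * cnj (D f r (z i)))) + \<epsilon> * Re (pick_form I z c)
      + 1 / (2 * \<epsilon>) * Re (pick_form I z (\<lambda>i. c i * cnj (D g r (z i)))))
    \<longlongrightarrow> Re (pick_form I z (\<lambda>i. c i * cnj (f (z i)))) + \<epsilon> * Re (pick_form I z c)
      + 1 / (2 * \<epsilon>) * Re (pick_form I z (\<lambda>i. c i * cnj (g (z i))))) (at_left 1)"
    by (intro tendsto_intros lim f g)
  moreover have "\<forall>\<^sub>F r in at_left 1. Re (pick_form I z c) \<le> Re (pick_form I z (\<lambda>i. c i * cnj (D f r (z i))))
    + \<epsilon> * Re (pick_form I z c) + 1 / (2 * \<epsilon>) * Re (pick_form I z (\<lambda>i. c i * cnj (D g r (z i))))"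
  proof -
    have "((\<lambda>r. 1 - r\<^sup>2) \<longlongrightarrow> 1 - 1\<^sup>2) (at_left (1::real))" by (intro tendsto_intros)
    then have "\<forall>\<^sub>F r in at_left (1::real). 1 - r\<^sup>2 < k" by (rule order_tendstoD) (use k in auto)
    moreover have "\<forall>\<^sub>F r in at_left (1::real). 0 < r \<and> r < 1"
      using eventually_at_left_real[of 0 1] by (auto elim: eventually_mono)
    ultimately show ?thesis by eventually_elim (rule bound; simp)
  qed
  ultimately show ?thesis by (rule tendsto_lowerbound) simp
qed

lemma Montel_unit_bound:
  fixes F :: "nat \<Rightarrow> complex \<Rightarrow> complex"
  assumes hol: "\<And>n. F n holomorphic_on S" and S: "open S" and le: "\<And>n w. w \<in> S \<Longrightarrow> cmod (F n w) \<le> 1"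
  shows "\<exists>g r. g holomorphic_on S \<and> strict_mono (r :: nat \<Rightarrow> nat) \<and> (\<forall>w\<in>S. (\<lambda>n. F (r n) w) \<longlonglongrightarrow> g w)"
proof (rule Montel[OF S, of "range F" F])
  show "\<exists>B. \<forall>h\<in>range F. \<forall>z\<in>K. cmod (h z) \<le> B" if "K \<subseteq> S" for K
    using le that by (intro exI[of _ 1]) auto
qed (use hol in auto)

text \<open>Interpolation yields solutions at finitely many points with bounds that do not depend on
  their number. A normal family limit solves the equation on an infinite set with a limit point in
  the disc, hence everywhere.\<close>

theorem corona_sharp:
  fixes f g :: "complex \<Rightarrow> complex"
  assumes f: "f holomorphic_on ball 0 1" and g: "g holomorphic_on ball 0 1"
    and f1: "\<And>w. w \<in> ball 0 1 \<Longrightarrow> cmod (f w) \<le> 1" and g1: "\<And>w. w \<in> ball 0 1 \<Longrightarrow> cmod (g w) \<le> 1"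
    and k: "0 < k" "2 * k < 1"
    and fg: "\<And>w. w \<in> ball 0 1 \<Longrightarrow> 1 - (cmod (f w))\<^sup>2 \<le> k \<or> 1 - (cmod (g w))\<^sup>2 \<le> k"
    and \<epsilon>: "0 < \<epsilon>" "\<epsilon> < 1" "(energy_const + 1) / sqrt (- ln (2 * k)) \<le> \<epsilon> / 2"
  obtains G H B where "G holomorphic_on ball 0 1" "H holomorphic_on ball 0 1"
    "\<And>w. w \<in> ball 0 1 \<Longrightarrow> cmod (G w) \<le> 1 / sqrt (1 - \<epsilon>)"
    "\<And>w. w \<in> ball 0 1 \<Longrightarrow> cmod (H w) \<le> B"
    "\<And>w. w \<in> ball 0 1 \<Longrightarrow> f w * G w + g w * H w = 1"
proof -
  \<comment> \<open>The squares of \<open>s\<close> and \<open>\<mu>\<close> are the coefficients 1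
    / (2 \<epsilon>) and 1 - \<epsilon> of the kernel. A contractive pair interpolates the constant
    \<open>\<mu>\<close>; division by \<open>\<mu>\<close> then produces the bound 1 / sqrt (1 -
    \<epsilon>).\<close>
  define s where "s = sqrt (1 / (2 * \<epsilon>))"
  define \<mu> where "\<mu> = sqrt (1 - \<epsilon>)"
  have s2: "s\<^sup>2 = 1 / (2 * \<epsilon>)" and \<mu>2: "\<mu>\<^sup>2 = 1 - \<epsilon>" and pos: "0 < s" "0 < \<mu>" using \<epsilon> by (auto simp: s_def \<mu>_def)
  \<comment> \<open>Any sequence of distinct points accumulating inside the disc would do; these
    tend to 0 without reaching it.\<close>
  define z where "z i = complex_of_real (1 / (real i + 2))" for i :: nat
  have z: "cmod (z i) < 1" for i
  proof -
    have "cmod (z i) = 1 / (real i + 2)" unfolding z_def norm_of_real by simp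
    then show ?thesis by simp
  qed
  have psd: "pick_psd {..<n} z (gram (\<lambda>i. f (z i)) (\<lambda>i. of_real s * g (z i)) (\<lambda>_. of_real \<mu>))" for n
    unfolding pick_psd_def
  proof
    fix c :: "nat \<Rightarrow> complex"
    let ?I = "{..<n}"
    have "(\<Sum>i\<in>?I. \<Sum>j\<in>?I. c i * cnj (c j) * (gram (\<lambda>i. f (z i)) (\<lambda>i. of_real s * g (z i)) (\<lambda>_. of_real \<mu>) i j / (1 - z i * cnj (z j))))
      = (\<Sum>i\<in>?I. \<Sum>j\<in>?I. cnj (cnj (c i) * cnj (f (z i))) * (cnj (c j) * cnj (f (z j))) / (1 - cnj (z j) * z i)
        + of_real (s\<^sup>2) * (cnj (cnj (c i) * cnj (g (z i))) * (cnj (c j) * cnj (g (z j))) / (1 - cnj (z j) * z i))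
        - of_real (\<mu>\<^sup>2) * (cnj (cnj (c i)) * cnj (c j) / (1 - cnj (z j) * z i)))"
      by (intro sum.cong refl) (simp add: gram_def power2_eq_square divide_inverse algebra_simps)
    also have "\<dots> = pick_form ?I z (\<lambda>i. cnj (c i) * cnj (f (z i))) + of_real (s\<^sup>2) * pick_form ?I z (\<lambda>i. cnj (c i) * cnj (g (z i)))
      - of_real (\<mu>\<^sup>2) * pick_form ?I z (\<lambda>i. cnj (c i))"
      unfolding pick_form_def by (simp only: sum.distrib sum_subtractf sum_distrib_left)
    finally have eq: "Re (\<Sum>i\<in>?I. \<Sum>j\<in>?I. c i * cnj (c j) * (gram (\<lambda>i. f (z i)) (\<lambda>i. of_real s * g (z i)) (\<lambda>_. of_real \<mu>) i j / (1 - z i * cnj (z j))))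
      = Re (pick_form ?I z (\<lambda>i. cnj (c i) * cnj (f (z i)))) + 1 / (2 * \<epsilon>) * Re (pick_form ?I z (\<lambda>i. cnj (c i) * cnj (g (z i))))
        - (1 - \<epsilon>) * Re (pick_form ?I z (\<lambda>i. cnj (c i)))"
      unfolding s2 \<mu>2 by (simp del: of_real_diff of_real_divide)
    show "0 \<le> Re (\<Sum>i\<in>?I. \<Sum>j\<in>?I. c i * cnj (c j) * (gram (\<lambda>i. f (z i)) (\<lambda>i. of_real s * g (z i)) (\<lambda>_. of_real \<mu>) i j / (1 - z i * cnj (z j))))"
      unfolding eq using pick_form_lower_bound[OF f g f1 g1 finite_lessThan z k fg \<epsilon>(1,3), of n, where c = "\<lambda>i. cnj (c i)"]
      by (simp add: algebra_simps)
  qed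
  define P where "P n X \<longleftrightarrow> fst X holomorphic_on ball 0 1 \<and> snd X holomorphic_on ball 0 1 \<and>
    (\<forall>w\<in>ball 0 1. (cmod (fst X w))\<^sup>2 + (cmod (snd X w))\<^sup>2 \<le> 1) \<and>
    (\<forall>i\<in>{..<n}. f (z i) * fst X (z i) + (of_real s * g (z i)) * snd X (z i) = of_real \<mu>)"
    for n and X :: "(complex \<Rightarrow> complex) \<times> (complex \<Rightarrow> complex)"
  have "\<exists>X. P n X" for n
    using tangential_interpolation[OF finite_lessThan z psd, of n] by (auto simp: P_def)
  then obtain X where X: "\<And>n. P n (X n)" by metis
  define G H where "G n = fst (X n)" and "H n = snd (X n)" for n
  have GH: "\<And>n. G n holomorphic_on ball 0 1" "\<And>n. H n holomorphic_on ball 0 1"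
    "\<And>n w. w \<in> ball 0 1 \<Longrightarrow> (cmod (G n w))\<^sup>2 + (cmod (H n w))\<^sup>2 \<le> 1"
    "\<And>n i. i < n \<Longrightarrow> f (z i) * G n (z i) + (of_real s * g (z i)) * H n (z i) = of_real \<mu>"
    using X by (auto simp: P_def G_def H_def)
  have G1: "cmod (G n w) \<le> 1" and H1: "cmod (H n w) \<le> 1" if "w \<in> ball 0 1" for n w
  proof -
    have "(cmod (G n w))\<^sup>2 \<le> 1" "(cmod (H n w))\<^sup>2 \<le> 1"
      using GH(3)[OF that, of n] zero_le_power2[of "cmod (G n w)"] zero_le_power2[of "cmod (H n w)"] by linarith+
    then show "cmod (G n w) \<le> 1" "cmod (H n w) \<le> 1" by (simp_all add: abs_square_le_1)
  qed
  obtain G0 \<rho> where G0: "G0 holomorphic_on ball 0 1" "strict_mono \<rho>"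
    "\<And>w. w \<in> ball 0 1 \<Longrightarrow> (\<lambda>n. G (\<rho> n) w) \<longlonglongrightarrow> G0 w"
    using Montel_unit_bound[of G, OF GH(1) open_ball G1] by blast
  obtain H0 \<sigma> where H0: "H0 holomorphic_on ball 0 1" "strict_mono \<sigma>"
    "\<And>w. w \<in> ball 0 1 \<Longrightarrow> (\<lambda>n. H (\<rho> (\<sigma> n)) w) \<longlonglongrightarrow> H0 w"
    using Montel_unit_bound[of "\<lambda>n. H (\<rho> n)", OF GH(2) open_ball H1] by blast
  have G0': "(\<lambda>n. G (\<rho> (\<sigma> n)) w) \<longlonglongrightarrow> G0 w" if "w \<in> ball 0 1" for w
    using LIMSEQ_subseq_LIMSEQ[OF G0(3)[OF that] H0(2)] by (simp add: o_def)
  have mono: "strict_mono (\<lambda>n. \<rho> (\<sigma> n))" using G0(2) H0(2) by (auto simp: strict_mono_def)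
  define F where "F w = f w * G0 w + (of_real s * g w) * H0 w - of_real \<mu>" for w
  have F: "F holomorphic_on ball 0 1" unfolding F_def[abs_def] by (intro holomorphic_intros f g G0 H0)
  have Fz: "F (z i) = 0" for i
  proof -
    have zi: "z i \<in> ball 0 1" using z by simp
    have "(\<lambda>n. f (z i) * G (\<rho> (\<sigma> n)) (z i) + (of_real s * g (z i)) * H (\<rho> (\<sigma> n)) (z i) - of_real \<mu>) \<longlonglongrightarrow> F (z i)"
      unfolding F_def by (intro tendsto_intros G0'[OF zi] H0(3)[OF zi])
    moreover have "\<forall>\<^sub>F n in sequentially. f (z i) * G (\<rho> (\<sigma> n)) (z i) + (of_real s * g (z i)) * H (\<rho> (\<sigma> n)) (z i) - of_real \<mu> = 0"
      using eventually_gt_at_top[of i]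
    proof eventually_elim
      fix n assume "i < n"
      then have "i < \<rho> (\<sigma> n)" using seq_suble[OF mono, of n] by simp
      then show "f (z i) * G (\<rho> (\<sigma> n)) (z i) + (of_real s * g (z i)) * H (\<rho> (\<sigma> n)) (z i) - of_real \<mu> = 0"
        using GH(4) by simp
    qed
    ultimately have "(\<lambda>n. 0) \<longlonglongrightarrow> F (z i)" by (rule Lim_transform_eventually)
    then show ?thesis using LIMSEQ_unique tendsto_const by blast
  qed
  have F0: "F w = 0" if "w \<in> ball 0 1" for w
  proof (rule analytic_continuation[OF F open_ball connected_ball, of "range z" 0 w])
    have "(\<lambda>i. 1 / (real i + 2)) \<longlonglongrightarrow> 0" by real_asymp
    then have "z \<longlonglongrightarrow> 0" unfolding z_def using tendsto_of_real[of "\<lambda>i. 1 / (real i + 2)" 0 sequentially, where 'a = complex]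
      by simp
    moreover have "z i \<noteq> 0" for i unfolding z_def of_real_eq_0_iff by simp
    ultimately show "0 islimpt range z"
      unfolding islimpt_sequential by (intro exI[of _ z]) auto
  qed (use z Fz that in auto)
  show thesis
  proof (rule that[of "\<lambda>w. G0 w / of_real \<mu>" "\<lambda>w. of_real s * H0 w / of_real \<mu>" "s / \<mu>"])
    show "(\<lambda>w. G0 w / of_real \<mu>) holomorphic_on ball 0 1" "(\<lambda>w. of_real s * H0 w / of_real \<mu>) holomorphic_on ball 0 1"
      using pos by (auto intro!: holomorphic_intros G0 H0)
    fix w :: complex assume w: "w \<in> ball 0 1"
    have "cmod (G0 w) \<le> 1"
      by (rule tendsto_upperbound[OF tendsto_norm[OF G0(3)[OF w]]]) (simp_all add: G1[OF w])
    then show "cmod (G0 w / of_real \<mu>) \<le> 1 / sqrt (1 - \<epsilon>)"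
      using pos by (simp add: norm_divide \<mu>_def divide_right_mono)
    have "cmod (H0 w) \<le> 1"
      by (rule tendsto_upperbound[OF tendsto_norm[OF H0(3)[OF w]]]) (simp_all add: H1[OF w])
    then show "cmod (of_real s * H0 w / of_real \<mu>) \<le> s / \<mu>"
      using pos by (simp add: norm_divide norm_mult divide_right_mono mult_left_le)
    have "f w * (G0 w / of_real \<mu>) + g w * (of_real s * H0 w / of_real \<mu>) = (F w + of_real \<mu>) / of_real \<mu>"
      by (simp add: F_def add_divide_distrib[symmetric] mult_ac)
    then show "f w * (G0 w / of_real \<mu>) + g w * (of_real s * H0 w / of_real \<mu>) = 1"
      using F0[OF w] pos by simp
  qed
qed

section \<open>Boundary behaviour and the Schwarz--Pick lemma\<close>

text \<open>Dominated convergence calls for a sequence of radii; the summand 2 keeps them strictly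
  between 0 and 1 from n = 0 on.\<close>

lemma radii_at_left: "filterlim (\<lambda>n. 1 - 1 / (real n + 2)) (at_left 1) sequentially"
  unfolding filterlim_at
proof
  show "(\<lambda>n. 1 - 1 / (real n + 2)) \<longlonglongrightarrow> 1" by real_asymp
qed auto

text \<open>The reproducing formula for k^m bounds |k(rw)|^m by the mean of max(1,|k|)^m over the
  circle of radius r, divided by 1 - |w|. In the limit |k(w)|^m \<le> 1 / (1 - |w|) for every m,
  which excludes |k(w)| > 1. Powers thus replace the Poisson kernel, and \<open>max 1\<close> allows
  k to have no radial limits.\<close>

lemma radial_max_principle:
  assumes k: "k holomorphic_on ball 0 1" and B: "\<And>w. w \<in> ball 0 1 \<Longrightarrow> cmod (k w) \<le> B"
    and lim: "AE t in lebesgue_on {0..2 * pi}.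
      (\<lambda>n. max 1 (cmod (k (of_real (1 - 1 / (real n + 2)) * cis t)))) \<longlonglongrightarrow> 1"
    and w: "w \<in> ball 0 1"
  shows "cmod (k w) \<le> 1"
proof -
  define r where "r n = 1 - 1 / (real n + 2)" for n
  have r: "0 < r n" "r n < 1" for n by (auto simp: r_def field_simps)
  have r1: "r \<longlonglongrightarrow> 1" using radii_at_left by (simp add: filterlim_at r_def[abs_def])
  have rz: "of_real (r n) * z \<in> ball 0 1" if "cmod z < 1 / r n" for n and z :: complex
    using that r[of n] by (simp add: norm_mult field_simps)
  have rz1: "of_real (r n) * z \<in> ball 0 1" if "z \<in> cball 0 1" for n and z :: complex
  proof (rule rz)
    have "1 < 1 / r n" using r[of n] by simp
    then show "cmod z < 1 / r n" using that by simp
  qed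
  have wlt: "0 < 1 - cmod w" using w by simp
  have le: "cmod (k w) ^ m \<le> 1 / (1 - cmod w)" for m
  proof -
    let ?\<phi> = "\<lambda>n t. (max 1 (cmod (k (of_real (r n) * cis t)))) ^ m"
    have kh: "(\<lambda>z. k (of_real (r n) * z)) holomorphic_on ball 0 (1 / r n)" for n
    proof -
      have "(k \<circ> (\<lambda>z. of_real (r n) * z)) holomorphic_on ball 0 (1 / r n)"
        by (rule holomorphic_on_compose_gen[OF _ k]) (use rz in \<open>auto intro!: holomorphic_intros\<close>)
      then show ?thesis by (simp add: o_def)
    qed
    have R: "1 < 1 / r n" for n using r[of n] by simp
    have cont: "continuous_on {0..2 * pi} (?\<phi> n)" for n
    proof -
      have "continuous_on UNIV (\<lambda>t. k (of_real (r n) * cis t))"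
        using rz1 by (intro continuous_on_compose2[OF holomorphic_on_imp_continuous_on[OF k]] continuous_intros) auto
      then show ?thesis by (intro continuous_intros) (auto elim: continuous_on_subset)
    qed
    have est: "cmod (k (of_real (r n) * w)) ^ m \<le> integral\<^sup>L (lebesgue_on {0..2 * pi}) (?\<phi> n) / (2 * pi) / (1 - cmod w)" for n
    proof -
      let ?u = "\<lambda>z. k (of_real (r n) * z) ^ m"
      let ?F = "\<lambda>z. ?u z * cnj (1 / (1 - cnj w * z))"
      have u: "?u holomorphic_on ball 0 (1 / r n)" by (intro holomorphic_intros kh)
      have "?u w = circ_mean ?F"
        using circ_reproducing[OF u R, of w] w by simp
      also have "cmod (circ_mean ?F) \<le> integral (cbox 0 (2 * pi)) (\<lambda>t. ?\<phi> n t / (1 - cmod w)) / (2 * pi)"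
      proof -
        have nz: "1 - cmod w \<le> cmod (1 - cnj w * cis t)" for t
          using norm_triangle_ineq2[of 1 "cnj w * cis t"] by (simp add: norm_mult)
        have "norm (integral (cbox 0 (2 * pi)) (\<lambda>t. ?F (cis t))) \<le> integral (cbox 0 (2 * pi)) (\<lambda>t. ?\<phi> n t / (1 - cmod w))"
        proof (rule integral_norm_bound_integral)
          have "0 < 1 + cmod w" by (simp add: add_pos_nonneg)
          then have R': "1 < 2 / (1 + cmod w)" "cmod w * (2 / (1 + cmod w)) < 1"
            using wlt by (simp_all add: pos_less_divide_eq pos_divide_less_eq)
          have "kernel_sum {()} (\<lambda>_. w) (\<lambda>_. 1) holomorphic_on ball 0 (2 / (1 + cmod w))"
            by (intro kernel_sum_holomorphic R'; assumption?)
          from this R'(1) have "continuous_on (cball 0 1) (kernel_sum {()} (\<lambda>_. w) (\<lambda>_. 1))"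
            by (rule holomorphic_continuous_on_cball)
          then have "continuous_on (cball 0 1) (\<lambda>z. 1 / (1 - cnj w * z))"
            by (simp add: kernel_sum_def[abs_def])
          then have "continuous_on (cball 0 1) ?F"
            using holomorphic_continuous_on_cball(1)[OF u R] by (intro continuous_on_mult continuous_on_cnj)
          then show "(\<lambda>t. ?F (cis t)) integrable_on cbox 0 (2 * pi)" by (rule circ.integrable)
          show "(\<lambda>t. ?\<phi> n t / (1 - cmod w)) integrable_on cbox 0 (2 * pi)"
            using wlt unfolding cbox_interval
            by (intro integrable_continuous_real continuous_on_divide cont continuous_on_const) auto
          fix t
          have "norm (?F (cis t)) = cmod (k (of_real (r n) * cis t)) ^ m * (1 / cmod (1 - cnj w * cis t))"
            by (simp only: norm_mult norm_power complex_mod_cnj norm_divide norm_one)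
          also have "\<dots> \<le> ?\<phi> n t * (1 / (1 - cmod w))"
            using nz[of t] wlt by (intro mult_mono power_mono divide_left_mono) (auto intro!: mult_pos_pos)
          finally show "norm (?F (cis t)) \<le> ?\<phi> n t / (1 - cmod w)" by simp
        qed
        then have "norm (integral (cbox 0 (2 * pi)) (\<lambda>t. ?F (cis t))) / (2 * pi)
          \<le> integral (cbox 0 (2 * pi)) (\<lambda>t. ?\<phi> n t / (1 - cmod w)) / (2 * pi)"
          by (rule divide_right_mono) simp
        then show ?thesis unfolding circ.avg_def norm_scaleR by (simp only: abs_inverse abs_mult divide_inverse mult.commute abs_numeral abs_of_pos[OF pi_gt_zero])
      qed
      also have "integral (cbox 0 (2 * pi)) (\<lambda>t. ?\<phi> n t / (1 - cmod w)) = integral {0..2 * pi} (?\<phi> n) / (1 - cmod w)"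
        by (simp add: cbox_interval)
      also have "integral {0..2 * pi} (?\<phi> n) = integral\<^sup>L (lebesgue_on {0..2 * pi}) (?\<phi> n)"
        by (rule lebesgue_integral_eq_integral[symmetric])
          (auto intro!: continuous_imp_integrable_real cont)
      finally show ?thesis by (simp add: norm_power mult.commute)
    qed
    have "(\<lambda>n. integral\<^sup>L (lebesgue_on {0..2 * pi}) (?\<phi> n)) \<longlonglongrightarrow> integral\<^sup>L (lebesgue_on {0..2 * pi}) (\<lambda>t. 1)"
    proof (rule integral_dominated_convergence[where w = "\<lambda>t. (max 1 B) ^ m"])
      show "AE t in lebesgue_on {0..2 * pi}. (\<lambda>n. ?\<phi> n t) \<longlonglongrightarrow> 1"
        using lim
      proof eventually_elim
        fix t assume "(\<lambda>n. max 1 (cmod (k (of_real (1 - 1 / (real n + 2)) * cis t)))) \<longlonglongrightarrow> 1"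
        from tendsto_power[OF this, of m] show "(\<lambda>n. ?\<phi> n t) \<longlonglongrightarrow> 1" by (simp add: r_def)
      qed
      show "AE t in lebesgue_on {0..2 * pi}. norm (?\<phi> n t) \<le> (max 1 B) ^ m" for n
      proof (rule AE_I2)
        fix t
        have "?\<phi> n t \<le> (max 1 B) ^ m"
          by (intro power_mono max.mono order.refl B rz1) auto
        then show "norm (?\<phi> n t) \<le> (max 1 B) ^ m" by simp
      qed
      show "?\<phi> n \<in> borel_measurable (lebesgue_on {0..2 * pi})" for n
        by (rule continuous_imp_measurable_on_sets_lebesgue[OF cont]) auto
    qed (auto intro!: continuous_imp_integrable_real continuous_intros)
    also have "integral\<^sup>L (lebesgue_on {0..2 * pi}) (\<lambda>t. 1::real) = 2 * pi"
      by (subst lebesgue_integral_eq_integral) (auto intro!: continuous_imp_integrable_real)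
    finally have "(\<lambda>n. integral\<^sup>L (lebesgue_on {0..2 * pi}) (?\<phi> n) / (2 * pi) / (1 - cmod w)) \<longlonglongrightarrow> 2 * pi / (2 * pi) / (1 - cmod w)"
      using wlt by (intro tendsto_intros) auto
    moreover have "(\<lambda>n. cmod (k (of_real (r n) * w)) ^ m) \<longlonglongrightarrow> cmod (k w) ^ m"
    proof -
      have "isCont k w"
        using holomorphic_on_imp_continuous_on[OF k] w by (auto simp: continuous_on_eq_continuous_at)
      moreover have "(\<lambda>n. of_real (r n) * w) \<longlonglongrightarrow> of_real 1 * w" by (intro tendsto_intros r1)
      ultimately have "(\<lambda>n. k (of_real (r n) * w)) \<longlonglongrightarrow> k w"
        using isCont_tendsto_compose[of w k "\<lambda>n. of_real (r n) * w"] by simp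
      then show ?thesis by (intro tendsto_intros)
    qed
    ultimately have "cmod (k w) ^ m \<le> 2 * pi / (2 * pi) / (1 - cmod w)"
      using est by (intro LIMSEQ_le[of _ "cmod (k w) ^ m"]) blast+
    then show ?thesis by simp
  qed
  show ?thesis
  proof (rule ccontr)
    assume "\<not> cmod (k w) \<le> 1"
    then obtain m where "1 / (1 - cmod w) < cmod (k w) ^ m"
      using real_arch_pow[of "cmod (k w)" "1 / (1 - cmod w)"] by (auto simp only: not_le)
    then show False using le[of m] by simp
  qed
qed

section \<open>Inner functions on almost every radius\<close>

lemma Hinf_carrier_iff:
  "f \<in> carrier Hinf \<longleftrightarrow> f \<in> extensional unit_disc \<and> f holomorphic_on unit_disc \<and> bounded (f ` unit_disc)"
  by (simp add: Hinf_def)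

lemma Hinf_bound:
  assumes "f \<in> carrier Hinf" obtains B where "\<And>w. w \<in> unit_disc \<Longrightarrow> cmod (f w) \<le> B" "1 \<le> B"
proof -
  obtain B where "\<forall>x\<in>f ` unit_disc. cmod x \<le> B"
    using assms unfolding Hinf_carrier_iff bounded_iff by blast
  then have "\<And>w. w \<in> unit_disc \<Longrightarrow> cmod (f w) \<le> max B 1" by (meson imageI max.coboundedI1)
  then show ?thesis using that[of "max B 1"] by auto
qed

lemma inner_function_radii:
  assumes "inner_function \<Theta>"
  shows "AE t in lebesgue_on {0..2 * pi}. (\<lambda>n. cmod (\<Theta> (of_real (1 - 1 / (real n + 2)) * cis t))) \<longlonglongrightarrow> 1"
proof -
  have "AE t in lebesgue_on {0..2 * pi}. \<exists>l. ((\<lambda>r. \<Theta> (of_real r * cis t)) \<longlongrightarrow> l) (at_left 1) \<and> cmod l = 1"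
    using assms by (simp add: inner_function_def)
  then show ?thesis
  proof eventually_elim
    fix t assume "\<exists>l. ((\<lambda>r. \<Theta> (of_real r * cis t)) \<longlongrightarrow> l) (at_left 1) \<and> cmod l = 1"
    then obtain l where l: "((\<lambda>r. \<Theta> (of_real r * cis t)) \<longlongrightarrow> l) (at_left 1)" "cmod l = 1" by blast
    from tendsto_norm[OF filterlim_compose[OF l(1) radii_at_left]]
    show "(\<lambda>n. cmod (\<Theta> (of_real (1 - 1 / (real n + 2)) * cis t))) \<longlonglongrightarrow> 1" by (simp only: l(2))
  qed
qed

lemma inner_function_holomorphic: "inner_function \<Theta> \<Longrightarrow> \<Theta> holomorphic_on unit_disc"
  by (simp add: inner_function_def Hinf_carrier_iff)

lemma inner_function_le_1:
  assumes "inner_function \<Theta>" "w \<in> unit_disc"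
  shows "cmod (\<Theta> w) \<le> 1"
proof -
  have "\<Theta> \<in> carrier Hinf" using assms(1) by (simp add: inner_function_def)
  then obtain B where B: "\<And>w. w \<in> unit_disc \<Longrightarrow> cmod (\<Theta> w) \<le> B" using Hinf_bound by blast
  have "AE t in lebesgue_on {0..2 * pi}. (\<lambda>n. max 1 (cmod (\<Theta> (of_real (1 - 1 / (real n + 2)) * cis t)))) \<longlonglongrightarrow> 1"
    using inner_function_radii[OF assms(1)]
  proof eventually_elim
    fix t assume "(\<lambda>n. cmod (\<Theta> (of_real (1 - 1 / (real n + 2)) * cis t))) \<longlonglongrightarrow> 1"
    from tendsto_max[OF tendsto_const[of 1] this]
    show "(\<lambda>n. max 1 (cmod (\<Theta> (of_real (1 - 1 / (real n + 2)) * cis t)))) \<longlonglongrightarrow> 1" by simp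
  qed
  from radial_max_principle[OF inner_function_holomorphic[OF assms(1)] B this assms(2)] show ?thesis .
qed

text \<open>Along almost every radius |k| \<le> 1/|\<Theta>|, which tends to 1. Near the zeros of
  \<Theta> this says nothing, but boundedness of k is enough for the radial maximum
  principle.\<close>

lemma inner_function_divide_le_1:
  assumes \<Theta>: "inner_function \<Theta>" and k: "k holomorphic_on unit_disc"
    and B: "\<And>w. w \<in> unit_disc \<Longrightarrow> cmod (k w) \<le> B"
    and le: "\<And>w. w \<in> unit_disc \<Longrightarrow> cmod (\<Theta> w * k w) \<le> 1" and w: "w \<in> unit_disc"
  shows "cmod (k w) \<le> 1"
proof -
  have "AE t in lebesgue_on {0..2 * pi}. (\<lambda>n. max 1 (cmod (k (of_real (1 - 1 / (real n + 2)) * cis t)))) \<longlonglongrightarrow> 1"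
    using inner_function_radii[OF \<Theta>]
  proof eventually_elim
    fix t assume lim: "(\<lambda>n. cmod (\<Theta> (of_real (1 - 1 / (real n + 2)) * cis t))) \<longlonglongrightarrow> 1"
    define c where "c n = cmod (\<Theta> (of_real (1 - 1 / (real n + 2)) * cis t))" for n
    have c: "c \<longlonglongrightarrow> 1" using lim by (simp add: c_def[abs_def])
    have "(\<lambda>n. max 1 (1 / c n)) \<longlonglongrightarrow> max 1 (1 / 1)" by (intro tendsto_intros c) auto
    then have up: "(\<lambda>n. max 1 (1 / c n)) \<longlonglongrightarrow> 1" by simp
    have "\<forall>\<^sub>F n in sequentially. 0 < c n" using order_tendstoD(1)[OF c, of 0] by simp
    then have ev: "\<forall>\<^sub>F n in sequentially. max 1 (cmod (k (of_real (1 - 1 / (real n + 2)) * cis t))) \<le> max 1 (1 / c n)"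
    proof eventually_elim
      fix n assume c0: "0 < c n"
      have "cmod (of_real (1 - 1 / (real n + 2)) * cis t) = \<bar>1 - 1 / (real n + 2)\<bar>"
        by (simp only: norm_mult norm_of_real norm_cis mult_1_right)
      moreover have "\<bar>1 - 1 / (real n + 2)\<bar> < 1" by (simp add: field_simps)
      ultimately have "of_real (1 - 1 / (real n + 2)) * cis t \<in> unit_disc" by (simp only: mem_ball_0)
      from le[OF this] have "c n * cmod (k (of_real (1 - 1 / (real n + 2)) * cis t)) \<le> 1"
        by (simp only: norm_mult c_def)
      then have "cmod (k (of_real (1 - 1 / (real n + 2)) * cis t)) \<le> 1 / c n"
        using c0 by (simp add: pos_le_divide_eq mult.commute)
      then show "max 1 (cmod (k (of_real (1 - 1 / (real n + 2)) * cis t))) \<le> max 1 (1 / c n)" by (rule max.mono[OF order.refl])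
    qed
    show "(\<lambda>n. max 1 (cmod (k (of_real (1 - 1 / (real n + 2)) * cis t)))) \<longlonglongrightarrow> 1"
      by (rule tendsto_sandwich[OF always_eventually ev tendsto_const up]) simp
  qed
  from radial_max_principle[OF k B this w] show ?thesis .
qed

section \<open>Pseudohyperbolic distance and Schwarz--Pick estimates\<close>

lemma rho_eq_Moebius: "rho z w = cmod (Moebius_function 0 w z)"
  by (simp add: rho_def Moebius_function_simple)

lemma rho_nonneg: "0 \<le> rho z w"
  by (simp add: rho_def)

lemma rho_commute: "rho z w = rho w z"
proof -
  have "cmod (1 - cnj w * z) = cmod (1 - cnj z * w)"
    using complex_mod_cnj[of "1 - cnj w * z"] by (simp add: mult.commute)
  then show ?thesis by (simp add: rho_def norm_divide norm_minus_commute)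
qed

text \<open>Schwarz's lemma after moving \<open>a\<close> to 0. It asks for modulus strictly less
  than 1, so F is first multiplied by c < 1, and then c tends to 1.\<close>

lemma Schwarz_rho:
  assumes F: "F holomorphic_on unit_disc" and F1: "\<And>w. w \<in> unit_disc \<Longrightarrow> cmod (F w) \<le> 1"
    and a: "a \<in> unit_disc" "F a = 0" and z: "z \<in> unit_disc"
  shows "cmod (F z) \<le> rho z a"
proof -
  have "c * cmod (F z) \<le> rho z a" if c: "0 < c" "c < 1" for c
  proof -
    define h where "h w = of_real c * F (Moebius_function 0 (- a) w)" for w
    have na: "cmod (- a) < 1" using a by simp
    have M: "Moebius_function 0 (- a) w \<in> unit_disc" if "w \<in> unit_disc" for w
      using Moebius_function_norm_lt_1[OF na] that by simp
    have "(F \<circ> Moebius_function 0 (- a)) holomorphic_on ball 0 1"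
      by (rule holomorphic_on_compose_gen[OF Moebius_function_holomorphic[OF na] F]) (use M in auto)
    then have "h holomorphic_on ball 0 1" unfolding h_def[abs_def] o_def by (intro holomorphic_intros)
    moreover have "h 0 = 0" using a by (simp add: h_def Moebius_function_of_zero)
    moreover have "cmod (h w) < 1" if "cmod w < 1" for w
    proof -
      have "cmod (h w) \<le> c * 1"
        unfolding h_def norm_mult using F1[OF M, of w] that c by (intro mult_mono) auto
      then show ?thesis using c by simp
    qed
    moreover have "cmod (Moebius_function 0 a z) < 1"
      using Moebius_function_norm_lt_1[of a z 0] a z by simp
    ultimately have "cmod (h (Moebius_function 0 a z)) \<le> cmod (Moebius_function 0 a z)"
      by (rule Schwarz_Lemma(1))
    then show ?thesis
      using Moebius_function_compose[of "- a" a z] a z c by (simp add: h_def rho_eq_Moebius norm_mult)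
  qed
  then have "\<forall>\<^sub>F c in at_left 1. c * cmod (F z) \<le> rho z a"
    using eventually_at_left_real[of 0 1] by (auto elim: eventually_mono)
  moreover have "((\<lambda>c. c * cmod (F z)) \<longlongrightarrow> 1 * cmod (F z)) (at_left 1)" by (intro tendsto_intros)
  ultimately have "1 * cmod (F z) \<le> rho z a" by (intro tendsto_upperbound[where F = "at_left 1"]) auto
  then show ?thesis by simp
qed

text \<open>By Schwarz--Pick the values of f at z and a have distance at most t. With s = |f(z)| the
  identity \<open>id\<close> turns this into (1 - t^2) (1 - s) \<le> (1 - |f(a)|^2) (1 + s). The
  first factor on the right is at most 2 (1 - |f(a)|), the second at most 2, and 1 - s^2 \<le> 2 (1
  - s): together this gives the 8.\<close>

lemma Schwarz_Pick_modulus: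
  assumes f: "f holomorphic_on unit_disc" and f1: "\<And>w. w \<in> unit_disc \<Longrightarrow> cmod (f w) < 1"
    and a: "a \<in> unit_disc" and z: "z \<in> unit_disc" and t: "rho z a \<le> t" "t < 1"
  shows "1 - (cmod (f z))\<^sup>2 \<le> 8 * (1 - cmod (f a)) / (1 - t\<^sup>2)"
proof -
  define c where "c = f a"
  have c1: "cmod c < 1" using f1[OF a] by (simp add: c_def)
  have t0: "0 \<le> t" using rho_nonneg[of z a] t by linarith
  have "(Moebius_function 0 c \<circ> f) holomorphic_on unit_disc"
    by (rule holomorphic_on_compose_gen[OF f Moebius_function_holomorphic[OF c1]]) (use f1 in auto)
  then have "cmod (Moebius_function 0 c (f z)) \<le> rho z a"
    using Schwarz_rho[of "\<lambda>w. Moebius_function 0 c (f w)" a z] Moebius_function_norm_lt_1[OF c1] f1 a z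
    by (auto simp: o_def c_def Moebius_function_eq_zero less_imp_le)
  then have "cmod (f z - c) / cmod (1 - cnj c * f z) \<le> t"
    using t by (simp add: Moebius_function_simple norm_divide)
  moreover have "1 - cnj c * f z \<noteq> 0"
  proof
    assume "1 - cnj c * f z = 0"
    then have "cmod (cnj c * f z) = 1" by simp
    moreover have "cmod c * cmod (f z) \<le> cmod c * 1" using f1[OF z] by (intro mult_left_mono) auto
    ultimately show False using c1 by (simp add: norm_mult)
  qed
  ultimately have le: "cmod (f z - c) \<le> t * cmod (1 - cnj c * f z)"
    by (simp add: divide_le_eq)
  define s where "s = cmod (f z)"
  have s: "0 \<le> s" "s < 1" using f1[OF z] by (auto simp: s_def)
  have id: "(cmod (1 - cnj c * f z))\<^sup>2 - (cmod (f z - c))\<^sup>2 = (1 - (cmod c)\<^sup>2) * (1 - s\<^sup>2)"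
  proof -
    have "complex_of_real ((cmod (1 - cnj c * f z))\<^sup>2 - (cmod (f z - c))\<^sup>2) = of_real ((1 - (cmod c)\<^sup>2) * (1 - s\<^sup>2))"
      unfolding s_def of_real_diff of_real_mult of_real_1 complex_norm_square by (simp add: algebra_simps)
    then show ?thesis by (simp only: of_real_eq_iff)
  qed
  have t2: "0 < 1 - t\<^sup>2" using t t0 abs_square_less_1[of t] by simp
  have "1 - s \<le> cmod (1 - cnj c * f z)"
  proof -
    have "cmod (cnj c * f z) \<le> 1 * s" unfolding norm_mult s_def using c1 by (intro mult_right_mono) auto
    then show ?thesis using norm_triangle_ineq2[of 1 "cnj c * f z"] by simp
  qed
  then have "(1 - t\<^sup>2) * (1 - s)\<^sup>2 \<le> (1 - t\<^sup>2) * (cmod (1 - cnj c * f z))\<^sup>2"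
    using t2 s by (intro mult_left_mono power_mono) auto
  also have "\<dots> \<le> (1 - (cmod c)\<^sup>2) * (1 - s\<^sup>2)"
  proof -
    have "(1 - t\<^sup>2) * (cmod (1 - cnj c * f z))\<^sup>2 = (cmod (1 - cnj c * f z))\<^sup>2 - (t * cmod (1 - cnj c * f z))\<^sup>2"
      by (simp add: left_diff_distrib power_mult_distrib)
    also have "\<dots> \<le> (cmod (1 - cnj c * f z))\<^sup>2 - (cmod (f z - c))\<^sup>2"
      using power_mono[OF le, of 2] by (intro diff_left_mono) auto
    finally show ?thesis unfolding id .
  qed
  also have "\<dots> = ((1 - (cmod c)\<^sup>2) * (1 + s)) * (1 - s)"
    by (simp add: power2_eq_square algebra_simps)
  finally have "((1 - t\<^sup>2) * (1 - s)) * (1 - s) \<le> ((1 - (cmod c)\<^sup>2) * (1 + s)) * (1 - s)"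
    by (simp only: power2_eq_square mult.assoc)
  then have "(1 - t\<^sup>2) * (1 - s) \<le> (1 - (cmod c)\<^sup>2) * (1 + s)"
    by (rule mult_right_le_imp_le) (use s in auto)
  also have "\<dots> \<le> (2 * (1 - cmod c)) * 2"
  proof (rule mult_mono)
    have "1 - (cmod c)\<^sup>2 = (1 + cmod c) * (1 - cmod c)" by (simp add: power2_eq_square algebra_simps)
    also have "\<dots> \<le> 2 * (1 - cmod c)" using c1 by (intro mult_right_mono) auto
    finally show "1 - (cmod c)\<^sup>2 \<le> 2 * (1 - cmod c)" .
  qed (use s c1 in auto)
  finally have A: "(1 - t\<^sup>2) * (1 - s) \<le> 4 * (1 - cmod c)" by simp
  have "1 - s\<^sup>2 = (1 + s) * (1 - s)" by (simp add: power2_eq_square algebra_simps)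
  also have "\<dots> \<le> 2 * (1 - s)" using s by (intro mult_right_mono) auto
  finally have "(1 - t\<^sup>2) * (1 - s\<^sup>2) \<le> (1 - t\<^sup>2) * (2 * (1 - s))" using t2 by (intro mult_left_mono) auto
  then have "(1 - t\<^sup>2) * (1 - s\<^sup>2) \<le> 8 * (1 - cmod c)" using A by linarith
  then show ?thesis using t2 by (simp add: s_def c_def pos_le_divide_eq mult.commute)
qed

section \<open>The two properties\<close>

lemma Hinf_holomorphic: "f \<in> carrier Hinf \<Longrightarrow> f holomorphic_on unit_disc"
  by (simp add: Hinf_carrier_iff)

lemma restrict_in_HinfI:
  assumes "f holomorphic_on unit_disc" "\<And>z. z \<in> unit_disc \<Longrightarrow> cmod (f z) \<le> B"
  shows "restrict f unit_disc \<in> carrier Hinf"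
proof (rule restrict_in_Hinf[OF assms(1)])
  show "bounded (f ` unit_disc)" unfolding bounded_iff using assms(2) by (intro exI[of _ B]) blast
qed

lemma cmod_le_sup_norm:
  assumes "f \<in> carrier Hinf" "z \<in> unit_disc"
  shows "cmod (f z) \<le> sup_norm f"
proof -
  obtain B where "\<And>w. w \<in> unit_disc \<Longrightarrow> cmod (f w) \<le> B" using Hinf_bound[OF assms(1)] by blast
  then show ?thesis unfolding sup_norm_def using assms(2) by (intro cSUP_upper bdd_aboveI2) auto
qed

lemma sup_norm_le:
  assumes "\<And>z. z \<in> unit_disc \<Longrightarrow> cmod (f z) \<le> B"
  shows "sup_norm f \<le> B"
  unfolding sup_norm_def using assms by (intro cSUP_least) auto

lemma sup_norm_nonneg: "f \<in> carrier Hinf \<Longrightarrow> 0 \<le> sup_norm f"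
  using order.trans[OF norm_ge_zero cmod_le_sup_norm[of f 0]] by simp

lemma quot_norm_le:
  assumes "C \<subseteq> carrier Hinf" "h \<in> C"
  shows "quot_norm C \<le> sup_norm h"
  unfolding quot_norm_def using assms sup_norm_nonneg by (intro cINF_lower bdd_belowI2[of _ 0]) auto

lemma quot_norm_less_obtain:
  assumes "C \<noteq> {}" "C \<subseteq> carrier Hinf" "quot_norm C < b"
  obtains h where "h \<in> C" "sup_norm h < b"
proof -
  have "bdd_below (sup_norm ` C)" using assms(2) sup_norm_nonneg by (intro bdd_belowI2[of _ 0]) auto
  then show ?thesis
    using assms(1,3) that unfolding quot_norm_def by (subst (asm) cINF_less_iff) auto
qed

lemma ideal_PIdl_Hinf: "\<Theta> \<in> carrier Hinf \<Longrightarrow> ideal (PIdl\<^bsub>Hinf\<^esub> \<Theta>) Hinf"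
  by (rule cring.cgenideal_ideal[OF cring_Hinf])

lemma mem_quot_class:
  assumes "\<Theta> \<in> carrier Hinf" "f \<in> carrier Hinf"
  shows "h \<in> quot_class \<Theta> f \<longleftrightarrow>
    h \<in> carrier Hinf \<and> (\<exists>g\<in>carrier Hinf. \<forall>z\<in>unit_disc. h z = f z + g z * \<Theta> z)"
proof -
  have "quot_class \<Theta> f = (\<lambda>g. g \<otimes>\<^bsub>Hinf\<^esub> \<Theta> \<oplus>\<^bsub>Hinf\<^esub> f) ` carrier Hinf"
    by (auto simp: quot_class_def a_r_coset_def' cgenideal_def)
  moreover have "h = g \<otimes>\<^bsub>Hinf\<^esub> \<Theta> \<oplus>\<^bsub>Hinf\<^esub> f \<longleftrightarrow> h \<in> carrier Hinf \<and> (\<forall>z\<in>unit_disc. h z = f z + g z * \<Theta> z)"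
    if g: "g \<in> carrier Hinf" for g
  proof
    assume "h \<in> carrier Hinf \<and> (\<forall>z\<in>unit_disc. h z = f z + g z * \<Theta> z)"
    then show "h = g \<otimes>\<^bsub>Hinf\<^esub> \<Theta> \<oplus>\<^bsub>Hinf\<^esub> f"
      using assms g by (intro Hinf_ext) (auto simp: Hinf_mult_closed Hinf_add_closed Hinf_apply)
  qed (use assms g in \<open>auto simp: Hinf_mult_closed Hinf_add_closed Hinf_apply\<close>)
  ultimately show ?thesis by auto
qed

lemma quot_class_self:
  assumes "\<Theta> \<in> carrier Hinf" "f \<in> carrier Hinf"
  shows "f \<in> quot_class \<Theta> f"
  unfolding mem_quot_class[OF assms] using assms(2) Hinf_zero_closed
  by (auto intro!: bexI[of _ "\<zero>\<^bsub>Hinf\<^esub>"] simp: Hinf_apply)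

lemma quot_class_subset: "\<Theta> \<in> carrier Hinf \<Longrightarrow> f \<in> carrier Hinf \<Longrightarrow> quot_class \<Theta> f \<subseteq> carrier Hinf"
  using mem_quot_class by auto

lemma quot_class_eqI:
  assumes "\<Theta> \<in> carrier Hinf" "f \<in> carrier Hinf" "g \<in> quot_class \<Theta> f"
  shows "quot_class \<Theta> f = quot_class \<Theta> g"
proof -
  interpret ideal "PIdl\<^bsub>Hinf\<^esub> \<Theta>" Hinf by (rule ideal_PIdl_Hinf[OF assms(1)])
  show ?thesis using a_repr_independence' assms(2,3) by (simp add: quot_class_def)
qed

lemma carrier_Hinf_quot: "carrier (Hinf_quot \<Theta>) = quot_class \<Theta> ` carrier Hinf"
  by (auto simp: Hinf_quot_def FactRing_def A_RCOSETS_def' quot_class_def)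

lemma one_Hinf_quot: "\<one>\<^bsub>Hinf_quot \<Theta>\<^esub> = quot_class \<Theta> \<one>\<^bsub>Hinf\<^esub>"
  by (simp add: Hinf_quot_def FactRing_def quot_class_def)

lemma mult_Hinf_quot:
  assumes "\<Theta> \<in> carrier Hinf" "f \<in> carrier Hinf" "g \<in> carrier Hinf"
  shows "quot_class \<Theta> f \<otimes>\<^bsub>Hinf_quot \<Theta>\<^esub> quot_class \<Theta> g = quot_class \<Theta> (f \<otimes>\<^bsub>Hinf\<^esub> g)"
  using ideal.rcoset_mult_add[OF ideal_PIdl_Hinf[OF assms(1)] assms(2,3)]
  by (simp add: Hinf_quot_def FactRing_def quot_class_def)

lemma cring_Hinf_quot: "\<Theta> \<in> carrier Hinf \<Longrightarrow> cring (Hinf_quot \<Theta>)"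
  unfolding Hinf_quot_def by (rule ideal.quotient_is_cring[OF ideal_PIdl_Hinf cring_Hinf])

text \<open>Invertibility in the quotient as a Bezout equation on the disc, the form in which both
  implications use it.\<close>

lemma quot_class_inverse_iff:
  assumes "\<Theta> \<in> carrier Hinf" "f \<in> carrier Hinf" "g \<in> carrier Hinf"
  shows "quot_class \<Theta> f \<otimes>\<^bsub>Hinf_quot \<Theta>\<^esub> quot_class \<Theta> g = \<one>\<^bsub>Hinf_quot \<Theta>\<^esub> \<longleftrightarrow>
    (\<exists>h\<in>carrier Hinf. \<forall>z\<in>unit_disc. f z * g z + h z * \<Theta> z = 1)"
proof -
  have fg: "f \<otimes>\<^bsub>Hinf\<^esub> g \<in> carrier Hinf" using assms by (intro Hinf_mult_closed)
  have "quot_class \<Theta> (f \<otimes>\<^bsub>Hinf\<^esub> g) = quot_class \<Theta> \<one>\<^bsub>Hinf\<^esub> \<longleftrightarrow> \<one>\<^bsub>Hinf\<^esub> \<in> quot_class \<Theta> (f \<otimes>\<^bsub>Hinf\<^esub> g)"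
    using quot_class_self[OF assms(1) Hinf_one_closed] quot_class_eqI[OF assms(1) fg] by auto
  also have "\<dots> \<longleftrightarrow> (\<exists>h\<in>carrier Hinf. \<forall>z\<in>unit_disc. f z * g z + h z * \<Theta> z = 1)"
    unfolding mem_quot_class[OF assms(1) fg] using Hinf_one_closed by (simp add: Hinf_apply eq_commute[of 1])
  finally show ?thesis unfolding mult_Hinf_quot[OF assms] one_Hinf_quot .
qed

text \<open>MAG for inner functions without extended reals; an empty zero set is covered by the
  vacuous inner quantifier.\<close>

definition tends_to_unimodular :: "(complex \<Rightarrow> complex) \<Rightarrow> bool" where
  "tends_to_unimodular \<Theta> \<longleftrightarrow> (\<forall>\<kappa>>0. \<exists>t\<in>{0<..<1}. \<forall>z\<in>unit_disc.
    (\<forall>a\<in>zeros \<Theta>. t \<le> rho z a) \<longrightarrow> 1 - \<kappa> \<le> cmod (\<Theta> z))"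

lemma eta_ge_iff:
  "ereal c \<le> eta \<Theta> t \<longleftrightarrow> (\<forall>z\<in>unit_disc. (\<forall>a\<in>zeros \<Theta>. t \<le> rho z a) \<longrightarrow> c \<le> cmod (\<Theta> z))"
  by (auto simp: eta_def rho_set_def le_INF_iff)

lemma eta_mono: "s \<le> t \<Longrightarrow> eta \<Theta> s \<le> eta \<Theta> t"
  unfolding eta_def rho_set_def by (intro INF_superset_mono) (auto simp: le_INF_iff intro: order.trans)

text \<open>The point is that the infimum is not over the empty set. Otherwise every point would be
  within t of a zero, and Schwarz's lemma would give |\<Theta>| \<le> t < 1 on the whole disc,
  against the radial limits of modulus 1.\<close>

lemma eta_le_1:
  assumes \<Theta>: "inner_function \<Theta>" and t: "t < 1"
  shows "eta \<Theta> t \<le> 1"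
proof -
  have "\<exists>z\<in>unit_disc. \<forall>a\<in>zeros \<Theta>. t \<le> rho z a"
  proof (rule ccontr)
    assume none: "\<not> ?thesis"
    have le: "cmod (\<Theta> z) \<le> t" if z: "z \<in> unit_disc" for z
    proof -
      obtain a where a: "a \<in> zeros \<Theta>" "rho z a < t" using none z by (meson not_le)
      have "cmod (\<Theta> z) \<le> rho z a"
        using a z inner_function_le_1[OF \<Theta>]
        by (intro Schwarz_rho inner_function_holomorphic[OF \<Theta>]) (auto simp: zeros_def)
      then show ?thesis using a by simp
    qed
    have "AE t in lebesgue_on {0..2 * pi}. False"
      using inner_function_radii[OF \<Theta>]
    proof eventually_elim
      fix s assume lim: "(\<lambda>n. cmod (\<Theta> (of_real (1 - 1 / (real n + 2)) * cis s))) \<longlonglongrightarrow> 1"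
      have "cmod (\<Theta> (of_real (1 - 1 / (real n + 2)) * cis s)) \<le> t" for n
      proof (rule le)
        have "cmod (of_real (1 - 1 / (real n + 2)) * cis s) = \<bar>1 - 1 / (real n + 2)\<bar>"
          by (simp only: norm_mult norm_of_real norm_cis mult_1_right)
        moreover have "\<bar>1 - 1 / (real n + 2)\<bar> < 1" by (simp add: field_simps)
        ultimately show "of_real (1 - 1 / (real n + 2)) * cis s \<in> unit_disc" by (simp only: mem_ball_0)
      qed
      then have "1 \<le> t" using LIMSEQ_le_const2[OF lim] by blast
      then show False using t by simp
    qed
    then have "ae_filter (lebesgue_on {0..2 * pi}) = bot" by (simp only: eventually_False)
    then show False by (simp add: ae_filter_eq_bot_iff emeasure_restrict_space)
  qed
  then obtain z where z: "z \<in> unit_disc" "\<forall>a\<in>zeros \<Theta>. t \<le> rho z a" by blast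
  have "eta \<Theta> t \<le> ereal (cmod (\<Theta> z))"
    unfolding eta_def using z by (intro INF_lower) (auto simp: rho_set_def le_INF_iff)
  also have "\<dots> \<le> 1" using inner_function_le_1[OF \<Theta> z(1)] by simp
  finally show ?thesis .
qed

text \<open>As \<open>eta\<close> is monotone and at most 1, its limit and its supremum are 1 as
  soon as it exceeds every number below 1.\<close>

lemma MAG_iff:
  assumes \<Theta>: "inner_function \<Theta>"
  shows "MAG \<Theta> \<longleftrightarrow> tends_to_unimodular \<Theta>"
proof
  assume "MAG \<Theta>"
  then have sup: "(SUP t\<in>{0<..<1}. eta \<Theta> t) = 1" by (simp add: MAG_def)
  show "tends_to_unimodular \<Theta>"
    unfolding tends_to_unimodular_def
  proof (intro allI impI)
    fix \<kappa> :: real assume "0 < \<kappa>"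
    then have "ereal (1 - \<kappa>) < (SUP t\<in>{0<..<1}. eta \<Theta> t)" unfolding sup by simp
    then obtain t where "t \<in> {0<..<1}" "ereal (1 - \<kappa>) < eta \<Theta> t" by (auto simp: less_SUP_iff)
    then show "\<exists>t\<in>{0<..<1}. \<forall>z\<in>unit_disc. (\<forall>a\<in>zeros \<Theta>. t \<le> rho z a) \<longrightarrow> 1 - \<kappa> \<le> cmod (\<Theta> z)"
      using eta_ge_iff[of "1 - \<kappa>" \<Theta> t] less_imp_le by blast
  qed
next
  assume u: "tends_to_unimodular \<Theta>"
  have ev: "\<forall>\<^sub>F t in at_left 1. 0 < t \<and> t < (1 :: real)"
    using eventually_at_left_real[of 0 1] by (auto elim: eventually_mono)
  have lim: "(eta \<Theta> \<longlongrightarrow> 1) (at_left 1)"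
  proof (rule order_tendstoI)
    fix a :: ereal assume "a < 1"
    then obtain c :: real where c: "a < ereal c" "c < 1"
      using ereal_dense2[of a 1] by (auto simp: one_ereal_def)
    then obtain t where t: "t \<in> {0<..<1}" "\<forall>z\<in>unit_disc. (\<forall>a\<in>zeros \<Theta>. t \<le> rho z a) \<longrightarrow> c \<le> cmod (\<Theta> z)"
      using u[unfolded tends_to_unimodular_def, rule_format, of "1 - c"] by auto
    have "a < eta \<Theta> s" if "t \<le> s" for s
      using c(1) t(2) eta_ge_iff[of c \<Theta> t] eta_mono[OF that, of \<Theta>] by (meson less_le_trans)
    moreover have "\<forall>\<^sub>F s in at_left 1. t \<le> s"
      using t(1) eventually_at_left_real[of t 1] by (auto elim: eventually_mono)
    ultimately show "\<forall>\<^sub>F s in at_left 1. a < eta \<Theta> s" by (auto elim: eventually_mono)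
  next
    fix a :: ereal assume "1 < a"
    then show "\<forall>\<^sub>F s in at_left 1. eta \<Theta> s < a"
      using ev by (auto elim!: eventually_mono intro: le_less_trans[OF eta_le_1[OF \<Theta>]])
  qed
  moreover have "(SUP t\<in>{0<..<1}. eta \<Theta> t) = 1"
  proof (rule antisym)
    show "(SUP t\<in>{0<..<1}. eta \<Theta> t) \<le> 1" by (intro SUP_least eta_le_1[OF \<Theta>]) auto
    have "\<forall>\<^sub>F s in at_left 1. eta \<Theta> s \<le> (SUP t\<in>{0<..<1}. eta \<Theta> t)"
      using ev by (auto elim!: eventually_mono intro: SUP_upper)
    then show "1 \<le> (SUP t\<in>{0<..<1}. eta \<Theta> t)" using lim by (intro tendsto_upperbound[OF lim]) auto
  qed
  ultimately show "MAG \<Theta>" by (simp add: MAG_def)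
qed

section \<open>The two implications\<close>

lemma SIP_imp_MAG:
  assumes \<Theta>: "inner_function \<Theta>" and sip: "SIP \<Theta>"
  shows "MAG \<Theta>"
  unfolding MAG_iff[OF \<Theta>] tends_to_unimodular_def
proof (intro allI impI)
  fix \<kappa> :: real assume \<kappa>: "0 < \<kappa>"
  have TH: "\<Theta> \<in> carrier Hinf" using \<Theta> by (simp add: inner_function_def)
  define \<epsilon> where "\<epsilon> = \<kappa> / 4"
  have \<epsilon>: "0 < \<epsilon>" using \<kappa> by (simp add: \<epsilon>_def)
  obtain \<delta> where \<delta>: "0 < \<delta>" and sipD: "\<And>f. f \<in> carrier Hinf \<Longrightarrow> quot_norm (quot_class \<Theta> f) \<le> 1 \<Longrightarrow>
      (INF z\<in>zeros \<Theta>. ereal (cmod (f z))) \<ge> ereal (1 - \<delta>) \<Longrightarrow>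
      quot_class \<Theta> f \<in> Units (Hinf_quot \<Theta>) \<and> quot_norm (m_inv (Hinf_quot \<Theta>) (quot_class \<Theta> f)) \<le> 1 + \<epsilon>"
    using sip \<epsilon> unfolding SIP_def by metis
  show "\<exists>t\<in>{0<..<1}. \<forall>z\<in>unit_disc. (\<forall>a\<in>zeros \<Theta>. t \<le> rho z a) \<longrightarrow> 1 - \<kappa> \<le> cmod (\<Theta> z)"
  \<comment> \<open>The alternative 1/2 keeps the threshold positive when \<delta> is 1 or
    larger.\<close>
  proof (intro bexI[of _ "max (1 / 2) (1 - \<delta>)"] ballI impI)
    fix z assume z: "z \<in> unit_disc" and far: "\<forall>a\<in>zeros \<Theta>. max (1 / 2) (1 - \<delta>) \<le> rho z a"
    define f where "f = restrict (Moebius_function 0 z) unit_disc"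
    have f1: "cmod (f w) \<le> 1" if "w \<in> unit_disc" for w
      using Moebius_function_norm_lt_1[of z w 0] z that by (simp add: f_def less_imp_le)
    have f: "f \<in> carrier Hinf"
      unfolding f_def
    proof (rule restrict_in_HinfI)
      show "Moebius_function 0 z holomorphic_on unit_disc" using z by (intro Moebius_function_holomorphic) simp
      show "cmod (Moebius_function 0 z w) \<le> 1" if "w \<in> unit_disc" for w
        using f1[OF that] that by (simp add: f_def)
    qed
    have "quot_norm (quot_class \<Theta> f) \<le> sup_norm f"
      by (intro quot_norm_le quot_class_subset quot_class_self TH f)
    also have "\<dots> \<le> 1" by (intro sup_norm_le f1)
    finally have "quot_norm (quot_class \<Theta> f) \<le> 1" .
    moreover have "(INF a\<in>zeros \<Theta>. ereal (cmod (f a))) \<ge> ereal (1 - \<delta>)"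
      using far rho_commute by (auto simp: le_INF_iff f_def zeros_def rho_eq_Moebius)
    ultimately have unit: "quot_class \<Theta> f \<in> Units (Hinf_quot \<Theta>)"
      and inv: "quot_norm (m_inv (Hinf_quot \<Theta>) (quot_class \<Theta> f)) \<le> 1 + \<epsilon>"
      using sipD[OF f] by auto
    interpret Q: cring "Hinf_quot \<Theta>" by (rule cring_Hinf_quot[OF TH])
    let ?C = "m_inv (Hinf_quot \<Theta>) (quot_class \<Theta> f)"
    have "?C \<in> carrier (Hinf_quot \<Theta>)" using unit by (rule Q.Units_inv_closed)
    then obtain g0 where g0: "g0 \<in> carrier Hinf" "?C = quot_class \<Theta> g0" by (auto simp: carrier_Hinf_quot)
    obtain g where g: "g \<in> ?C" "sup_norm g < 1 + 2 * \<epsilon>"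
    proof (rule quot_norm_less_obtain)
      show "?C \<noteq> {}" using g0 quot_class_self[OF TH g0(1)] by auto
      show "?C \<subseteq> carrier Hinf" unfolding g0 by (rule quot_class_subset[OF TH g0(1)])
      show "quot_norm ?C < 1 + 2 * \<epsilon>" using inv \<epsilon> by simp
    qed
    have gc: "g \<in> carrier Hinf" using g(1) quot_class_subset[OF TH g0(1)] g0(2) by auto
    have "?C = quot_class \<Theta> g" using g(1) quot_class_eqI[OF TH g0(1)] g0(2) by simp
    then have "quot_class \<Theta> f \<otimes>\<^bsub>Hinf_quot \<Theta>\<^esub> quot_class \<Theta> g = \<one>\<^bsub>Hinf_quot \<Theta>\<^esub>"
      using Q.Units_r_inv[OF unit] by simp
    then obtain h where h: "h \<in> carrier Hinf" "\<And>w. w \<in> unit_disc \<Longrightarrow> f w * g w + h w * \<Theta> w = 1"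
      unfolding quot_class_inverse_iff[OF TH f gc] by blast
    \<comment> \<open>From |f g| \<le> 1 + 2\<epsilon> the real part of 1 - f g is at least
      -2\<epsilon>. A shift by twice that amount makes the real part at least 2\<epsilon> and does
      not decrease the modulus. At the zero z of f it costs only 1 + 4\<epsilon> = 1 +
      \<kappa>.\<close>
    define q where "q w = 1 - f w * g w + of_real (4 * \<epsilon>)" for w
    have fg: "cmod (f w * g w) \<le> 1 + 2 * \<epsilon>" if "w \<in> unit_disc" for w
    proof -
      have "cmod (g w) \<le> 1 + 2 * \<epsilon>" using cmod_le_sup_norm[OF gc that] g(2) by simp
      then have "cmod (f w) * cmod (g w) \<le> 1 * (1 + 2 * \<epsilon>)" using f1[OF that] by (intro mult_mono) auto
      then show ?thesis by (simp add: norm_mult)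
    qed
    have Re_q: "2 * \<epsilon> \<le> Re (q w)" if "w \<in> unit_disc" for w
      using fg[OF that] complex_Re_le_cmod[of "f w * g w"] unfolding q_def by simp
    have q0: "q w \<noteq> 0" "2 * \<epsilon> \<le> cmod (q w)" if "w \<in> unit_disc" for w
      using Re_q[OF that] \<epsilon> complex_Re_le_cmod[of "q w"] by auto
    have q_ge: "cmod (1 - f w * g w) \<le> cmod (q w)" if "w \<in> unit_disc" for w
    proof -
      have "\<bar>Re (1 - f w * g w)\<bar> \<le> \<bar>Re (q w)\<bar>" using Re_q[OF that] \<epsilon> unfolding q_def by simp
      moreover have "Im (1 - f w * g w) = Im (q w)" by (simp add: q_def)
      ultimately show ?thesis unfolding cmod_def by (intro real_sqrt_le_mono add_mono) (auto simp: abs_le_square_iff)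
    qed
    obtain B where B: "\<And>w. w \<in> unit_disc \<Longrightarrow> cmod (h w) \<le> B" "1 \<le> B" using Hinf_bound[OF h(1)] by blast
    have "cmod (h z / q z) \<le> 1"
    proof (rule inner_function_divide_le_1[OF \<Theta> _ _ _ z])
      show "(\<lambda>w. h w / q w) holomorphic_on unit_disc"
        unfolding q_def using q0(1) Hinf_holomorphic[OF h(1)] Hinf_holomorphic[OF f] Hinf_holomorphic[OF gc]
        by (intro holomorphic_intros) (auto simp: q_def)
      show "cmod (h w / q w) \<le> B / (2 * \<epsilon>)" if "w \<in> unit_disc" for w
        unfolding norm_divide using B q0(2)[OF that] that \<epsilon> by (intro frac_le) auto
      show "cmod (\<Theta> w * (h w / q w)) \<le> 1" if "w \<in> unit_disc" for w
      proof -
        have "\<Theta> w * h w = 1 - f w * g w" using h(2)[OF that] by (simp add: algebra_simps)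
        then have "cmod (\<Theta> w * (h w / q w)) = cmod (1 - f w * g w) / cmod (q w)"
          by (simp add: norm_divide)
        also have "\<dots> \<le> 1" using q_ge[OF that] q0(1)[OF that] by simp
        finally show ?thesis .
      qed
    qed
    moreover have fz: "f z = 0" using z by (simp add: f_def Moebius_function_eq_zero)
    moreover have "cmod (q z) = 1 + 4 * \<epsilon>"
    proof -
      have "q z = of_real (1 + 4 * \<epsilon>)" by (simp add: q_def fz)
      then show ?thesis using \<epsilon> norm_of_real[of "1 + 4 * \<epsilon>", where 'a = complex] by simp
    qed
    ultimately have hz: "cmod (h z) \<le> 1 + \<kappa>"
      using \<kappa> by (simp add: norm_divide \<epsilon>_def divide_le_eq)
    have "h z * \<Theta> z = 1" using h(2)[OF z] fz by simp
    then have "1 = cmod (h z) * cmod (\<Theta> z)" by (metis norm_mult norm_one)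
    also have "\<dots> \<le> (1 + \<kappa>) * cmod (\<Theta> z)" using hz by (intro mult_right_mono) auto
    finally have "1 \<le> (1 + \<kappa>) * cmod (\<Theta> z)" .
    moreover have "(1 + \<kappa>) * (1 - \<kappa>) \<le> 1" by (simp add: algebra_simps)
    ultimately have "(1 + \<kappa>) * (1 - \<kappa>) \<le> (1 + \<kappa>) * cmod (\<Theta> z)" by (rule order.trans[rotated])
    with \<kappa> show "1 - \<kappa> \<le> cmod (\<Theta> z)" by simp
  qed (use \<delta> in auto)
qed

lemma MAG_imp_SIP:
  assumes \<Theta>: "inner_function \<Theta>" and mag: "MAG \<Theta>"
  shows "SIP \<Theta>"
  unfolding SIP_def
proof (intro allI impI)
  fix \<epsilon> :: real assume \<epsilon>: "0 < \<epsilon>"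
  have TH: "\<Theta> \<in> carrier Hinf" using \<Theta> by (simp add: inner_function_def)
  note \<Theta>1 = inner_function_le_1[OF \<Theta>] and \<Theta>h = inner_function_holomorphic[OF \<Theta>]
  \<comment> \<open>Solves 1 / sqrt (1 - e) = 1 + \<epsilon>, so that the bound of
    \<open>corona_sharp\<close> becomes the required one.\<close>
  define e where "e = 1 - 1 / (1 + \<epsilon>)\<^sup>2"
  have e: "0 < e" "e < 1" "1 / sqrt (1 - e) = 1 + \<epsilon>"
  proof -
    have "1 < (1 + \<epsilon>)\<^sup>2" using \<epsilon> by (simp add: one_less_power)
    then show "0 < e" by (simp add: e_def divide_less_eq)
    show "e < 1" using \<epsilon> by (simp add: e_def)
    show "1 / sqrt (1 - e) = 1 + \<epsilon>" using \<epsilon> by (simp add: e_def real_sqrt_divide)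
  qed
  have E: "0 < energy_const + 1" using carleson_const_nonneg by (simp add: energy_const_def)
  \<comment> \<open>Chosen to make the condition of \<open>corona_sharp\<close> on k an
    equality.\<close>
  define k where "k = exp (- ((2 * (energy_const + 1) / e)\<^sup>2)) / 2"
  have lnk: "- ln (2 * k) = (2 * (energy_const + 1) / e)\<^sup>2" by (simp add: k_def)
  have k: "0 < k" "2 * k < 1" "(energy_const + 1) / sqrt (- ln (2 * k)) \<le> e / 2"
  proof -
    show "0 < k" by (simp add: k_def)
    show "2 * k < 1" using E e by (simp add: k_def)
    have "sqrt (- ln (2 * k)) = 2 * (energy_const + 1) / e" unfolding lnk using E e by simp
    then show "(energy_const + 1) / sqrt (- ln (2 * k)) \<le> e / 2"
      using E e by (simp only:) (simp add: field_simps)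
  qed
  \<comment> \<open>Half of k, because |\<Theta>| \<ge> 1 - k/2 gives |\<Theta>|^2 \<ge> 1 -
    k.\<close>
  obtain t where t: "0 < t" "t < 1" "\<And>z. z \<in> unit_disc \<Longrightarrow> \<forall>a\<in>zeros \<Theta>. t \<le> rho z a \<Longrightarrow> 1 - k / 2 \<le> cmod (\<Theta> z)"
    using mag[unfolded MAG_iff[OF \<Theta>] tends_to_unimodular_def, rule_format, of "k / 2"] k(1) by auto
  \<comment> \<open>The deficit of |f| at the zeros that \<open>Schwarz_Pick_modulus\<close>
    enlarges to exactly k within distance t.\<close>
  define \<eta> where "\<eta> = k * (1 - t\<^sup>2) / 8"
  have t2: "0 < 1 - t\<^sup>2" using t abs_square_less_1[of t] by simp
  have \<eta>: "0 < \<eta>" using t2 k by (simp add: \<eta>_def)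
  show "\<exists>\<delta>>0. \<forall>f\<in>carrier Hinf.
      quot_norm (quot_class \<Theta> f) \<le> 1 \<and> (INF z\<in>zeros \<Theta>. ereal (cmod (f z))) \<ge> ereal (1 - \<delta>) \<longrightarrow>
      quot_class \<Theta> f \<in> Units (Hinf_quot \<Theta>) \<and> quot_norm (m_inv (Hinf_quot \<Theta>) (quot_class \<Theta> f)) \<le> 1 + \<epsilon>"
  proof (intro exI[of _ "\<eta> / 2"] conjI ballI impI)
    show "0 < \<eta> / 2" using \<eta> by simp
    fix f assume f: "f \<in> carrier Hinf"
      and hyp: "quot_norm (quot_class \<Theta> f) \<le> 1 \<and> (INF z\<in>zeros \<Theta>. ereal (cmod (f z))) \<ge> ereal (1 - \<eta> / 2)"
    have fz: "1 - \<eta> / 2 \<le> cmod (f z)" if "z \<in> zeros \<Theta>" for z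
      using hyp that by (auto simp: le_INF_iff)
    obtain f1 where f1: "f1 \<in> quot_class \<Theta> f" "sup_norm f1 < 1 + \<eta> / 2"
    proof (rule quot_norm_less_obtain)
      show "quot_class \<Theta> f \<noteq> {}" using quot_class_self[OF TH f] by auto
      show "quot_class \<Theta> f \<subseteq> carrier Hinf" by (rule quot_class_subset[OF TH f])
      show "quot_norm (quot_class \<Theta> f) < 1 + \<eta> / 2" using hyp \<eta> by linarith
    qed
    have f1c: "f1 \<in> carrier Hinf" using f1 quot_class_subset[OF TH f] by auto
    have cls: "quot_class \<Theta> f = quot_class \<Theta> f1" by (rule quot_class_eqI[OF TH f f1(1)])
    have f1z: "f1 z = f z" if "z \<in> zeros \<Theta>" for z
      using f1(1) that unfolding mem_quot_class[OF TH f] by (auto simp: zeros_def)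
    \<comment> \<open>The quotient norm need not be attained, so a representative may exceed norm 1
      slightly. Division by \<open>c\<close> makes it less than 1 everywhere, and (1 - \<eta>) c
      \<le> 1 - \<eta>/2 keeps the deficit at the zeros within \<eta>; this fixes \<delta> =
      \<eta>/2.\<close>
    define c where "c = 1 + \<eta> / 2"
    have c: "0 < c" using \<eta> by (simp add: c_def)
    define f2 where "f2 z = f1 z / of_real c" for z
    have f2h: "f2 holomorphic_on unit_disc"
      unfolding f2_def[abs_def] using c Hinf_holomorphic[OF f1c] by (intro holomorphic_intros) auto
    have f2n: "cmod (f2 z) = cmod (f1 z) / c" for z using c by (simp add: f2_def norm_divide)
    have f2l: "cmod (f2 z) < 1" if "z \<in> unit_disc" for z
      using cmod_le_sup_norm[OF f1c that] f1(2) c unfolding f2n c_def by simp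
    have f2a: "1 - cmod (f2 a) \<le> \<eta>" if "a \<in> zeros \<Theta>" for a
    proof -
      have "(1 - \<eta>) * c \<le> 1 - \<eta> / 2" using \<eta> by (simp add: c_def algebra_simps)
      also have "\<dots> \<le> cmod (f1 a)" using fz[OF that] f1z[OF that] by simp
      finally have "1 - \<eta> \<le> cmod (f2 a)" unfolding f2n using c by (simp add: pos_le_divide_eq)
      then show ?thesis by simp
    qed
    have dich: "1 - (cmod (f2 z))\<^sup>2 \<le> k \<or> 1 - (cmod (\<Theta> z))\<^sup>2 \<le> k" if z: "z \<in> unit_disc" for z
    proof (cases "\<forall>a\<in>zeros \<Theta>. t \<le> rho z a")
      case True
      have "1 - k / 2 \<le> cmod (\<Theta> z)" by (rule t(3)[OF z True])
      then have "(1 - k / 2)\<^sup>2 \<le> (cmod (\<Theta> z))\<^sup>2" using k by (intro power_mono) auto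
      moreover have "1 - k \<le> (1 - k / 2)\<^sup>2" by (simp add: power2_eq_square algebra_simps)
      ultimately have "1 - k \<le> (cmod (\<Theta> z))\<^sup>2" by (rule order.trans[rotated])
      then show ?thesis by simp
    next
      case False
      then obtain a where a: "a \<in> zeros \<Theta>" "rho z a \<le> t" by (auto simp: not_le less_imp_le)
      have ad: "a \<in> unit_disc" using a by (simp add: zeros_def)
      have "1 - (cmod (f2 z))\<^sup>2 \<le> 8 * (1 - cmod (f2 a)) / (1 - t\<^sup>2)"
        by (rule Schwarz_Pick_modulus[OF f2h f2l ad z a(2) t(2)])
      also have "\<dots> \<le> 8 * \<eta> / (1 - t\<^sup>2)" using f2a[OF a(1)] t2 by (intro divide_right_mono mult_left_mono) auto
      also have "\<dots> = k" using t2 by (simp add: \<eta>_def)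
      finally show ?thesis by simp
    qed
    obtain G H B where G: "G holomorphic_on unit_disc" "H holomorphic_on unit_disc"
      "\<And>w. w \<in> unit_disc \<Longrightarrow> cmod (G w) \<le> 1 / sqrt (1 - e)"
      "\<And>w. w \<in> unit_disc \<Longrightarrow> cmod (H w) \<le> B"
      "\<And>w. w \<in> unit_disc \<Longrightarrow> f2 w * G w + \<Theta> w * H w = 1"
      using corona_sharp[OF f2h \<Theta>h less_imp_le[OF f2l] \<Theta>1 k(1,2) dich e(1,2) k(3)] by blast
    define g where "g = restrict (\<lambda>w. G w / of_real c) unit_disc"
    define h where "h = restrict H unit_disc"
    have Gc: "cmod (G w / of_real c) \<le> 1 + \<epsilon>" if "w \<in> unit_disc" for w
    proof -
      have "cmod (G w / of_real c) = cmod (G w) / c" using c by (simp add: norm_divide)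
      also have "\<dots> \<le> cmod (G w) / 1" using \<eta> by (intro divide_left_mono) (auto simp: c_def)
      finally show ?thesis using G(3)[OF that] e(3) by simp
    qed
    have g: "g \<in> carrier Hinf"
      unfolding g_def using c by (intro restrict_in_HinfI[OF _ Gc] holomorphic_intros G(1)) auto
    have h: "h \<in> carrier Hinf"
      unfolding h_def by (rule restrict_in_HinfI[OF G(2,4)])
    have "f1 w * g w + h w * \<Theta> w = 1" if "w \<in> unit_disc" for w
      using G(5)[OF that] that by (simp add: f2_def g_def h_def mult.commute)
    then have fg: "quot_class \<Theta> f \<otimes>\<^bsub>Hinf_quot \<Theta>\<^esub> quot_class \<Theta> g = \<one>\<^bsub>Hinf_quot \<Theta>\<^esub>"
      unfolding cls quot_class_inverse_iff[OF TH f1c g] using h by blast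
    interpret Q: cring "Hinf_quot \<Theta>" by (rule cring_Hinf_quot[OF TH])
    have car: "quot_class \<Theta> f \<in> carrier (Hinf_quot \<Theta>)" "quot_class \<Theta> g \<in> carrier (Hinf_quot \<Theta>)"
      using f g by (auto simp: carrier_Hinf_quot)
    have gf: "quot_class \<Theta> g \<otimes>\<^bsub>Hinf_quot \<Theta>\<^esub> quot_class \<Theta> f = \<one>\<^bsub>Hinf_quot \<Theta>\<^esub>"
      using fg Q.m_comm[OF car] by simp
    show "quot_class \<Theta> f \<in> Units (Hinf_quot \<Theta>)"
      unfolding Units_def using car fg gf by blast
    have inv: "m_inv (Hinf_quot \<Theta>) (quot_class \<Theta> f) = quot_class \<Theta> g"
      by (rule Q.inv_char[OF car fg gf])
    have "quot_norm (quot_class \<Theta> g) \<le> sup_norm g"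
      by (intro quot_norm_le quot_class_subset quot_class_self TH g)
    also have "\<dots> \<le> 1 + \<epsilon>" by (intro sup_norm_le) (simp add: g_def Gc)
    finally show "quot_norm (m_inv (Hinf_quot \<Theta>) (quot_class \<Theta> f)) \<le> 1 + \<epsilon>" unfolding inv .
  qed
qed

theorem theorem1p2:
  fixes \<Theta> :: "complex \<Rightarrow> complex"
  assumes "inner_function \<Theta>"
  shows "SIP \<Theta> \<longleftrightarrow> MAG \<Theta>"
  using SIP_imp_MAG[OF assms] MAG_imp_SIP[OF assms] by blast

end
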